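(* Let $R$ be a commutative ring, $n\ge2$, and let $\varphi$ be a $2n\times2n$ alternating matrix over $R$ with Pfaffian $1$. Let $\theta(X)\in{\rm SL}_{2n-1}(R[X])$ with $\theta(0)=I_{2n-1}$. If for every maximal ideal $\mathfrak m$ of $R$ the image $\theta(X)_{\mathfrak m}$ of $\theta(X)$ over $R_{\mathfrak m}[X]$ lies in ${\rm E}_{\varphi\otimes R_{\mathfrak m}[X]}(R_{\mathfrak m}[X])$, then $\theta(X)\in{\rm E}_{\varphi\otimes R[X]}(R[X])$.
   Context: All rings are commutative with identity; $R_{\mathfrak m}$ is the localisation at $\mathfrak m$. A square matrix is alternating if it is of the form $\nu-\nu^t$; alternating matrices of Pfaffian $1$ are invertible. Elements of $S^m$ are row vectors, ${}^t$ is transpose. For an invertible alternating $2n\times2n$ matrix $\varphi$ over a ring $S$ write $\varphi=\begin{pmatrix}0&-c\\ c^t&\nu\end{pmatrix}$, $\varphi^{-1}=\begin{pmatrix}0&d\\ -d^t&\mu\end{pmatrix}$ with $c,d\in S^{2n-1}$, and set $\alpha_\varphi(v)=I_{2n-1}+d^tv\nu$, $\beta_\varphi(v)=I_{2n-1}+\mu v^tc$ for $v\in S^{2n-1}$; ${\rm E}_\varphi(S)$ is the subgroup of ${\rm GL}_{2n-1}(S)$ generated by all these. For a ring homomorphism $R\to S$, ${\rm E}_{\varphi\otimes S}(S)$ denotes ${\rm E}_{\varphi'}(S)$ where $\varphi'$ is the image of $\varphi$ over $S$. *)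

theory Defs
  imports "HOL-Algebra.Algebra" "HOL-Combinatorics.Permutations"
begin

definition loc_rel :: "('a, 'b) ring_scheme \<Rightarrow> 'a set \<Rightarrow> (('a \<times> 'a) \<times> ('a \<times> 'a)) set" where
  "loc_rel R m = {(a, b). a \<in> carrier R \<times> (carrier R - m) \<and> b \<in> carrier R \<times> (carrier R - m) \<and>
     (\<exists>u \<in> carrier R - m. u \<otimes>\<^bsub>R\<^esub> (fst a \<otimes>\<^bsub>R\<^esub> snd b \<ominus>\<^bsub>R\<^esub> fst b \<otimes>\<^bsub>R\<^esub> snd a) = \<zero>\<^bsub>R\<^esub>)}"

definition loc_frac :: "('a, 'b) ring_scheme \<Rightarrow> 'a set \<Rightarrow> 'a \<times> 'a \<Rightarrow> ('a \<times> 'a) set" where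
  "loc_frac R m a = loc_rel R m `` {a}"

definition loc_rep :: "('a \<times> 'a) set \<Rightarrow> 'a \<times> 'a" where
  "loc_rep A = (SOME a. a \<in> A)"

definition loc :: "('a, 'b) ring_scheme \<Rightarrow> 'a set \<Rightarrow> ('a \<times> 'a) set ring" where
  "loc R m = \<lparr>carrier = (carrier R \<times> (carrier R - m)) // loc_rel R m,
     Group.monoid.mult = (\<lambda>A B. loc_frac R m (fst (loc_rep A) \<otimes>\<^bsub>R\<^esub> fst (loc_rep B), snd (loc_rep A) \<otimes>\<^bsub>R\<^esub> snd (loc_rep B))),
     Group.monoid.one = loc_frac R m (\<one>\<^bsub>R\<^esub>, \<one>\<^bsub>R\<^esub>),
     Ring.ring.zero = loc_frac R m (\<zero>\<^bsub>R\<^esub>, \<one>\<^bsub>R\<^esub>),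
     Ring.ring.add = (\<lambda>A B. loc_frac R m (fst (loc_rep A) \<otimes>\<^bsub>R\<^esub> snd (loc_rep B) \<oplus>\<^bsub>R\<^esub> fst (loc_rep B) \<otimes>\<^bsub>R\<^esub> snd (loc_rep A),
                                  snd (loc_rep A) \<otimes>\<^bsub>R\<^esub> snd (loc_rep B)))\<rparr>"

definition loc_map :: "('a, 'b) ring_scheme \<Rightarrow> 'a set \<Rightarrow> 'a \<Rightarrow> ('a \<times> 'a) set" where
  "loc_map R m r = loc_frac R m (r, \<one>\<^bsub>R\<^esub>)"

definition poly_loc_map :: "('a, 'b) ring_scheme \<Rightarrow> 'a set \<Rightarrow> (nat \<Rightarrow> 'a) \<Rightarrow> (nat \<Rightarrow> ('a \<times> 'a) set)" where
  "poly_loc_map R m p = (\<lambda>i. loc_map R m (p i))"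

definition const_poly :: "('a, 'b) ring_scheme \<Rightarrow> 'a \<Rightarrow> (nat \<Rightarrow> 'a)" where
  "const_poly S r = monom (UP S) r 0"

definition mat_carrier :: "('c, 'd) ring_scheme \<Rightarrow> nat \<Rightarrow> (nat \<Rightarrow> nat \<Rightarrow> 'c) set" where
  "mat_carrier S k = {M. \<forall>i j. if i < k \<and> j < k then M i j \<in> carrier S else M i j = \<zero>\<^bsub>S\<^esub>}"

definition mat_mult :: "('c, 'd) ring_scheme \<Rightarrow> nat \<Rightarrow> (nat \<Rightarrow> nat \<Rightarrow> 'c) \<Rightarrow> (nat \<Rightarrow> nat \<Rightarrow> 'c) \<Rightarrow> (nat \<Rightarrow> nat \<Rightarrow> 'c)" where
  "mat_mult S k A B = (\<lambda>i j. if i < k \<and> j < k then (\<Oplus>\<^bsub>S\<^esub>l\<in>{..<k}. A i l \<otimes>\<^bsub>S\<^esub> B l j) else \<zero>\<^bsub>S\<^esub>)"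

definition mat_one :: "('c, 'd) ring_scheme \<Rightarrow> nat \<Rightarrow> (nat \<Rightarrow> nat \<Rightarrow> 'c)" where
  "mat_one S k = (\<lambda>i j. if i < k \<and> j < k \<and> i = j then \<one>\<^bsub>S\<^esub> else \<zero>\<^bsub>S\<^esub>)"

definition mat_monoid :: "('c, 'd) ring_scheme \<Rightarrow> nat \<Rightarrow> (nat \<Rightarrow> nat \<Rightarrow> 'c) monoid" where
  "mat_monoid S k = \<lparr>carrier = mat_carrier S k, Group.monoid.mult = mat_mult S k, one = mat_one S k\<rparr>"

definition GL :: "('c, 'd) ring_scheme \<Rightarrow> nat \<Rightarrow> (nat \<Rightarrow> nat \<Rightarrow> 'c) monoid" where
  "GL S k = units_of (mat_monoid S k)"

definition mat_inv :: "('c, 'd) ring_scheme \<Rightarrow> nat \<Rightarrow> (nat \<Rightarrow> nat \<Rightarrow> 'c) \<Rightarrow> (nat \<Rightarrow> nat \<Rightarrow> 'c)" where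
  "mat_inv S k M = inv\<^bsub>mat_monoid S k\<^esub> M"

definition sign_elt :: "('c, 'd) ring_scheme \<Rightarrow> (nat \<Rightarrow> nat) \<Rightarrow> 'c" where
  "sign_elt S p = (if sign p = 1 then \<one>\<^bsub>S\<^esub> else \<ominus>\<^bsub>S\<^esub> \<one>\<^bsub>S\<^esub>)"

definition mat_det :: "('c, 'd) ring_scheme \<Rightarrow> nat \<Rightarrow> (nat \<Rightarrow> nat \<Rightarrow> 'c) \<Rightarrow> 'c" where
  "mat_det S k M = (\<Oplus>\<^bsub>S\<^esub>p\<in>{p. p permutes {..<k}}. sign_elt S p \<otimes>\<^bsub>S\<^esub> (\<Otimes>\<^bsub>S\<^esub>i\<in>{..<k}. M i (p i)))"

definition SL :: "('c, 'd) ring_scheme \<Rightarrow> nat \<Rightarrow> (nat \<Rightarrow> nat \<Rightarrow> 'c) set" where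
  "SL S k = {M \<in> mat_carrier S k. mat_det S k M = \<one>\<^bsub>S\<^esub>}"

definition mat_map :: "('c, 'd) ring_scheme \<Rightarrow> nat \<Rightarrow> ('e \<Rightarrow> 'c) \<Rightarrow> (nat \<Rightarrow> nat \<Rightarrow> 'e) \<Rightarrow> (nat \<Rightarrow> nat \<Rightarrow> 'c)" where
  "mat_map S k h M = (\<lambda>i j. if i < k \<and> j < k then h (M i j) else \<zero>\<^bsub>S\<^esub>)"

definition alternating :: "('c, 'd) ring_scheme \<Rightarrow> nat \<Rightarrow> (nat \<Rightarrow> nat \<Rightarrow> 'c) \<Rightarrow> bool" where
  "alternating S k A \<longleftrightarrow> A \<in> mat_carrier S k \<and>
     (\<exists>\<nu> \<in> mat_carrier S k. \<forall>i<k. \<forall>j<k. A i j = \<nu> i j \<ominus>\<^bsub>S\<^esub> \<nu> j i)"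

text \<open>Pfaffian of a 2n x 2n matrix: sum over permutations encoding perfect matchings
  (sigma(2i) < sigma(2i+1), sigma(0) < sigma(2) < ... < sigma(2n-2)).\<close>
definition pfaffian :: "('c, 'd) ring_scheme \<Rightarrow> nat \<Rightarrow> (nat \<Rightarrow> nat \<Rightarrow> 'c) \<Rightarrow> 'c" where
  "pfaffian S n A = (\<Oplus>\<^bsub>S\<^esub>\<sigma>\<in>{\<sigma>. \<sigma> permutes {..<2*n} \<and> (\<forall>i<n. \<sigma> (2*i) < \<sigma> (2*i+1))
                               \<and> (\<forall>i. Suc i < n \<longrightarrow> \<sigma> (2*i) < \<sigma> (2*i+2))}.
       sign_elt S \<sigma> \<otimes>\<^bsub>S\<^esub> (\<Otimes>\<^bsub>S\<^esub>i\<in>{..<n}. A (\<sigma> (2*i)) (\<sigma> (2*i+1))))"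

text \<open>For phi (2n x 2n, indices 0..2n-1): c_j = -phi(0,j+1), nu_{ij} = phi(i+1,j+1);
  for psi = phi^{-1}: d_j = psi(0,j+1), mu_{ij} = psi(i+1,j+1). Vectors of length 2n-1.\<close>

definition alpha_phi :: "('c, 'd) ring_scheme \<Rightarrow> nat \<Rightarrow> (nat \<Rightarrow> nat \<Rightarrow> 'c) \<Rightarrow> (nat \<Rightarrow> 'c) \<Rightarrow> (nat \<Rightarrow> nat \<Rightarrow> 'c)" where
  "alpha_phi S n \<phi> v = (let \<psi> = mat_inv S (2*n) \<phi>; k = 2*n - 1 in
     (\<lambda>i j. if i < k \<and> j < k then
        mat_one S k i j \<oplus>\<^bsub>S\<^esub> \<psi> 0 (i+1) \<otimes>\<^bsub>S\<^esub> (\<Oplus>\<^bsub>S\<^esub>l\<in>{..<k}. v l \<otimes>\<^bsub>S\<^esub> \<phi> (l+1) (j+1))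
      else \<zero>\<^bsub>S\<^esub>))"

definition beta_phi :: "('c, 'd) ring_scheme \<Rightarrow> nat \<Rightarrow> (nat \<Rightarrow> nat \<Rightarrow> 'c) \<Rightarrow> (nat \<Rightarrow> 'c) \<Rightarrow> (nat \<Rightarrow> nat \<Rightarrow> 'c)" where
  "beta_phi S n \<phi> v = (let \<psi> = mat_inv S (2*n) \<phi>; k = 2*n - 1 in
     (\<lambda>i j. if i < k \<and> j < k then
        mat_one S k i j \<oplus>\<^bsub>S\<^esub> (\<Oplus>\<^bsub>S\<^esub>l\<in>{..<k}. \<psi> (i+1) (l+1) \<otimes>\<^bsub>S\<^esub> v l) \<otimes>\<^bsub>S\<^esub> (\<ominus>\<^bsub>S\<^esub> \<phi> 0 (j+1))
      else \<zero>\<^bsub>S\<^esub>))"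

definition vec_carrier :: "('c, 'd) ring_scheme \<Rightarrow> nat \<Rightarrow> (nat \<Rightarrow> 'c) set" where
  "vec_carrier S k = {v. \<forall>l<k. v l \<in> carrier S}"

definition E_phi :: "('c, 'd) ring_scheme \<Rightarrow> nat \<Rightarrow> (nat \<Rightarrow> nat \<Rightarrow> 'c) \<Rightarrow> (nat \<Rightarrow> nat \<Rightarrow> 'c) set" where
  "E_phi S n \<phi> = generate (GL S (2*n - 1))
     ({alpha_phi S n \<phi> v | v. v \<in> vec_carrier S (2*n - 1)} \<union> {beta_phi S n \<phi> v | v. v \<in> vec_carrier S (2*n - 1)})"

end

theory Submission
  imports Defs
begin

text \<open>
  Write $c$, $d$ for the vectors cut out of the first rows of $-\varphi$ and $\varphi^{-1}$. Then
  $c d^t = 1$, and the group attached to $\varphi$ is generated by the transvections $I + d^t g$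
  with $g d^t = 0$ and $I + \kappa c$ with $c \kappa = 0$: the matrix $\varphi$ is only needed
  to know that it is invertible, which follows from the expansion of its Pfaffian along a row.

  Where $c_j$ is invertible, the kernel of $c$ is free of rank at least $2$, with an explicit basis
  and dual basis. Commutator identities then show that conjugating a transvection whose parameter is divisible by a high power
  of a denominator $t$ by one with denominator $t$ yields a product of transvections with
  parameters still divisible by a prescribed power of $t$. Hence if a matrix over $A[Y]$ becomes elementary over a localization of $A$,
  then after the substitution $Y \mapsto s Y$, for a suitable denominator $s$, it is an elementary
  matrix over $A[Y]$ times its value at $Y = 0$.

  Apply this to $\theta(X + Y)$ over $A = R[X]$. The $s \in R$ such that $\theta(x + s y)$ and $\theta(x)$
  differ by an elementary factor for all $x, y \in R[X]$ form an ideal, which is contained in no maximal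
  ideal. So it contains $1$, and $x = 0$, $y = X$ gives the theorem.
\<close>

section \<open>Matrices and transvections\<close>

text \<open>The relation \<open>c d^t = 1\<close> does two jobs. It makes a transvection
  \<open>I + \<kappa> h\<close> with \<open>c \<kappa> = 0\<close>, \<open>h d^t = 0\<close> and
  \<open>h \<kappa> = 0\<close> a commutator of two generators, and it allows a parameter that is
  orthogonal only over a localization to be corrected to an orthogonal one below. The obstacle is
  conjugation when \<open>h \<kappa>\<close> is not zero, since the result then has neither
  generating shape. A basis vector of the kernel with a third index, available because
  \<open>2n - 1\<close> is at least 3, resolves this case. Every conjugation lowers the exponent of
  \<open>t\<close> from \<open>5M + 10\<close> to \<open>M\<close>; as this loss does not depend on
  the element conjugated, a fixed word can be treated one factor at a time. Two choices serve the
  patching. All denominators are constants from \<open>R\<close>, even over \<open>R[X]\<close>, so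
  the good scalars lie in \<open>R\<close> and only maximal ideals of \<open>R\<close> matter. And
  \<open>\<theta>\<close> is compared at two arbitrary points \<open>x\<close> and
  \<open>x + s y\<close>: comparing \<open>\<theta>(s X)\<close> with \<open>\<theta>(0)\<close>
  alone would not yield a set closed under addition.\<close>

definition dot :: "('c, 'd) ring_scheme \<Rightarrow> nat \<Rightarrow> (nat \<Rightarrow> 'c) \<Rightarrow> (nat \<Rightarrow> 'c) \<Rightarrow> 'c" where
  "dot S k v w = (\<Oplus>\<^bsub>S\<^esub>l\<in>{..<k}. v l \<otimes>\<^bsub>S\<^esub> w l)"

definition outer :: "('c, 'd) ring_scheme \<Rightarrow> nat \<Rightarrow> (nat \<Rightarrow> 'c) \<Rightarrow> (nat \<Rightarrow> 'c) \<Rightarrow> (nat \<Rightarrow> nat \<Rightarrow> 'c)" where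
  "outer S k p q = (\<lambda>i j. if i < k \<and> j < k then p i \<otimes>\<^bsub>S\<^esub> q j else \<zero>\<^bsub>S\<^esub>)"

text \<open>Adding a sum to the matrix monoid allows transvections to be computed as elements
  \<open>1 + a\<close> of an abstract noncommutative ring.\<close>

definition mat_ring :: "('c, 'd) ring_scheme \<Rightarrow> nat \<Rightarrow> (nat \<Rightarrow> nat \<Rightarrow> 'c) ring" where
  "mat_ring S k = \<lparr>carrier = mat_carrier S k, Group.monoid.mult = mat_mult S k, one = mat_one S k,
     Ring.ring.zero = (\<lambda>i j. \<zero>\<^bsub>S\<^esub>), Ring.ring.add = (\<lambda>A B i j. A i j \<oplus>\<^bsub>S\<^esub> B i j)\<rparr>"

definition transv :: "('c, 'd) ring_scheme \<Rightarrow> nat \<Rightarrow> (nat \<Rightarrow> 'c) \<Rightarrow> (nat \<Rightarrow> 'c) \<Rightarrow> (nat \<Rightarrow> nat \<Rightarrow> 'c)" where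
  "transv S k p q = (\<lambda>i j. mat_one S k i j \<oplus>\<^bsub>S\<^esub> outer S k p q i j)"

lemma vec_carrierD: "v \<in> vec_carrier S k \<Longrightarrow> l < k \<Longrightarrow> v l \<in> carrier S"
  by (simp add: vec_carrier_def)

lemma mat_carrierD: "M \<in> mat_carrier S k \<Longrightarrow> i < k \<Longrightarrow> j < k \<Longrightarrow> M i j \<in> carrier S"
  unfolding mat_carrier_def by (auto split: if_splits)

lemma mat_carrier_out: "M \<in> mat_carrier S k \<Longrightarrow> \<not> (i < k \<and> j < k) \<Longrightarrow> M i j = \<zero>\<^bsub>S\<^esub>"
  unfolding mat_carrier_def mem_Collect_eq by presburger

lemma mat_eqI:
  assumes "A \<in> mat_carrier S k" "B \<in> mat_carrier S k" "\<And>i j. i < k \<Longrightarrow> j < k \<Longrightarrow> A i j = B i j"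
  shows "A = B"
proof (intro ext)
  fix i j show "A i j = B i j"
    using assms mat_carrier_out[of A S k i j] mat_carrier_out[of B S k i j] by (cases "i < k \<and> j < k") auto
qed

lemma (in abelian_monoid) finsum_swap:
  assumes "finite A" "finite B" "\<And>i j. i \<in> A \<Longrightarrow> j \<in> B \<Longrightarrow> f i j \<in> carrier G"
  shows "(\<Oplus>i\<in>A. \<Oplus>j\<in>B. f i j) = (\<Oplus>j\<in>B. \<Oplus>i\<in>A. f i j)"
  using assms(1,3)
proof (induction A rule: finite_induct)
  case empty
  then show ?case by simp
next
  case (insert x A)
  have "(\<Oplus>j\<in>B. \<Oplus>i\<in>insert x A. f i j) = (\<Oplus>j\<in>B. f x j \<oplus> (\<Oplus>i\<in>A. f i j))"
    using insert by (intro finsum_cong') (auto simp: Pi_def)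
  also have "\<dots> = (\<Oplus>j\<in>B. f x j) \<oplus> (\<Oplus>j\<in>B. \<Oplus>i\<in>A. f i j)"
    using insert by (intro finsum_addf) (auto simp: Pi_def)
  finally show ?case using insert by (simp add: Pi_def)
qed

section \<open>Unipotent elements of a noncommutative ring\<close>

context ring
begin

text \<open>With \<open>u = a b\<close>, \<open>v = a + b\<close> and \<open>w = 1 + u\<close> the
  product is \<open>(w + v) (w - v)\<close>. The relations give \<open>w v = v = v w\<close>, so the
  mixed terms cancel and \<open>w^2 - v^2 = (w + u) - u\<close> remains.\<close>

lemma unipotent_commutator:
  assumes [simp]: "a \<in> carrier R" "b \<in> carrier R" and z: "a \<otimes> a = \<zero>" "b \<otimes> b = \<zero>" "b \<otimes> a = \<zero>"
  shows "(\<one> \<oplus> a) \<otimes> (\<one> \<oplus> b) \<otimes> ((\<one> \<oplus> \<ominus> a) \<otimes> (\<one> \<oplus> \<ominus> b)) = \<one> \<oplus> a \<otimes> b"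
proof -
  define u v w where "u = a \<otimes> b" and "v = a \<oplus> b" and "w = \<one> \<oplus> u"
  have cl [simp]: "u \<in> carrier R" "v \<in> carrier R" "w \<in> carrier R" by (auto simp: u_def v_def w_def)
  have "a \<otimes> (a \<otimes> b) = \<zero>" "b \<otimes> (a \<otimes> b) = \<zero>" by (simp_all add: m_assoc[symmetric] z)
  then have uv: "u \<otimes> u = \<zero>" "u \<otimes> v = \<zero>" "v \<otimes> u = \<zero>" "v \<otimes> v = u"
    unfolding u_def v_def by (simp_all add: l_distr r_distr m_assoc z)
  then have "w \<otimes> v = v" "v \<otimes> w = v" "w \<otimes> w = w \<oplus> u"
    unfolding w_def by (simp_all add: l_distr r_distr)
  then have "(w \<oplus> v) \<otimes> (w \<ominus> v) = (w \<oplus> u \<oplus> v) \<oplus> (\<ominus> v \<oplus> \<ominus> u)"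
    using uv cl by (simp only: minus_eq l_distr r_distr r_minus a_closed a_inv_closed m_closed minus_add)
  also have "\<dots> = w" by (simp add: a_assoc r_neg r_neg2)
  moreover have "(\<one> \<oplus> a) \<otimes> (\<one> \<oplus> b) = w \<oplus> v"
    by (simp add: w_def u_def v_def l_distr r_distr a_ac)
  moreover have "(\<one> \<oplus> \<ominus> a) \<otimes> (\<one> \<oplus> \<ominus> b) = w \<ominus> v"
    by (simp add: w_def u_def v_def l_distr r_distr a_ac l_minus r_minus minus_add minus_eq)
  ultimately show ?thesis by (simp add: w_def u_def)
qed

text \<open>As \<open>1 - h\<close> inverts \<open>1 + h\<close>, the conjugate differs from
  \<open>1\<close> by \<open>(1 + h) p (1 - h)\<close>. It is grouped so that, for \<open>p\<close>
  of rank one, the left factor acts on the column and the right factor on the row.\<close>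

lemma unipotent_conj:
  assumes [simp]: "p \<in> carrier R" "h \<in> carrier R" and z: "h \<otimes> h = \<zero>"
  shows "(\<one> \<oplus> h) \<otimes> (\<one> \<oplus> p) \<otimes> (\<one> \<ominus> h) = \<one> \<oplus> ((p \<oplus> h \<otimes> p) \<ominus> (p \<oplus> h \<otimes> p) \<otimes> h)"
proof -
  have 1: "(\<one> \<oplus> h) \<otimes> (\<one> \<ominus> h) = \<one>"
    by (simp add: l_distr r_distr l_minus r_minus minus_eq z a_assoc l_neg r_neg)
  have "(\<one> \<oplus> h) \<otimes> (\<one> \<oplus> p) \<otimes> (\<one> \<ominus> h) = ((\<one> \<oplus> h) \<oplus> (p \<oplus> h \<otimes> p)) \<otimes> (\<one> \<ominus> h)"
    by (simp add: l_distr r_distr a_ac)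
  also have "\<dots> = (\<one> \<oplus> h) \<otimes> (\<one> \<ominus> h) \<oplus> (p \<oplus> h \<otimes> p) \<otimes> (\<one> \<ominus> h)"
    by (rule l_distr) auto
  also have "(p \<oplus> h \<otimes> p) \<otimes> (\<one> \<ominus> h) = (p \<oplus> h \<otimes> p) \<ominus> (p \<oplus> h \<otimes> p) \<otimes> h"
    by (simp add: minus_eq r_distr r_minus)
  finally show ?thesis unfolding 1 .
qed

end

section \<open>Vectors, matrices and rank-one matrices over a commutative ring\<close>

context cring
begin

lemma mat_carrier_entry [simp]: "M \<in> mat_carrier R k \<Longrightarrow> M i j \<in> carrier R"
  unfolding mat_carrier_def mem_Collect_eq by (metis zero_closed)

lemma mat_mult_closed [simp]:
  "A \<in> mat_carrier R k \<Longrightarrow> B \<in> mat_carrier R k \<Longrightarrow> mat_mult R k A B \<in> mat_carrier R k"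
  by (auto simp: mat_carrier_def[of R k] mat_mult_def intro!: finsum_closed)

lemma mat_one_closed [simp]: "mat_one R k \<in> mat_carrier R k"
  by (auto simp: mat_carrier_def mat_one_def)

lemma dot_closed [simp]:
  "v \<in> vec_carrier R k \<Longrightarrow> w \<in> vec_carrier R k \<Longrightarrow> dot R k v w \<in> carrier R"
  by (auto simp: dot_def vec_carrier_def intro!: finsum_closed)

lemma dot_comm:
  "v \<in> vec_carrier R k \<Longrightarrow> w \<in> vec_carrier R k \<Longrightarrow> dot R k v w = dot R k w v"
  unfolding dot_def by (intro finsum_cong') (auto simp: vec_carrier_def m_comm)

lemma dot_add_right:
  "\<lbrakk>v \<in> vec_carrier R k; w \<in> vec_carrier R k; u \<in> vec_carrier R k\<rbrakk> \<Longrightarrow>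
   dot R k v (\<lambda>i. w i \<oplus> u i) = dot R k v w \<oplus> dot R k v u"
proof -
  assume a: "v \<in> vec_carrier R k" "w \<in> vec_carrier R k" "u \<in> vec_carrier R k"
  have "dot R k v (\<lambda>i. w i \<oplus> u i) = (\<Oplus>l\<in>{..<k}. v l \<otimes> w l \<oplus> v l \<otimes> u l)"
    unfolding dot_def using a by (intro finsum_cong') (auto simp: vec_carrier_def r_distr)
  also have "\<dots> = dot R k v w \<oplus> dot R k v u"
    unfolding dot_def using a by (intro finsum_addf) (auto simp: vec_carrier_def)
  finally show ?thesis .
qed

lemma dot_smult_right:
  "\<lbrakk>v \<in> vec_carrier R k; w \<in> vec_carrier R k; a \<in> carrier R\<rbrakk> \<Longrightarrow>
   dot R k v (\<lambda>i. a \<otimes> w i) = a \<otimes> dot R k v w"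
  unfolding dot_def
  by (subst finsum_rdistr) (auto simp: vec_carrier_def m_lcomm intro!: finsum_cong')

lemma dot_uminus_right:
  "\<lbrakk>v \<in> vec_carrier R k; w \<in> vec_carrier R k\<rbrakk> \<Longrightarrow> dot R k v (\<lambda>i. \<ominus> w i) = \<ominus> dot R k v w"
proof -
  assume a: "v \<in> vec_carrier R k" "w \<in> vec_carrier R k"
  have "dot R k v (\<lambda>i. \<ominus> w i) = dot R k v (\<lambda>i. \<ominus> \<one> \<otimes> w i)"
    unfolding dot_def using a by (intro finsum_cong') (auto simp: vec_carrier_def l_minus)
  then show ?thesis using a by (simp add: dot_smult_right l_minus)
qed

lemma dot_cong:
  "\<lbrakk>v \<in> vec_carrier R k; w \<in> vec_carrier R k; \<And>i. i < k \<Longrightarrow> v i = v' i; \<And>i. i < k \<Longrightarrow> w i = w' i\<rbrakk> \<Longrightarrow>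
   dot R k v w = dot R k v' w'"
  unfolding dot_def by (intro finsum_cong') (auto simp: vec_carrier_def)

lemma vec_add_closed [simp]:
  "v \<in> vec_carrier R k \<Longrightarrow> w \<in> vec_carrier R k \<Longrightarrow> (\<lambda>i. v i \<oplus> w i) \<in> vec_carrier R k"
  by (auto simp: vec_carrier_def)

lemma vec_smult_closed [simp]:
  "v \<in> vec_carrier R k \<Longrightarrow> a \<in> carrier R \<Longrightarrow> (\<lambda>i. a \<otimes> v i) \<in> vec_carrier R k"
  by (auto simp: vec_carrier_def)

lemma vec_uminus_closed [simp]: "v \<in> vec_carrier R k \<Longrightarrow> (\<lambda>i. \<ominus> v i) \<in> vec_carrier R k"
  by (auto simp: vec_carrier_def)

lemma vec_minus_closed [simp]:
  "v \<in> vec_carrier R k \<Longrightarrow> w \<in> vec_carrier R k \<Longrightarrow> (\<lambda>i. v i \<ominus> w i) \<in> vec_carrier R k"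
  by (auto simp: vec_carrier_def)

lemma dot_minus_right:
  "\<lbrakk>v \<in> vec_carrier R k; w \<in> vec_carrier R k; u \<in> vec_carrier R k\<rbrakk> \<Longrightarrow>
   dot R k v (\<lambda>i. w i \<ominus> u i) = dot R k v w \<ominus> dot R k v u"
  by (simp add: a_minus_def dot_add_right dot_uminus_right)

lemma dot_add_left:
  "\<lbrakk>v \<in> vec_carrier R k; w \<in> vec_carrier R k; u \<in> vec_carrier R k\<rbrakk> \<Longrightarrow>
   dot R k (\<lambda>i. w i \<oplus> u i) v = dot R k w v \<oplus> dot R k u v"
  by (simp add: dot_comm[of _ k v] dot_add_right)

lemma dot_minus_left:
  "\<lbrakk>v \<in> vec_carrier R k; w \<in> vec_carrier R k; u \<in> vec_carrier R k\<rbrakk> \<Longrightarrow>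
   dot R k (\<lambda>i. w i \<ominus> u i) v = dot R k w v \<ominus> dot R k u v"
  by (simp add: dot_comm[of _ k v] dot_minus_right)

lemma dot_uminus_left:
  "\<lbrakk>v \<in> vec_carrier R k; w \<in> vec_carrier R k\<rbrakk> \<Longrightarrow> dot R k (\<lambda>i. \<ominus> w i) v = \<ominus> dot R k w v"
  by (simp add: dot_comm[of _ k v] dot_uminus_right)

lemma dot_smult_left:
  "\<lbrakk>v \<in> vec_carrier R k; w \<in> vec_carrier R k; a \<in> carrier R\<rbrakk> \<Longrightarrow>
   dot R k (\<lambda>i. a \<otimes> w i) v = a \<otimes> dot R k w v"
  by (simp add: dot_comm[of _ k v] dot_smult_right)

lemma mat_mult_assoc:
  assumes "A \<in> mat_carrier R k" "B \<in> mat_carrier R k" "C \<in> mat_carrier R k"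
  shows "mat_mult R k (mat_mult R k A B) C = mat_mult R k A (mat_mult R k B C)"
proof (rule mat_eqI[of _ R k])
  fix i j assume ij: "i < k" "j < k"
  have "mat_mult R k (mat_mult R k A B) C i j = (\<Oplus>l\<in>{..<k}. \<Oplus>l'\<in>{..<k}. A i l' \<otimes> B l' l \<otimes> C l j)"
    using ij assms by (auto simp: mat_mult_def finsum_ldistr intro!: finsum_cong')
  also have "\<dots> = (\<Oplus>l'\<in>{..<k}. \<Oplus>l\<in>{..<k}. A i l' \<otimes> B l' l \<otimes> C l j)"
    using assms by (intro finsum_swap) auto
  also have "\<dots> = mat_mult R k A (mat_mult R k B C) i j"
    using ij assms by (auto simp: mat_mult_def finsum_rdistr m_assoc intro!: finsum_cong')
  finally show "mat_mult R k (mat_mult R k A B) C i j = mat_mult R k A (mat_mult R k B C) i j" .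
qed (use assms in auto)

lemma finsum_delta:
  fixes i k :: nat
  assumes "i < k" "f i \<in> carrier R"
  shows "(\<Oplus>l\<in>{..<k}. if l = i then f l else \<zero>) = f i"
proof -
  have "(\<Oplus>l\<in>{..<k}. if l = i then f l else \<zero>) = (\<Oplus>l\<in>{..<k}. if i = l then f i else \<zero>)"
    using assms by (intro finsum_cong') auto
  also have "\<dots> = f i" using assms by (intro finsum_singleton[of i "{..<k}" "\<lambda>_. f i"]) auto
  finally show ?thesis .
qed

lemma mat_one_left [simp]: "A \<in> mat_carrier R k \<Longrightarrow> mat_mult R k (mat_one R k) A = A"
proof (rule mat_eqI[of _ R k])
  fix i j assume a: "A \<in> mat_carrier R k" and ij: "i < k" "j < k"
  have "mat_mult R k (mat_one R k) A i j = (\<Oplus>l\<in>{..<k}. if l = i then A l j else \<zero>)"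
    using ij a by (auto simp: mat_mult_def mat_one_def intro!: finsum_cong')
  then show "mat_mult R k (mat_one R k) A i j = A i j" using finsum_delta[of i k "\<lambda>l. A l j"] ij a by simp
qed auto

lemma mat_one_right [simp]: "A \<in> mat_carrier R k \<Longrightarrow> mat_mult R k A (mat_one R k) = A"
proof (rule mat_eqI[of _ R k])
  fix i j assume a: "A \<in> mat_carrier R k" and ij: "i < k" "j < k"
  have "mat_mult R k A (mat_one R k) i j = (\<Oplus>l\<in>{..<k}. if l = j then A i l else \<zero>)"
    using ij a by (auto simp: mat_mult_def mat_one_def intro!: finsum_cong')
  then show "mat_mult R k A (mat_one R k) i j = A i j" using finsum_delta[of j k "\<lambda>l. A i l"] ij a by simp
qed auto

lemma monoid_mat_monoid: "Group.monoid (mat_monoid R k)"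
  by (rule Group.monoid.intro) (auto simp: mat_monoid_def mat_mult_assoc)

lemma mat_mult_dot:
  "mat_mult R k A B = (\<lambda>i j. if i < k \<and> j < k then dot R k (A i) (\<lambda>l. B l j) else \<zero>)"
  unfolding mat_mult_def dot_def ..

lemma mat_row_closed [simp]: "A \<in> mat_carrier R k \<Longrightarrow> A i \<in> vec_carrier R k"
  by (simp add: vec_carrier_def)

lemma mat_col_closed [simp]: "A \<in> mat_carrier R k \<Longrightarrow> (\<lambda>l. A l j) \<in> vec_carrier R k"
  by (simp add: vec_carrier_def)

lemma ring_mat_ring: "ring (mat_ring R k)"
proof (rule ringI)
  show "abelian_group (mat_ring R k)"
  proof (rule abelian_groupI)
    fix x assume x: "x \<in> carrier (mat_ring R k)"
    then have "(\<lambda>i j. \<ominus> x i j) \<in> carrier (mat_ring R k)"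
      by (auto simp: mat_ring_def mat_carrier_def split: if_splits)
    moreover have "(\<lambda>i j. \<ominus> x i j) \<oplus>\<^bsub>mat_ring R k\<^esub> x = \<zero>\<^bsub>mat_ring R k\<^esub>"
      using x by (auto simp: mat_ring_def fun_eq_iff l_neg)
    ultimately show "\<exists>y\<in>carrier (mat_ring R k). y \<oplus>\<^bsub>mat_ring R k\<^esub> x = \<zero>\<^bsub>mat_ring R k\<^esub>" by blast
  qed (auto simp: mat_ring_def fun_eq_iff a_ac, auto simp: mat_carrier_def split: if_splits)
  show "Group.monoid (mat_ring R k)"
    by (rule Group.monoid.intro) (auto simp: mat_ring_def mat_mult_assoc)
next
  fix x y z assume "x \<in> carrier (mat_ring R k)" "y \<in> carrier (mat_ring R k)" "z \<in> carrier (mat_ring R k)"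
  then show "(x \<oplus>\<^bsub>mat_ring R k\<^esub> y) \<otimes>\<^bsub>mat_ring R k\<^esub> z = x \<otimes>\<^bsub>mat_ring R k\<^esub> z \<oplus>\<^bsub>mat_ring R k\<^esub> y \<otimes>\<^bsub>mat_ring R k\<^esub> z"
   and "z \<otimes>\<^bsub>mat_ring R k\<^esub> (x \<oplus>\<^bsub>mat_ring R k\<^esub> y) = z \<otimes>\<^bsub>mat_ring R k\<^esub> x \<oplus>\<^bsub>mat_ring R k\<^esub> z \<otimes>\<^bsub>mat_ring R k\<^esub> y"
    by (auto simp: mat_ring_def mat_mult_dot fun_eq_iff dot_add_left dot_add_right)
qed

lemma outer_closed [simp]:
  "p \<in> vec_carrier R k \<Longrightarrow> q \<in> vec_carrier R k \<Longrightarrow> outer R k p q \<in> mat_carrier R k"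
  by (auto simp: outer_def mat_carrier_def vec_carrier_def)

lemma transv_closed [simp]:
  "p \<in> vec_carrier R k \<Longrightarrow> q \<in> vec_carrier R k \<Longrightarrow> transv R k p q \<in> mat_carrier R k"
  by (auto simp: transv_def mat_one_def outer_def mat_carrier_def vec_carrier_def)

lemma transv_eq: "transv R k p q = \<one>\<^bsub>mat_ring R k\<^esub> \<oplus>\<^bsub>mat_ring R k\<^esub> outer R k p q"
  by (simp add: transv_def mat_ring_def)

lemma outer_mult:
  assumes "p \<in> vec_carrier R k" "q \<in> vec_carrier R k" "p' \<in> vec_carrier R k" "q' \<in> vec_carrier R k"
  shows "outer R k p q \<otimes>\<^bsub>mat_ring R k\<^esub> outer R k p' q' = outer R k p (\<lambda>j. dot R k q p' \<otimes> q' j)"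
proof (rule mat_eqI[of _ R k])
  fix i j assume ij: "i < k" "j < k"
  have "(\<Oplus>l\<in>{..<k}. p i \<otimes> q l \<otimes> (p' l \<otimes> q' j)) = (\<Oplus>l\<in>{..<k}. p i \<otimes> (q l \<otimes> p' l) \<otimes> q' j)"
    using assms ij by (intro finsum_cong') (auto simp: vec_carrier_def m_assoc)
  also have "\<dots> = (\<Oplus>l\<in>{..<k}. p i \<otimes> (q l \<otimes> p' l)) \<otimes> q' j"
    using assms ij by (subst finsum_ldistr) (auto simp: vec_carrier_def)
  also have "\<dots> = p i \<otimes> dot R k q p' \<otimes> q' j"
    using assms ij unfolding dot_def by (subst finsum_rdistr) (auto simp: vec_carrier_def)
  moreover have "(outer R k p q \<otimes>\<^bsub>mat_ring R k\<^esub> outer R k p' q') i j = (\<Oplus>l\<in>{..<k}. p i \<otimes> q l \<otimes> (p' l \<otimes> q' j))"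
    unfolding mat_ring_def mat_mult_def outer_def using assms ij
    by (simp, intro finsum_cong') (auto simp: vec_carrier_def)
  ultimately show "(outer R k p q \<otimes>\<^bsub>mat_ring R k\<^esub> outer R k p' q') i j = outer R k p (\<lambda>j. dot R k q p' \<otimes> q' j) i j"
    using assms ij by (simp add: outer_def m_assoc vec_carrierD)
qed (use assms in \<open>auto simp: mat_ring_def\<close>)

lemma outer_mult_zero:
  assumes "p \<in> vec_carrier R k" "q \<in> vec_carrier R k" "p' \<in> vec_carrier R k" "q' \<in> vec_carrier R k"
    and "dot R k q p' = \<zero>"
  shows "outer R k p q \<otimes>\<^bsub>mat_ring R k\<^esub> outer R k p' q' = \<zero>\<^bsub>mat_ring R k\<^esub>"
  unfolding outer_mult[OF assms(1-4)] using assms by (auto simp: outer_def mat_ring_def fun_eq_iff vec_carrierD)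

lemma outer_uminus_left:
  "p \<in> vec_carrier R k \<Longrightarrow> q \<in> vec_carrier R k \<Longrightarrow>
   outer R k (\<lambda>i. \<ominus> p i) q = \<ominus>\<^bsub>mat_ring R k\<^esub> outer R k p q"
  by (rule sym, rule abelian_group.minus_equality[OF ring.is_abelian_group[OF ring_mat_ring]])
     (auto simp: mat_ring_def outer_def fun_eq_iff l_minus l_neg vec_carrierD mat_carrier_def)

lemma outer_uminus_right:
  "p \<in> vec_carrier R k \<Longrightarrow> q \<in> vec_carrier R k \<Longrightarrow>
   outer R k p (\<lambda>i. \<ominus> q i) = outer R k (\<lambda>i. \<ominus> p i) q"
  by (auto simp: outer_def fun_eq_iff l_minus r_minus vec_carrierD)

lemma outer_smult:
  "p \<in> vec_carrier R k \<Longrightarrow> q \<in> vec_carrier R k \<Longrightarrow> a \<in> carrier R \<Longrightarrow>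
   outer R k p (\<lambda>i. a \<otimes> q i) = outer R k (\<lambda>i. a \<otimes> p i) q"
  by (auto simp: outer_def fun_eq_iff vec_carrierD m_assoc m_lcomm)

lemma outer_add_left:
  "\<lbrakk>p \<in> vec_carrier R k; p' \<in> vec_carrier R k; q \<in> vec_carrier R k\<rbrakk> \<Longrightarrow>
   outer R k (\<lambda>i. p i \<oplus> p' i) q = outer R k p q \<oplus>\<^bsub>mat_ring R k\<^esub> outer R k p' q"
  by (auto simp: outer_def mat_ring_def fun_eq_iff vec_carrierD l_distr)

lemma outer_add_right:
  "\<lbrakk>p \<in> vec_carrier R k; q \<in> vec_carrier R k; q' \<in> vec_carrier R k\<rbrakk> \<Longrightarrow>
   outer R k p (\<lambda>i. q i \<oplus> q' i) = outer R k p q \<oplus>\<^bsub>mat_ring R k\<^esub> outer R k p q'"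
  by (auto simp: outer_def mat_ring_def fun_eq_iff vec_carrierD r_distr)

text \<open>The only cross term is \<open>(q . p) p q'^t\<close>, built from the row of the first
  factor and the column of the second.\<close>

lemma transv_mult_same_left:
  assumes "p \<in> vec_carrier R k" "q \<in> vec_carrier R k" "q' \<in> vec_carrier R k" "dot R k q p = \<zero>"
  shows "mat_mult R k (transv R k p q) (transv R k p q') = transv R k p (\<lambda>i. q i \<oplus> q' i)"
proof -
  interpret M: ring "mat_ring R k" by (rule ring_mat_ring)
  have [simp]: "outer R k p q \<in> carrier (mat_ring R k)" "outer R k p q' \<in> carrier (mat_ring R k)"
    using assms by (auto simp: mat_ring_def)
  have "transv R k p q \<otimes>\<^bsub>mat_ring R k\<^esub> transv R k p q' = transv R k p (\<lambda>i. q i \<oplus> q' i)"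
    using assms by (simp add: transv_eq outer_add_right M.l_distr M.r_distr outer_mult_zero M.a_ac)
  then show ?thesis by (simp add: mat_ring_def)
qed

lemma transv_mult_same_right:
  assumes "p \<in> vec_carrier R k" "p' \<in> vec_carrier R k" "q \<in> vec_carrier R k" "dot R k q p' = \<zero>"
  shows "mat_mult R k (transv R k p q) (transv R k p' q) = transv R k (\<lambda>i. p i \<oplus> p' i) q"
proof -
  interpret M: ring "mat_ring R k" by (rule ring_mat_ring)
  have [simp]: "outer R k p q \<in> carrier (mat_ring R k)" "outer R k p' q \<in> carrier (mat_ring R k)"
    using assms by (auto simp: mat_ring_def)
  have "transv R k p q \<otimes>\<^bsub>mat_ring R k\<^esub> transv R k p' q = transv R k (\<lambda>i. p i \<oplus> p' i) q"
    using assms by (simp add: transv_eq outer_add_left M.l_distr M.r_distr outer_mult_zero M.a_ac)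
  then show ?thesis by (simp add: mat_ring_def)
qed

lemma transv_uminus_right:
  "p \<in> vec_carrier R k \<Longrightarrow> q \<in> vec_carrier R k \<Longrightarrow> transv R k p (\<lambda>i. \<ominus> q i) = transv R k (\<lambda>i. \<ominus> p i) q"
  by (simp add: transv_eq outer_uminus_right)

lemma transv_smult:
  "p \<in> vec_carrier R k \<Longrightarrow> q \<in> vec_carrier R k \<Longrightarrow> a \<in> carrier R \<Longrightarrow>
   transv R k p (\<lambda>i. a \<otimes> q i) = transv R k (\<lambda>i. a \<otimes> p i) q"
  by (simp add: transv_eq outer_smult)

lemma transv_zero_left:
  "q \<in> vec_carrier R k \<Longrightarrow> (\<And>i. i < k \<Longrightarrow> p i = \<zero>) \<Longrightarrow> transv R k p q = mat_one R k"
  by (auto simp: transv_def outer_def fun_eq_iff vec_carrierD mat_one_def)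

lemma transv_zero_right:
  "p \<in> vec_carrier R k \<Longrightarrow> (\<And>i. i < k \<Longrightarrow> q i = \<zero>) \<Longrightarrow> transv R k p q = mat_one R k"
  by (auto simp: transv_def outer_def fun_eq_iff vec_carrierD mat_one_def)

lemma transv_cong:
  "(\<And>i. i < k \<Longrightarrow> p i = p' i) \<Longrightarrow> (\<And>i. i < k \<Longrightarrow> q i = q' i) \<Longrightarrow> transv R k p q = transv R k p' q'"
  by (auto simp: transv_def outer_def fun_eq_iff)

lemma transv_inverse:
  assumes "p \<in> vec_carrier R k" "q \<in> vec_carrier R k" "dot R k q p = \<zero>"
  shows "mat_mult R k (transv R k p q) (transv R k p (\<lambda>i. \<ominus> q i)) = mat_one R k"
    and "mat_mult R k (transv R k p (\<lambda>i. \<ominus> q i)) (transv R k p q) = mat_one R k"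
  using assms
  by (auto simp: transv_mult_same_left dot_uminus_left r_neg l_neg vec_carrierD intro!: transv_zero_right)

text \<open>The three orthogonality relations say that both rank-one matrices have square zero and
  that their product in one order vanishes. Their product in the other order has rank one with
  scalar \<open>q . p'\<close>. All commutator relations below are instances of this one.\<close>

lemma transv_commutator:
  assumes "p \<in> vec_carrier R k" "q \<in> vec_carrier R k" "p' \<in> vec_carrier R k" "q' \<in> vec_carrier R k"
    and "dot R k q p = \<zero>" "dot R k q' p' = \<zero>" "dot R k q' p = \<zero>"
  shows "mat_mult R k (mat_mult R k (transv R k p q) (transv R k p' q'))
      (mat_mult R k (transv R k (\<lambda>i. \<ominus> p i) q) (transv R k (\<lambda>i. \<ominus> p' i) q'))
    = transv R k p (\<lambda>i. dot R k q p' \<otimes> q' i)"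
proof -
  interpret M: ring "mat_ring R k" by (rule ring_mat_ring)
  have "outer R k p q \<in> carrier (mat_ring R k)" "outer R k p' q' \<in> carrier (mat_ring R k)"
    using assms by (auto simp: mat_ring_def)
  from M.unipotent_commutator[OF this] show ?thesis
    using assms by (simp add: transv_eq outer_uminus_left outer_mult_zero outer_mult) (simp add: mat_ring_def)
qed

lemma transv_conj:
  assumes "p \<in> vec_carrier R k" "q \<in> vec_carrier R k" "d \<in> vec_carrier R k" "h \<in> vec_carrier R k"
    and "dot R k h d = \<zero>"
  shows "mat_mult R k (mat_mult R k (transv R k d h) (transv R k p q)) (transv R k d (\<lambda>i. \<ominus> h i))
    = transv R k (\<lambda>i. p i \<oplus> dot R k h p \<otimes> d i) (\<lambda>i. q i \<ominus> dot R k q d \<otimes> h i)"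
proof -
  interpret M: ring "mat_ring R k" by (rule ring_mat_ring)
  let ?P = "outer R k p q" and ?H = "outer R k d h" and ?p = "\<lambda>i. p i \<oplus> dot R k h p \<otimes> d i"
  have cl: "?P \<in> carrier (mat_ring R k)" "?H \<in> carrier (mat_ring R k)"
    using assms by (auto simp: mat_ring_def)
  have HP: "?P \<oplus>\<^bsub>mat_ring R k\<^esub> ?H \<otimes>\<^bsub>mat_ring R k\<^esub> ?P = outer R k ?p q"
    using assms by (simp add: outer_add_left outer_mult outer_smult)
  have HPH: "outer R k ?p q \<otimes>\<^bsub>mat_ring R k\<^esub> ?H = outer R k ?p (\<lambda>i. dot R k q d \<otimes> h i)"
    using assms by (simp add: outer_mult)
  show ?thesis using M.unipotent_conj[OF cl] assms unfolding HP HPH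
    by (simp add: transv_eq outer_uminus_right outer_uminus_left outer_mult_zero a_minus_def outer_add_right M.minus_eq)
       (simp add: mat_ring_def)
qed

end

text \<open>Words in the two families of generators, built from the left so that induction peels off
  one generator. The set \<open>J\<close> only bounds the entries of the parameters, which is how
  divisibility by powers of a denominator is tracked. Inverses are not put in by hand: they are
  present as soon as \<open>J\<close> is closed under negation.\<close>

inductive_set ET :: "('c, 'd) ring_scheme \<Rightarrow> nat \<Rightarrow> (nat \<Rightarrow> 'c) \<Rightarrow> (nat \<Rightarrow> 'c) \<Rightarrow> 'c set \<Rightarrow> (nat \<Rightarrow> nat \<Rightarrow> 'c) set"
  for S :: "('c, 'd) ring_scheme" and k c d J where
  ET_one: "mat_one S k \<in> ET S k c d J"
| ET_row: "\<lbrakk>\<And>i. i < k \<Longrightarrow> g i \<in> J; dot S k g d = \<zero>\<^bsub>S\<^esub>; A \<in> ET S k c d J\<rbrakk> \<Longrightarrow>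
     mat_mult S k (transv S k d g) A \<in> ET S k c d J"
| ET_col: "\<lbrakk>\<And>i. i < k \<Longrightarrow> \<kappa> i \<in> J; dot S k c \<kappa> = \<zero>\<^bsub>S\<^esub>; A \<in> ET S k c d J\<rbrakk> \<Longrightarrow>
     mat_mult S k (transv S k \<kappa> c) A \<in> ET S k c d J"

section \<open>Transposes and closure properties of the words in transvections\<close>

definition mat_transpose :: "(nat \<Rightarrow> nat \<Rightarrow> 'c) \<Rightarrow> (nat \<Rightarrow> nat \<Rightarrow> 'c)" where
  "mat_transpose A = (\<lambda>i j. A j i)"

lemma mat_transpose_carrier [simp]: "mat_transpose A \<in> mat_carrier S k \<longleftrightarrow> A \<in> mat_carrier S k"
  unfolding mat_transpose_def mat_carrier_def mem_Collect_eq by metis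

lemma mat_transpose_transpose [simp]: "mat_transpose (mat_transpose A) = A"
  by (simp add: mat_transpose_def)

lemma mat_transpose_one [simp]: "mat_transpose (mat_one S k) = mat_one S k"
  by (auto simp: mat_transpose_def mat_one_def fun_eq_iff)

context cring
begin

lemma dot_delta:
  assumes "i < k" "v \<in> vec_carrier R k" "x \<in> carrier R"
  shows "dot R k v (\<lambda>a. if a = i then x else \<zero>) = v i \<otimes> x"
proof -
  have "dot R k v (\<lambda>a. if a = i then x else \<zero>) = (\<Oplus>l\<in>{..<k}. if l = i then v l \<otimes> x else \<zero>)"
    unfolding dot_def using assms by (intro finsum_cong') (auto simp: vec_carrierD)
  also have "\<dots> = v i \<otimes> x" using assms by (intro finsum_delta) (auto simp: vec_carrierD)
  finally show ?thesis .
qed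

lemma dot_indicator: "i < k \<Longrightarrow> v \<in> vec_carrier R k \<Longrightarrow> dot R k v (\<lambda>a. if a = i then \<one> else \<zero>) = v i"
  by (simp add: dot_delta vec_carrierD)

lemma mat_transpose_mult:
  "A \<in> mat_carrier R k \<Longrightarrow> B \<in> mat_carrier R k \<Longrightarrow>
   mat_transpose (mat_mult R k A B) = mat_mult R k (mat_transpose B) (mat_transpose A)"
  by (auto simp: mat_transpose_def mat_mult_dot fun_eq_iff dot_comm)

lemma mat_transpose_transv:
  "p \<in> vec_carrier R k \<Longrightarrow> q \<in> vec_carrier R k \<Longrightarrow> mat_transpose (transv R k p q) = transv R k q p"
  by (auto simp: mat_transpose_def transv_def mat_one_def outer_def fun_eq_iff m_comm vec_carrierD)

context
  fixes k c d J
  assumes cd [simp]: "c \<in> vec_carrier R k" "d \<in> vec_carrier R k" and J: "J \<subseteq> carrier R"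
begin

lemma vec_in_carrier: "(\<And>i. i < k \<Longrightarrow> g i \<in> J) \<Longrightarrow> g \<in> vec_carrier R k"
  using J by (auto simp: vec_carrier_def)

lemma ET_closed [simp]: "A \<in> ET R k c d J \<Longrightarrow> A \<in> mat_carrier R k"
  by (induction rule: ET.induct) (auto simp: vec_in_carrier)

lemma ET_mult:
  assumes "A \<in> ET R k c d J" "B \<in> ET R k c d J"
  shows "mat_mult R k A B \<in> ET R k c d J"
  using assms(1)
proof (induction rule: ET.induct)
  case ET_one
  then show ?case using assms(2) by simp
next
  case (ET_row g A)
  then show ?case using assms(2) by (simp add: mat_mult_assoc vec_in_carrier ET.ET_row)
next
  case (ET_col \<kappa> A)
  then show ?case using assms(2) by (simp add: mat_mult_assoc vec_in_carrier ET.ET_col)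
qed

lemma transv_row_ET: "(\<And>i. i < k \<Longrightarrow> g i \<in> J) \<Longrightarrow> dot R k g d = \<zero> \<Longrightarrow> transv R k d g \<in> ET R k c d J"
  using ET.ET_row[OF _ _ ET.ET_one, of k g J R d c] by (simp add: vec_in_carrier)

lemma transv_col_ET: "(\<And>i. i < k \<Longrightarrow> \<kappa> i \<in> J) \<Longrightarrow> dot R k c \<kappa> = \<zero> \<Longrightarrow> transv R k \<kappa> c \<in> ET R k c d J"
  using ET.ET_col[OF _ _ ET.ET_one, of k \<kappa> J R c d] by (simp add: vec_in_carrier)

lemma transv_col_inverse:
  assumes "\<kappa> \<in> vec_carrier R k" "dot R k c \<kappa> = \<zero>"
  shows "mat_mult R k (transv R k \<kappa> c) (transv R k (\<lambda>i. \<ominus> \<kappa> i) c) = mat_one R k"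
    and "mat_mult R k (transv R k (\<lambda>i. \<ominus> \<kappa> i) c) (transv R k \<kappa> c) = mat_one R k"
  using assms by (auto simp: transv_uminus_right[symmetric] transv_inverse)

text \<open>A generator is inverted by negating its parameter, and the order of the word is
  reversed.\<close>

lemma ET_inverse:
  assumes "A \<in> ET R k c d J" "\<And>x. x \<in> J \<Longrightarrow> \<ominus> x \<in> J"
  shows "\<exists>B\<in>ET R k c d J. mat_mult R k A B = mat_one R k \<and> mat_mult R k B A = mat_one R k"
  using assms(1)
proof (induction rule: ET.induct)
  case ET_one
  then show ?case by (intro bexI[of _ "mat_one R k"]) (auto intro: ET.ET_one)
next
  case (ET_row g A)
  then obtain B where B: "B \<in> ET R k c d J" "mat_mult R k A B = mat_one R k" "mat_mult R k B A = mat_one R k" by blast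
  let ?g = "\<lambda>i. \<ominus> g i"
  note [simp] = vec_in_carrier[OF ET_row(1)]
  have g: "transv R k d ?g \<in> ET R k c d J"
    using ET_row assms(2) by (intro transv_row_ET) (auto simp: dot_uminus_left)
  have "mat_mult R k (mat_mult R k (transv R k d g) A) (mat_mult R k B (transv R k d ?g))
     = mat_mult R k (transv R k d g) (mat_mult R k (mat_mult R k A B) (transv R k d ?g))"
    using ET_row(3) B(1) by (simp add: mat_mult_assoc)
  moreover have "mat_mult R k (mat_mult R k B (transv R k d ?g)) (mat_mult R k (transv R k d g) A)
     = mat_mult R k B (mat_mult R k (mat_mult R k (transv R k d ?g) (transv R k d g)) A)"
    using ET_row(3) B(1) by (simp add: mat_mult_assoc)
  ultimately show ?case using B g ET_row
    by (intro bexI[of _ "mat_mult R k B (transv R k d ?g)"]) (auto simp: transv_inverse ET_mult)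
next
  case (ET_col g A)
  then obtain B where B: "B \<in> ET R k c d J" "mat_mult R k A B = mat_one R k" "mat_mult R k B A = mat_one R k" by blast
  let ?g = "\<lambda>i. \<ominus> g i"
  note [simp] = vec_in_carrier[OF ET_col(1)]
  have g: "transv R k ?g c \<in> ET R k c d J"
    using ET_col assms(2) by (intro transv_col_ET) (auto simp: dot_uminus_right)
  have "mat_mult R k (mat_mult R k (transv R k g c) A) (mat_mult R k B (transv R k ?g c))
     = mat_mult R k (transv R k g c) (mat_mult R k (mat_mult R k A B) (transv R k ?g c))"
    using ET_col(3) B(1) by (simp add: mat_mult_assoc)
  moreover have "mat_mult R k (mat_mult R k B (transv R k ?g c)) (mat_mult R k (transv R k g c) A)
     = mat_mult R k B (mat_mult R k (mat_mult R k (transv R k ?g c) (transv R k g c)) A)"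
    using ET_col(3) B(1) by (simp add: mat_mult_assoc)
  ultimately show ?case using B g ET_col
    by (intro bexI[of _ "mat_mult R k B (transv R k ?g c)"]) (auto simp: transv_col_inverse ET_mult)
qed

end

text \<open>Transposition turns \<open>I + p q^t\<close> into \<open>I + q p^t\<close>, so it
  exchanges rows with columns and \<open>c\<close> with \<open>d\<close>. Conjugation by column
  transvections is deduced from conjugation by row transvections in this way.\<close>

lemma ET_transpose:
  assumes "A \<in> ET R k c d J" "c \<in> vec_carrier R k" "d \<in> vec_carrier R k" "J \<subseteq> carrier R"
  shows "mat_transpose A \<in> ET R k d c J"
  using assms(1)
proof (induction rule: ET.induct)
  case ET_one
  then show ?case by (simp add: ET.ET_one)
next
  case (ET_row g A)
  then have "g \<in> vec_carrier R k" using assms(4) by (auto simp: vec_carrier_def)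
  with ET_row assms show ?case
    by (auto simp: mat_transpose_mult ET_closed[of c k d J] mat_transpose_transv dot_comm
        intro!: ET_mult transv_col_ET)
next
  case (ET_col g A)
  then have "g \<in> vec_carrier R k" using assms(4) by (auto simp: vec_carrier_def)
  with ET_col assms show ?case
    by (auto simp: mat_transpose_mult ET_closed[of c k d J] mat_transpose_transv dot_comm
        intro!: ET_mult transv_row_ET)
qed

lemma ET_mono: "A \<in> ET R k c d J \<Longrightarrow> J \<subseteq> J' \<Longrightarrow> A \<in> ET R k c d J'"
  by (induction rule: ET.induct) (auto intro!: ET.intros)

end

section \<open>Parameters divisible by powers of a denominator\<close>

definition pow_multiples :: "('c, 'd) ring_scheme \<Rightarrow> 'c set \<Rightarrow> 'c \<Rightarrow> nat \<Rightarrow> 'c set" where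
  "pow_multiples S A t M = (\<lambda>a. t [^]\<^bsub>S\<^esub> M \<otimes>\<^bsub>S\<^esub> a) ` A"

text \<open>
  The ring plays the role of a localization in which $t$ is invertible, $A$ is the image of the
  unlocalized ring, and $t$ is a multiple of both $c_j$ and $d_j$. Conjugation will lower the
  exponent $M$ of the sets $J_M = t^M A$ of admissible parameters in a controlled way.
\<close>

locale denominators = cring R for R (structure) +
  fixes A t k c d j tc td
  assumes subring_A: "subring A R" and t: "t \<in> A" "t \<in> Units R"
    and c_A: "\<And>i. i < k \<Longrightarrow> c i \<in> A" and d_A: "\<And>i. i < k \<Longrightarrow> d i \<in> A"
    and j: "j < k" and k: "3 \<le> k" and dot_cd: "dot R k c d = \<one>"
    and tc: "tc \<in> A" "t = c j \<otimes> tc" and td: "td \<in> A" "t = d j \<otimes> td"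
begin

abbreviation J :: "nat \<Rightarrow> 'a set" where "J \<equiv> pow_multiples R A t"

lemmas J_def = pow_multiples_def

text \<open>Conjugation by a row transvection. Its inverse is written out as the transvection by
  \<open>- h\<close>, which is correct when \<open>h . d = 0\<close>.\<close>

definition tconj :: "(nat \<Rightarrow> 'a) \<Rightarrow> (nat \<Rightarrow> nat \<Rightarrow> 'a) \<Rightarrow> (nat \<Rightarrow> nat \<Rightarrow> 'a)" where
  "tconj h U = mat_mult R k (mat_mult R k (transv R k d h) U) (transv R k d (\<lambda>i. \<ominus> h i))"

lemma A_carrier [simp]: "a \<in> A \<Longrightarrow> a \<in> carrier R"
  using subringE(1)[OF subring_A] by blast

lemma t_carrier [simp]: "t \<in> carrier R" using t by simp

lemma A_pow [simp]: "t [^] (M::nat) \<in> A"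
  using t subringE(3,6)[OF subring_A] by (induction M) auto

lemma cd_closed [simp]: "c \<in> vec_carrier R k" "d \<in> vec_carrier R k"
  using c_A d_A by (auto simp: vec_carrier_def)

lemma cj_unit: "c j \<in> Units R"
proof -
  from t obtain t' where "t' \<in> carrier R" "t \<otimes> t' = \<one>" by (auto simp: Units_def)
  then have "c j \<otimes> (tc \<otimes> t') = \<one>" "tc \<otimes> t' \<in> carrier R"
    using tc c_A[OF j] by (auto simp: m_assoc[symmetric])
  then show ?thesis using c_A[OF j] m_comm[of "tc \<otimes> t'" "c j"] unfolding Units_def by auto
qed

lemma t_inv_cj: "t \<otimes> inv (c j) = tc"
proof -
  have "t \<otimes> inv (c j) = tc \<otimes> (c j \<otimes> inv (c j))"
    using tc cj_unit Units_closed[OF cj_unit] by (simp add: m_ac)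
  then show ?thesis using tc cj_unit by simp
qed

lemma J_closed [simp]: "x \<in> J M \<Longrightarrow> x \<in> carrier R"
  by (auto simp: J_def)

lemma J_subset: "J M \<subseteq> carrier R" by auto

lemma J_uminus: "x \<in> J M \<Longrightarrow> \<ominus> x \<in> J M"
  unfolding J_def using subringE(5)[OF subring_A]
  by (auto simp: r_minus[symmetric] intro!: image_eqI)

lemma J_smult: "a \<in> A \<Longrightarrow> x \<in> J M \<Longrightarrow> a \<otimes> x \<in> J M"
proof -
  assume a: "a \<in> A" "x \<in> J M"
  then obtain b where b: "b \<in> A" "x = t [^] M \<otimes> b" by (auto simp: J_def)
  then have "a \<otimes> x = t [^] M \<otimes> (a \<otimes> b)" using a by (simp add: m_lcomm)
  then show ?thesis using a b subringE(6)[OF subring_A] unfolding J_def by blast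
qed

lemma J_smult_right: "a \<in> A \<Longrightarrow> x \<in> J M \<Longrightarrow> x \<otimes> a \<in> J M"
  using J_smult[of a x M] by (simp add: m_comm)

text \<open>Divisibility by \<open>t^(M + n)\<close> pays for the denominator \<open>t^n\<close> of
  \<open>h\<close> and still leaves \<open>t^M\<close>.\<close>

lemma J_frac:
  assumes "x \<in> J L" "L = M + n" "h \<in> carrier R" "t [^] n \<otimes> h \<in> A"
  shows "x \<otimes> h \<in> J M"
proof -
  from assms obtain a where a: "a \<in> A" "x = t [^] (M + n) \<otimes> a" by (auto simp: J_def)
  then have "x \<otimes> h = t [^] M \<otimes> (a \<otimes> (t [^] n \<otimes> h))"
    using assms by (simp add: nat_pow_mult[symmetric] m_ac)
  moreover have "a \<otimes> (t [^] n \<otimes> h) \<in> A" using a assms subringE(6)[OF subring_A] by blast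
  ultimately show ?thesis unfolding J_def by blast
qed

lemma t_pow_J: "t [^] M \<in> J M"
  using subringE(3)[OF subring_A] unfolding J_def by (force intro!: image_eqI[of _ _ \<one>])

lemma J_antimono: "M \<le> N \<Longrightarrow> J N \<subseteq> J M"
proof
  fix x assume "M \<le> N" "x \<in> J N"
  then show "x \<in> J M" using J_frac[of x N M "N - M" \<one>] by simp
qed

lemma J_split:
  assumes "x \<in> J L" "L = M + N"
  obtains y where "y \<in> J N" "x = t [^] M \<otimes> y"
  using assms unfolding J_def
  by (auto simp: nat_pow_mult[symmetric] m_assoc)

lemma conj_closed [simp]:
  "h \<in> vec_carrier R k \<Longrightarrow> U \<in> mat_carrier R k \<Longrightarrow> tconj h U \<in> mat_carrier R k"
  by (simp add: tconj_def)

lemma conj_mult: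
  assumes "h \<in> vec_carrier R k" "dot R k h d = \<zero>" "U \<in> mat_carrier R k" "V \<in> mat_carrier R k"
  shows "tconj h (mat_mult R k U V) = mat_mult R k (tconj h U) (tconj h V)"
proof -
  let ?H = "transv R k d h" and ?H' = "transv R k d (\<lambda>i. \<ominus> h i)"
  have "mat_mult R k (tconj h U) (tconj h V)
    = mat_mult R k (mat_mult R k ?H U) (mat_mult R k (mat_mult R k ?H' ?H) (mat_mult R k V ?H'))"
    using assms by (simp add: tconj_def mat_mult_assoc)
  also have "\<dots> = tconj h (mat_mult R k U V)"
    using assms by (simp add: tconj_def mat_mult_assoc transv_inverse)
  finally show ?thesis by simp
qed

lemma conj_transv:
  assumes "h \<in> vec_carrier R k" "dot R k h d = \<zero>" "p \<in> vec_carrier R k" "q \<in> vec_carrier R k"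
  shows "tconj h (transv R k p q)
    = transv R k (\<lambda>i. p i \<oplus> dot R k h p \<otimes> d i) (\<lambda>i. q i \<ominus> dot R k q d \<otimes> h i)"
  unfolding tconj_def using assms by (intro transv_conj) auto

text \<open>Row transvections multiply by adding their parameters, so a parameter can be split into
  summands that are easier to conjugate by.\<close>

lemma conj_add:
  assumes "h \<in> vec_carrier R k" "dot R k h d = \<zero>" "h' \<in> vec_carrier R k" "dot R k h' d = \<zero>"
    "U \<in> mat_carrier R k"
  shows "tconj (\<lambda>i. h i \<oplus> h' i) U = tconj h (tconj h' U)"
proof -
  have 1: "transv R k d (\<lambda>i. h i \<oplus> h' i) = mat_mult R k (transv R k d h) (transv R k d h')"
    using assms by (simp add: transv_mult_same_left)
  have 2: "transv R k d (\<lambda>i. \<ominus> (h i \<oplus> h' i)) = mat_mult R k (transv R k d (\<lambda>i. \<ominus> h' i)) (transv R k d (\<lambda>i. \<ominus> h i))"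
    using assms by (simp add: transv_mult_same_left dot_uminus_left)
       (intro transv_cong, auto simp: vec_carrierD minus_add a_comm)
  show ?thesis unfolding tconj_def 1 2 using assms by (simp add: mat_mult_assoc)
qed

text \<open>The scalar in the middle of the commutator is \<open>c . d = 1\<close>. The coefficient
  is split as \<open>a b\<close> so that its divisibility can be shared between the column generator
  and the row generator.\<close>

lemma transv_eq_commutator:
  assumes "\<kappa> \<in> vec_carrier R k" "h \<in> vec_carrier R k" "a \<in> carrier R" "b \<in> carrier R"
    and "dot R k c \<kappa> = \<zero>" "dot R k h d = \<zero>" "dot R k h \<kappa> = \<zero>"
  shows "transv R k (\<lambda>i. a \<otimes> b \<otimes> \<kappa> i) h =
    mat_mult R k (mat_mult R k (transv R k (\<lambda>i. a \<otimes> \<kappa> i) c) (transv R k d (\<lambda>i. b \<otimes> h i)))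
      (mat_mult R k (transv R k (\<lambda>i. \<ominus> (a \<otimes> \<kappa> i)) c) (transv R k d (\<lambda>i. \<ominus> (b \<otimes> h i))))"
proof -
  let ?p = "\<lambda>i. a \<otimes> \<kappa> i" and ?q = "\<lambda>i. b \<otimes> h i"
  have "transv R k (\<lambda>i. a \<otimes> b \<otimes> \<kappa> i) h = transv R k (\<lambda>i. b \<otimes> ?p i) h"
    using assms by (intro transv_cong) (auto simp: m_ac vec_carrierD)
  also have "\<dots> = transv R k ?p ?q" using assms by (simp add: transv_smult)
  also have "\<dots> = transv R k ?p (\<lambda>i. dot R k c d \<otimes> ?q i)"
    using assms by (intro transv_cong) (auto simp: dot_cd vec_carrierD)
  also have "\<dots> = mat_mult R k (mat_mult R k (transv R k ?p c) (transv R k d ?q))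
      (mat_mult R k (transv R k (\<lambda>i. \<ominus> ?p i) c) (transv R k (\<lambda>i. \<ominus> d i) ?q))"
    using assms by (subst transv_commutator) (auto simp: dot_smult_left dot_smult_right)
  also have "transv R k (\<lambda>i. \<ominus> d i) ?q = transv R k d (\<lambda>i. \<ominus> ?q i)"
    using assms by (simp add: transv_uminus_right)
  finally show ?thesis .
qed

lemma transv_ET:
  assumes "\<kappa> \<in> vec_carrier R k" "h \<in> vec_carrier R k" "a \<in> carrier R" "b \<in> carrier R"
    and "dot R k c \<kappa> = \<zero>" "dot R k h d = \<zero>" "dot R k h \<kappa> = \<zero>"
    and "\<And>i. i < k \<Longrightarrow> a \<otimes> \<kappa> i \<in> J M" and "\<And>i. i < k \<Longrightarrow> b \<otimes> h i \<in> J M"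
  shows "transv R k (\<lambda>i. a \<otimes> b \<otimes> \<kappa> i) h \<in> ET R k c d (J M)"
  unfolding transv_eq_commutator[OF assms(1-7)] using assms
  by (intro ET_mult transv_row_ET transv_col_ET)
     (auto simp: J_uminus dot_smult_left dot_smult_right dot_uminus_left dot_uminus_right)

text \<open>As \<open>h\<close> kills \<open>\<kappa>\<close>, the column does not change; as
  \<open>c . d = 1\<close>, the row \<open>c\<close> becomes \<open>c - h\<close>.\<close>

lemma conj_orthogonal:
  assumes "\<kappa> \<in> vec_carrier R k" "h \<in> vec_carrier R k"
    and "dot R k c \<kappa> = \<zero>" "dot R k h d = \<zero>" "dot R k h \<kappa> = \<zero>"
  shows "tconj h (transv R k \<kappa> c) = mat_mult R k (transv R k \<kappa> c) (transv R k \<kappa> (\<lambda>i. \<ominus> h i))"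
  using assms
  by (simp add: conj_transv transv_mult_same_left dot_cd)
     (intro transv_cong, auto simp: vec_carrierD a_minus_def d_A)

text \<open>
  As $c_j$ is a unit, the vectors $k_i = c_j e_i - c_i e_j$ with $i \neq j$ form a basis of the
  kernel of $c$; up to the factor $c_j$, the dual basis consists of the functionals
  $e_l - d_l c$, which vanish on $d$.
\<close>

definition kv :: "nat \<Rightarrow> nat \<Rightarrow> 'a" where
  "kv i = (\<lambda>a. if a = i then c j else if a = j then \<ominus> c i else \<zero>)"

definition kd :: "nat \<Rightarrow> nat \<Rightarrow> 'a" where
  "kd l = (\<lambda>a. (if a = l then \<one> else \<zero>) \<ominus> d l \<otimes> c a)"

lemma kv_A: "i < k \<Longrightarrow> a < k \<Longrightarrow> kv i a \<in> A"
  using c_A j subringE(2,5)[OF subring_A] by (auto simp: kv_def)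

lemma kd_A: "i < k \<Longrightarrow> a < k \<Longrightarrow> kd i a \<in> A"
  using c_A d_A j subringE(2,3,5,6,7)[OF subring_A] by (auto simp: kd_def a_minus_def)

lemma kv_carrier [simp]: "i < k \<Longrightarrow> a < k \<Longrightarrow> kv i a \<in> carrier R"
  using kv_A by simp

lemma kd_carrier [simp]: "i < k \<Longrightarrow> a < k \<Longrightarrow> kd i a \<in> carrier R"
  using kd_A by simp

lemma kv_closed [simp]: "i < k \<Longrightarrow> kv i \<in> vec_carrier R k"
  using kv_A by (auto simp: vec_carrier_def)

lemma kd_closed [simp]: "i < k \<Longrightarrow> kd i \<in> vec_carrier R k"
  using kd_A by (auto simp: vec_carrier_def)

lemma dot_kv:
  assumes "i < k" "i \<noteq> j" "v \<in> vec_carrier R k"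
  shows "dot R k v (kv i) = v i \<otimes> c j \<ominus> v j \<otimes> c i"
proof -
  have cc: "c j \<in> carrier R" "c i \<in> carrier R" using assms c_A j by auto
  have "dot R k v (kv i) = dot R k v (\<lambda>a. (if a = i then c j else \<zero>) \<oplus> (if a = j then \<ominus> c i else \<zero>))"
    using assms cc kv_closed[of i] by (intro dot_cong) (auto simp: kv_def)
  also have "\<dots> = v i \<otimes> c j \<oplus> v j \<otimes> (\<ominus> c i)"
    using assms cc j by (subst dot_add_right) (auto simp: dot_delta vec_carrier_def)
  finally show ?thesis using assms cc j by (simp add: r_minus a_minus_def vec_carrierD)
qed

lemma dot_c_kv: "i < k \<Longrightarrow> i \<noteq> j \<Longrightarrow> dot R k c (kv i) = \<zero>"
  using c_A j by (simp add: dot_kv m_comm r_neg a_minus_def)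

text \<open>On the kernel of \<open>c\<close> this functional is the coordinate \<open>v l\<close>;
  at \<open>d\<close>, where \<open>c . d = 1\<close>, it vanishes.\<close>

lemma dot_kd:
  assumes "l < k" "v \<in> vec_carrier R k"
  shows "dot R k (kd l) v = v l \<ominus> d l \<otimes> dot R k c v"
proof -
  have dd: "d l \<in> carrier R" using assms d_A by auto
  have "dot R k (kd l) v = dot R k (\<lambda>a. if a = l then \<one> else \<zero>) v \<ominus> dot R k (\<lambda>a. d l \<otimes> c a) v"
    unfolding kd_def using assms dd by (intro dot_minus_left) (auto simp: vec_carrier_def c_A)
  also have "dot R k (\<lambda>a. if a = l then \<one> else \<zero>) v = dot R k v (\<lambda>a. if a = l then \<one> else \<zero>)"
    using assms by (intro dot_comm) (auto simp: vec_carrier_def)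
  finally show ?thesis using assms dd by (simp add: dot_delta dot_smult_left vec_carrierD)
qed

lemma dot_kd_d: "l < k \<Longrightarrow> dot R k (kd l) d = \<zero>"
  using d_A by (simp add: dot_kd dot_cd r_neg a_minus_def)

lemma dot_kd_kv: "l < k \<Longrightarrow> i < k \<Longrightarrow> i \<noteq> j \<Longrightarrow> l \<noteq> j \<Longrightarrow> dot R k (kd l) (kv i) = (if i = l then c j else \<zero>)"
  using c_A d_A j by (simp add: dot_kd dot_c_kv a_minus_def) (simp add: kv_def)

end

section \<open>Conjugation of elementary transvections with denominators\<close>

context denominators
begin

text \<open>Row transvections share the column \<open>d\<close>, which all their rows annihilate, so
  they commute.\<close>

lemma conj_row_commute:
  assumes "h \<in> vec_carrier R k" "dot R k h d = \<zero>" "g \<in> vec_carrier R k" "dot R k g d = \<zero>"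
  shows "tconj h (transv R k d g) = transv R k d g"
  using assms by (simp add: conj_transv) (intro transv_cong, auto simp: vec_carrierD a_minus_def d_A)

lemma tconj_cong: "(\<And>i. i < k \<Longrightarrow> h i = h' i) \<Longrightarrow> tconj h = tconj h'"
  unfolding tconj_def using transv_cong[of k d d h h'] transv_cong[of k d d "\<lambda>i. \<ominus> h i" "\<lambda>i. \<ominus> h' i"] by simp

text \<open>The conjugate is \<open>(I + e \<kappa> c) (I - e \<kappa> h)\<close> and the second
  factor is a commutator. Of \<open>e = t^M y\<close> the column generator takes \<open>t^M\<close>
  and the row generator takes \<open>y\<close>, which must also absorb the denominator
  \<open>t^2\<close> of \<open>h\<close>. Hence \<open>2M + 2 = M + (M + 2)\<close>.\<close>

lemma conj_col_orthogonal_ET: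
  assumes "\<kappa> \<in> vec_carrier R k" "h \<in> vec_carrier R k" "e \<in> J (2 * M + 2)"
    and "dot R k c \<kappa> = \<zero>" "dot R k h d = \<zero>" "dot R k h \<kappa> = \<zero>"
    and \<kappa>: "\<And>i. i < k \<Longrightarrow> \<kappa> i \<in> A" and h: "\<And>i. i < k \<Longrightarrow> t [^] (2::nat) \<otimes> h i \<in> A"
  shows "tconj h (transv R k (\<lambda>i. e \<otimes> \<kappa> i) c) \<in> ET R k c d (J M)"
proof -
  obtain y where y: "y \<in> J (M + 2)" "e = t [^] M \<otimes> y"
    using J_split[OF assms(3), of M "M + 2"] by auto
  have eM: "e \<in> J M" using assms(3) J_antimono[of M "2 * M + 2"] by auto
  have "tconj h (transv R k (\<lambda>i. e \<otimes> \<kappa> i) c)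
    = mat_mult R k (transv R k (\<lambda>i. e \<otimes> \<kappa> i) c) (transv R k (\<lambda>i. e \<otimes> \<kappa> i) (\<lambda>i. \<ominus> h i))"
    using assms by (intro conj_orthogonal) (auto simp: dot_smult_right)
  moreover have "transv R k (\<lambda>i. e \<otimes> \<kappa> i) c \<in> ET R k c d (J M)"
    using assms eM by (intro transv_col_ET) (auto simp: dot_smult_right J_smult_right)
  moreover have "transv R k (\<lambda>i. t [^] M \<otimes> y \<otimes> \<kappa> i) (\<lambda>i. \<ominus> h i) \<in> ET R k c d (J M)"
    using assms y
    by (intro transv_ET)
       (auto simp: dot_uminus_left J_smult_right t_pow_J r_minus vec_carrierD intro!: J_uminus J_frac[where n = 2])
  ultimately show ?thesis using y by (simp add: ET_mult J_subset)
qed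

text \<open>Here the row does not kill the column, so the conjugate is no product of evident
  generators. Rewriting the column transvection as the commutator of \<open>I + e1 kv_i kd_l\<close>
  and \<open>I + e2 kv_l c\<close> reduces the claim to these two factors. The exponent is
  \<open>(2M + 2) + 1 + (2M + 4)\<close>: the outer summands serve \<open>e2\<close> and
  \<open>e1\<close>, and one power of \<open>t\<close> produces the scalar
  \<open>c j\<close>.\<close>

lemma conj_kv_parallel:
  assumes i: "i < k" "i \<noteq> j" and lam: "\<mu> \<in> carrier R" "t [^] (2::nat) \<otimes> \<mu> \<in> A"
    and e: "e \<in> J (4 * M + 7)"
  shows "tconj (\<lambda>a. \<mu> \<otimes> kd i a) (transv R k (\<lambda>a. e \<otimes> kv i a) c) \<in> ET R k c d (J M)"
proof -
  \<comment> \<open>Of three indices at least one differs from both \<open>i\<close> and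
    \<open>j\<close>; this is where \<open>3 \<le> k\<close> enters.\<close>
  obtain l where "l \<in> {0, 1, 2::nat}" and lij: "l \<noteq> i" "l \<noteq> j"
    by (metis insertCI zero_neq_one zero_neq_numeral one_eq_numeral_iff num.distinct(1))
  then have l: "l < k" "l \<noteq> i" "l \<noteq> j" using k by auto
  let ?h = "\<lambda>a. \<mu> \<otimes> kd i a"
  have h: "?h \<in> vec_carrier R k" "dot R k ?h d = \<zero>" "dot R k ?h (kv l) = \<zero>" "dot R k ?h (kv i) = \<mu> \<otimes> c j"
    using i l lam by (auto simp: dot_smult_left dot_kd_d dot_kd_kv)
  have hA: "t [^] (2::nat) \<otimes> (\<mu> \<otimes> kd i a) \<in> A" if "a < k" for a
    using that lam i subringE(6)[OF subring_A] kd_A[of i a] by (simp add: m_assoc[symmetric])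
  have cj: "c j \<in> A" using c_A j by simp
  \<comment> \<open>Since \<open>kd l\<close> kills \<open>d\<close>, the row is unchanged and the
    column only gains a multiple \<open>\<eta> d\<close>. That multiple splits off as a row
    transvection, and the rest is a commutator of generators.\<close>
  have U1: "tconj ?h (transv R k (\<lambda>a. e1 \<otimes> kv i a) (kd l)) \<in> ET R k c d (J M)" if e1: "e1 \<in> J (2 * M + 4)" for e1
  proof -
    define \<eta> where "\<eta> = e1 \<otimes> (\<mu> \<otimes> c j)"
    have "e1 \<otimes> \<mu> \<in> J (2 * M + 2)" using lam by (intro J_frac[OF e1, of _ 2]) auto
    then have "e1 \<otimes> \<mu> \<in> J M" using J_antimono[of M "2 * M + 2"] by auto
    then have \<eta>: "\<eta> \<in> J M" using J_smult_right[OF cj] e1 lam cj by (simp add: \<eta>_def m_assoc[symmetric])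
    obtain y where y: "y \<in> J (M + 4)" "e1 = t [^] M \<otimes> y"
      using J_split[OF e1, of M "M + 4"] by auto
    have yM: "y \<in> J M" using y J_antimono[of M "M + 4"] by auto
    have "tconj ?h (transv R k (\<lambda>a. e1 \<otimes> kv i a) (kd l)) = transv R k (\<lambda>a. e1 \<otimes> kv i a \<oplus> \<eta> \<otimes> d a) (kd l)"
      using h i l e1 cj lam
      by (simp add: conj_transv) (intro transv_cong, auto simp: dot_smult_right \<eta>_def dot_kd_d vec_carrierD a_minus_def m_ac)
    also have "\<dots> = mat_mult R k (transv R k (\<lambda>a. e1 \<otimes> kv i a) (kd l)) (transv R k (\<lambda>a. \<eta> \<otimes> d a) (kd l))"
      using i l e1 \<eta> by (subst transv_mult_same_right) (auto simp: dot_smult_right dot_kd_d)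
    also have "transv R k (\<lambda>a. \<eta> \<otimes> d a) (kd l) = transv R k d (\<lambda>a. \<eta> \<otimes> kd l a)"
      using l \<eta> by (simp add: transv_smult)
    finally have eq: "tconj ?h (transv R k (\<lambda>a. e1 \<otimes> kv i a) (kd l))
      = mat_mult R k (transv R k (\<lambda>a. e1 \<otimes> kv i a) (kd l)) (transv R k d (\<lambda>a. \<eta> \<otimes> kd l a))" .
    have "transv R k d (\<lambda>a. \<eta> \<otimes> kd l a) \<in> ET R k c d (J M)"
      using l \<eta> by (intro transv_row_ET) (auto simp: dot_smult_left dot_kd_d J_smult_right kd_A)
    moreover have "transv R k (\<lambda>a. t [^] M \<otimes> y \<otimes> kv i a) (kd l) \<in> ET R k c d (J M)"
      using i l y yM by (intro transv_ET) (auto simp: dot_c_kv dot_kd_d dot_kd_kv J_smult_right t_pow_J kv_A kd_A)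
    ultimately show ?thesis unfolding eq using y by (simp add: ET_mult J_subset)
  qed
  \<comment> \<open>The conjugating row is a multiple of \<open>kd i\<close> and kills
    \<open>kv l\<close>, so the orthogonal case applies.\<close>
  have U2: "tconj ?h (transv R k (\<lambda>a. e2 \<otimes> kv l a) c) \<in> ET R k c d (J M)" if e2: "e2 \<in> J (2 * M + 2)" for e2
    using e2 h l hA kv_A dot_c_kv by (intro conj_col_orthogonal_ET) auto
  obtain y where y: "y \<in> J (2 * M + 4)" "e = t [^] (2 * M + 3) \<otimes> y"
    using J_split[OF e, of "2 * M + 3" "2 * M + 4"] by auto
  \<comment> \<open>This needs a third index \<open>l\<close>: the column transvection along \<open>kv i\<close> is a commutator through \<open>kv l\<close>.\<close>
  define e1 e2 where "e1 = tc \<otimes> y" and "e2 = t [^] (2 * M + 2)"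
  have e1: "e1 \<in> J (2 * M + 4)" using y(1) tc(1) by (simp add: e1_def J_smult)
  have e2: "e2 \<in> J (2 * M + 2)" unfolding e2_def by (rule t_pow_J)
  have [simp]: "c j \<in> carrier R" "tc \<in> carrier R" "y \<in> carrier R" "e1 \<in> carrier R" "e2 \<in> carrier R"
    using cj tc y e1 e2 by auto
  \<comment> \<open>One power of \<open>t\<close> is spent on \<open>c j\<close>, which is the value
    of \<open>kd l\<close> at \<open>kv l\<close>; its cofactor \<open>tc\<close> has been put into
    \<open>e1\<close>.\<close>
  have e_eq: "e = e2 \<otimes> c j \<otimes> e1"
  proof -
    have "e = e2 \<otimes> t \<otimes> y" unfolding y(2) e2_def by (simp add: eval_nat_numeral)
    then show ?thesis unfolding tc(2) by (simp add: e1_def m_assoc)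
  qed
  let ?p = "\<lambda>a. e1 \<otimes> kv i a" and ?p' = "\<lambda>a. e2 \<otimes> kv l a"
  have "transv R k (\<lambda>a. e \<otimes> kv i a) c = transv R k (\<lambda>a. (e2 \<otimes> c j) \<otimes> ?p a) c"
    using i by (intro transv_cong) (auto simp: e_eq m_assoc vec_carrierD)
  also have "\<dots> = transv R k ?p (\<lambda>a. dot R k (kd l) ?p' \<otimes> c a)"
    using i l by (subst transv_smult[symmetric]) (auto simp: dot_smult_right dot_kd_kv)
  also have "\<dots> = mat_mult R k (mat_mult R k (transv R k ?p (kd l)) (transv R k ?p' c))
      (mat_mult R k (transv R k (\<lambda>a. \<ominus> ?p a) (kd l)) (transv R k (\<lambda>a. \<ominus> ?p' a) c))"
    using i l by (subst transv_commutator) (auto simp: dot_smult_right dot_kd_kv dot_c_kv)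
  also have "transv R k (\<lambda>a. \<ominus> ?p a) (kd l) = transv R k (\<lambda>a. \<ominus> e1 \<otimes> kv i a) (kd l)"
    using i by (intro transv_cong) (auto simp: l_minus vec_carrierD)
  also have "transv R k (\<lambda>a. \<ominus> ?p' a) c = transv R k (\<lambda>a. \<ominus> e2 \<otimes> kv l a) c"
    using l by (intro transv_cong) (auto simp: l_minus vec_carrierD)
  finally have eq: "transv R k (\<lambda>a. e \<otimes> kv i a) c =
    mat_mult R k (mat_mult R k (transv R k ?p (kd l)) (transv R k ?p' c))
      (mat_mult R k (transv R k (\<lambda>a. \<ominus> e1 \<otimes> kv i a) (kd l)) (transv R k (\<lambda>a. \<ominus> e2 \<otimes> kv l a) c))" .
  show ?thesis unfolding eq using h i l U1 U2 e1 e2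
    by (simp add: conj_mult ET_mult J_subset J_uminus)
qed

text \<open>Removing a multiple of \<open>kd i\<close> from \<open>h\<close> leaves a row
  \<open>h'\<close> that kills \<open>kv i\<close>. Conjugation by \<open>h'\<close> gives an
  explicit word in generators, to which the parallel case is then applied. The exponent is
  \<open>(4M + 7) + (M + 2)\<close>: column factors have to pass through the parallel case, row
  factors only have to absorb the denominator \<open>t^2\<close> of \<open>h'\<close>.\<close>

lemma conj_kv:
  assumes i: "i < k" "i \<noteq> j" and h: "h \<in> vec_carrier R k" "dot R k h d = \<zero>" "\<And>a. a < k \<Longrightarrow> t \<otimes> h a \<in> A"
    and e: "e \<in> J (5 * M + 9)"
  shows "tconj h (transv R k (\<lambda>a. e \<otimes> kv i a) c) \<in> ET R k c d (J M)"
proof -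
  note A_closed = subringE(5,6,7)[OF subring_A]
  have cj: "c j \<in> A" "c i \<in> A" using c_A j i by auto
  have icj: "inv (c j) \<in> carrier R" "c j \<otimes> inv (c j) = \<one>" using cj_unit by auto
  \<comment> \<open>Chosen so that \<open>\<mu> kd i\<close> and \<open>h\<close> take the same
    value at \<open>kv i\<close>. The division by \<open>c j\<close> is responsible for a second
    power of \<open>t\<close> in the denominator.\<close>
  define \<mu> where "\<mu> = inv (c j) \<otimes> dot R k h (kv i)"
  have \<mu>c: "\<mu> \<in> carrier R" using icj h i by (simp add: \<mu>_def)
  have hij: "h i \<in> carrier R" "h j \<in> carrier R" using h i j by (auto simp: vec_carrierD)
  have "t \<otimes> dot R k h (kv i) = (t \<otimes> h i) \<otimes> c j \<oplus> \<ominus> ((t \<otimes> h j) \<otimes> c i)"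
    using h i cj hij by (simp add: dot_kv r_distr a_minus_def r_minus m_assoc)
  then have tA: "t \<otimes> dot R k h (kv i) \<in> A" using h(3) i j cj A_closed by auto
  have "t [^] (2::nat) \<otimes> \<mu> = (t \<otimes> inv (c j)) \<otimes> (t \<otimes> dot R k h (kv i))"
    using icj(1) h i by (simp add: \<mu>_def numeral_2_eq_2 m_ac)
  also have "\<dots> = tc \<otimes> (t \<otimes> dot R k h (kv i))" unfolding t_inv_cj ..
  finally have \<mu>A: "t [^] (2::nat) \<otimes> \<mu> \<in> A" using tA tc A_closed by auto
  define h1 h' where "h1 = (\<lambda>a. \<mu> \<otimes> kd i a)" and "h' = (\<lambda>a. h a \<ominus> h1 a)"
  have h1: "h1 \<in> vec_carrier R k" "dot R k h1 d = \<zero>" "dot R k h1 (kv i) = dot R k h (kv i)"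
    using \<mu>c i h icj cj by (auto simp: h1_def dot_smult_left dot_kd_d dot_kd_kv)
       (simp add: \<mu>_def m_comm[of _ "c j"] m_assoc[symmetric])
  have h': "h' \<in> vec_carrier R k" "dot R k h' d = \<zero>" "dot R k h' (kv i) = \<zero>"
    using h h1 i by (auto simp: h'_def dot_minus_left)
  have h'A: "t [^] (2::nat) \<otimes> h' a \<in> A" if a: "a < k" for a
  proof -
    have "t [^] (2::nat) \<otimes> h' a = t \<otimes> (t \<otimes> h a) \<oplus> \<ominus> ((t [^] (2::nat) \<otimes> \<mu>) \<otimes> kd i a)"
      using a h \<mu>c i by (simp add: h'_def h1_def r_distr a_minus_def r_minus m_assoc numeral_2_eq_2 vec_carrierD)
    then show ?thesis using h(3)[OF a] \<mu>A kd_A[OF i(1) a] t A_closed by auto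
  qed
  have "tconj h = tconj (\<lambda>a. h1 a \<oplus> h' a)"
    using h h1 by (intro tconj_cong) (auto simp: h'_def vec_carrierD a_minus_def a_lcomm r_neg)
  then have split: "tconj h U = tconj h1 (tconj h' U)" if "U \<in> mat_carrier R k" for U
    using that h1 h' by (simp add: conj_add)
  obtain b where b: "b \<in> J (M + 2)" "e = t [^] (4 * M + 7) \<otimes> b"
    using J_split[OF e, of "4 * M + 7" "M + 2"] by auto
  define a where "a = t [^] (4 * M + 7)"
  have a: "a \<in> J (4 * M + 7)" unfolding a_def by (rule t_pow_J)
  have [simp]: "a \<in> carrier R" "b \<in> carrier R" "e \<in> carrier R" using a b e by auto
  let ?p = "\<lambda>x. a \<otimes> kv i x" and ?q = "\<lambda>x. b \<otimes> (\<ominus> h' x)"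
  have par: "tconj h1 (transv R k (\<lambda>x. y \<otimes> kv i x) c) \<in> ET R k c d (J M)" if "y \<in> J (4 * M + 7)" for y
    unfolding h1_def using i \<mu>c \<mu>A that by (rule conj_kv_parallel)
  \<comment> \<open>Row factors are fixed by the conjugation, so it is enough that
    \<open>b h'\<close> has entries in \<open>J M\<close>.\<close>
  have row: "tconj h1 (transv R k d ?q) \<in> ET R k c d (J M)" "tconj h1 (transv R k d (\<lambda>x. \<ominus> ?q x)) \<in> ET R k c d (J M)"
    using h1 h' b h'A
    by (auto simp: conj_row_commute dot_smult_left dot_uminus_left r_minus vec_carrierD
        A_closed(1)
        intro!: transv_row_ET J_uminus J_frac[where n = 2])
  have "tconj h (transv R k (\<lambda>x. e \<otimes> kv i x) c)
    = tconj h1 (mat_mult R k (transv R k (\<lambda>x. e \<otimes> kv i x) c) (transv R k (\<lambda>x. e \<otimes> kv i x) (\<lambda>x. \<ominus> h' x)))"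
    using i h' by (simp add: split conj_orthogonal dot_smult_right dot_c_kv)
  also have "transv R k (\<lambda>x. e \<otimes> kv i x) (\<lambda>x. \<ominus> h' x) = mat_mult R k (mat_mult R k (transv R k ?p c) (transv R k d ?q))
      (mat_mult R k (transv R k (\<lambda>x. \<ominus> ?p x) c) (transv R k d (\<lambda>x. \<ominus> ?q x)))"
    using transv_eq_commutator[of "kv i" "\<lambda>x. \<ominus> h' x" a b] i h' b(2) dot_c_kv
    by (simp add: a_def dot_uminus_left)
  also have "transv R k (\<lambda>x. \<ominus> ?p x) c = transv R k (\<lambda>x. \<ominus> a \<otimes> kv i x) c"
    using i by (intro transv_cong) (auto simp: l_minus vec_carrierD)
  finally have eq: "tconj h (transv R k (\<lambda>x. e \<otimes> kv i x) c) = tconj h1 (mat_mult R k (transv R k (\<lambda>x. e \<otimes> kv i x) c)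
     (mat_mult R k (mat_mult R k (transv R k ?p c) (transv R k d ?q))
      (mat_mult R k (transv R k (\<lambda>x. \<ominus> a \<otimes> kv i x) c) (transv R k d (\<lambda>x. \<ominus> ?q x)))))" .
  have "e \<in> J (4 * M + 7)" using e J_antimono[of "4 * M + 7" "5 * M + 9"] by auto
  then show ?thesis unfolding eq using i h1 h' par a row
    by (simp add: conj_mult ET_mult J_subset J_uminus)
qed

text \<open>A vector killed by \<open>c\<close> is the sum of \<open>(\<kappa> i / c j) kv i\<close>
  over \<open>i \<noteq> j\<close>, and the column transvections multiply by adding these columns.
  Division by \<open>c j\<close> uses up the one power of \<open>t\<close> by which
  \<open>5M + 10\<close> exceeds the exponent for a single basis vector.\<close>

lemma conj_col:
  assumes h: "h \<in> vec_carrier R k" "dot R k h d = \<zero>" "\<And>a. a < k \<Longrightarrow> t \<otimes> h a \<in> A"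
    and \<kappa>: "\<And>a. a < k \<Longrightarrow> \<kappa> a \<in> J (5 * M + 10)" "dot R k c \<kappa> = \<zero>"
  shows "tconj h (transv R k \<kappa> c) \<in> ET R k c d (J M)"
proof -
  have icj: "inv (c j) \<in> carrier R" "c j \<in> carrier R" "c j \<otimes> inv (c j) = \<one>" using cj_unit by auto
  define e where "e i = \<kappa> i \<otimes> inv (c j)" for i
  have e: "e i \<in> J (5 * M + 9)" if "i < k" for i
    unfolding e_def using icj tc(1) by (intro J_frac[OF \<kappa>(1)[OF that], of _ 1]) (auto simp: t_inv_cj)
  \<comment> \<open>Closure and orthogonality of the partial sums are carried along because both are
    needed to split off the next column.\<close>
  have sums: "dot R k c (\<lambda>a. \<Oplus>i\<in>F. e i \<otimes> kv i a) = \<zero> \<and> (\<lambda>a. \<Oplus>i\<in>F. e i \<otimes> kv i a) \<in> vec_carrier R k \<and>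
      tconj h (transv R k (\<lambda>a. \<Oplus>i\<in>F. e i \<otimes> kv i a) c) \<in> ET R k c d (J M)"
    if "finite F" "F \<subseteq> {..<k} - {j}" for F
    using that
  proof (induction F rule: finite_induct)
    case empty
    have [simp]: "(\<lambda>a. \<zero>) \<in> vec_carrier R k" by (simp add: vec_carrier_def)
    have "dot R k c (\<lambda>a. \<zero>) = \<zero>"
      unfolding dot_def using cd_closed(1) by (intro add.finprod_one_eqI) (auto simp: c_A)
    moreover have "transv R k (\<lambda>a. \<zero>) c = mat_one R k" by (rule transv_zero_left) auto
    moreover have "tconj h (mat_one R k) = mat_one R k" unfolding tconj_def using h by (simp add: transv_inverse)
    ultimately show ?case by (simp add: ET.ET_one)
  next
    case (insert x F)
    let ?q = "\<lambda>a. \<Oplus>i\<in>F. e i \<otimes> kv i a" and ?p = "\<lambda>a. e x \<otimes> kv x a"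
    have x: "x < k" "x \<noteq> j" and F: "F \<subseteq> {..<k} - {j}" using insert by auto
    have IH: "dot R k c ?q = \<zero>" "?q \<in> vec_carrier R k" "tconj h (transv R k ?q c) \<in> ET R k c d (J M)"
      using insert by auto
    have ec: "e i \<in> carrier R" if "i < k" for i using e[OF that] by simp
    have cl: "e i \<otimes> kv i a \<in> carrier R" if "i \<in> F" "a < k" for i a
    proof -
      have "i < k" using that F by auto
      then show ?thesis using that ec[of i] by simp
    qed
    have pv: "?p \<in> vec_carrier R k" using x ec[of x] by simp
    have q: "(\<Oplus>i\<in>insert x F. e i \<otimes> kv i a) = ?p a \<oplus> ?q a" if "a < k" for a
      using that insert x cl ec[of x] by (intro finsum_insert) (auto simp: vec_carrierD)
    then have v: "(\<lambda>a. \<Oplus>i\<in>insert x F. e i \<otimes> kv i a) \<in> vec_carrier R k"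
      using IH(2) pv by (auto simp: vec_carrier_def)
    have dt: "dot R k c (\<lambda>a. \<Oplus>i\<in>insert x F. e i \<otimes> kv i a) = dot R k c (\<lambda>a. ?p a \<oplus> ?q a)"
      using v q by (intro dot_cong) auto
    have "transv R k (\<lambda>a. \<Oplus>i\<in>insert x F. e i \<otimes> kv i a) c = transv R k (\<lambda>a. ?p a \<oplus> ?q a) c"
      using q by (intro transv_cong) auto
    also have "\<dots> = mat_mult R k (transv R k ?p c) (transv R k ?q c)"
      using IH pv by (subst transv_mult_same_right) auto
    finally have tr: "transv R k (\<lambda>a. \<Oplus>i\<in>insert x F. e i \<otimes> kv i a) c = mat_mult R k (transv R k ?p c) (transv R k ?q c)" .
    have "tconj h (transv R k ?p c) \<in> ET R k c d (J M)"
      using x h e[OF x(1)] by (rule conj_kv)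
    then show ?case unfolding tr dt using v IH pv h x ec[of x]
      by (simp add: conj_mult ET_mult J_subset dot_add_right dot_smult_right dot_c_kv)
  qed
  let ?F = "{..<k} - {j}"
  have \<kappa>c: "\<kappa> i \<in> carrier R" if "i < k" for i using \<kappa>(1)[OF that] by simp
  have ec: "e i \<in> carrier R" if "i < k" for i using e[OF that] by simp
  have cc: "c i \<in> carrier R" if "i < k" for i using c_A[OF that] by simp
  have \<kappa>v: "\<kappa> \<in> vec_carrier R k" using \<kappa>c by (simp add: vec_carrier_def)
  have ecj: "e i \<otimes> c j = \<kappa> i" if "i < k" for i
  proof -
    have "e i \<otimes> c j = \<kappa> i \<otimes> (c j \<otimes> inv (c j))"
      unfolding e_def using \<kappa>c[OF that] icj(1,2) by (simp only: m_ac m_closed)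
    then show ?thesis using icj \<kappa>c[OF that] by simp
  qed
  have "\<kappa> a = (\<Oplus>i\<in>?F. e i \<otimes> kv i a)" if a: "a < k" for a
  proof (cases "a = j")
    case False
    have "(\<Oplus>i\<in>?F. e i \<otimes> kv i a) = (\<Oplus>i\<in>?F. if a = i then \<kappa> i else \<zero>)"
      using False ec ecj a \<kappa>c by (intro finsum_cong') (auto simp: kv_def)
    also have "\<dots> = \<kappa> a" using False a \<kappa>c by (intro finsum_singleton) auto
    finally show ?thesis by simp
  next
    case True
    have "(\<Oplus>i\<in>?F. e i \<otimes> kv i a) = (\<Oplus>i\<in>?F. (\<ominus> (inv (c j))) \<otimes> (c i \<otimes> \<kappa> i))"
      using True cc \<kappa>c icj by (intro finsum_cong') (auto simp: kv_def e_def l_minus r_minus m_ac)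
    also have "\<dots> = (\<ominus> (inv (c j))) \<otimes> (\<Oplus>i\<in>?F. c i \<otimes> \<kappa> i)"
      using cc \<kappa>c icj by (intro finsum_rdistr[symmetric]) auto
    \<comment> \<open>This is \<open>c . \<kappa> = 0\<close> solved for its term at
      \<open>j\<close>: the coordinate \<open>j\<close> of \<open>\<kappa>\<close> is determined by
      the others.\<close>
    also have "(\<Oplus>i\<in>?F. c i \<otimes> \<kappa> i) = \<ominus> (c j \<otimes> \<kappa> j)"
    proof -
      have "\<zero> = (\<Oplus>i\<in>insert j ?F. c i \<otimes> \<kappa> i)" using \<kappa>(2) j by (simp add: dot_def insert_absorb)
      also have "\<dots> = c j \<otimes> \<kappa> j \<oplus> (\<Oplus>i\<in>?F. c i \<otimes> \<kappa> i)" using cc \<kappa>c j by (intro finsum_insert) auto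
      finally have "(\<Oplus>i\<in>?F. c i \<otimes> \<kappa> i) \<oplus> c j \<otimes> \<kappa> j = \<zero>"
        using cc \<kappa>c j by (simp add: a_comm)
      then show ?thesis using cc \<kappa>c j by (intro minus_equality[symmetric]) auto
    qed
    also have "(\<ominus> (inv (c j))) \<otimes> (\<ominus> (c j \<otimes> \<kappa> j)) = (c j \<otimes> inv (c j)) \<otimes> \<kappa> j"
      using icj(1,2) \<kappa>c[OF j] by (simp only: l_minus r_minus minus_minus m_ac m_closed a_inv_closed)
    finally show ?thesis using True icj \<kappa>c[OF j] by simp
  qed
  then have "transv R k \<kappa> c = transv R k (\<lambda>a. \<Oplus>i\<in>?F. e i \<otimes> kv i a) c" by (intro transv_cong) auto
  then show ?thesis using sums[of ?F] by simp
qed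

text \<open>Conjugation is multiplicative, so each generator of the word is treated separately and
  the loss of exponent does not depend on the length of the word.\<close>

lemma conj_row_ET:
  assumes h: "h \<in> vec_carrier R k" "dot R k h d = \<zero>" "\<And>a. a < k \<Longrightarrow> t \<otimes> h a \<in> A"
    and "U \<in> ET R k c d (J (5 * M + 10))"
  shows "mat_mult R k (mat_mult R k (transv R k d h) U) (transv R k d (\<lambda>i. \<ominus> h i)) \<in> ET R k c d (J M)"
  unfolding tconj_def[symmetric] using assms(4)
proof (induction rule: ET.induct)
  case ET_one
  have "tconj h (mat_one R k) = mat_one R k" unfolding tconj_def using h by (simp add: transv_inverse)
  then show ?case by (simp add: ET.ET_one)
next
  case (ET_row g U)
  then have g: "g \<in> vec_carrier R k" unfolding vec_carrier_def using J_closed by blast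
  have "transv R k d g \<in> ET R k c d (J M)"
    using ET_row J_antimono[of M "5 * M + 10"] by (intro transv_row_ET) auto
  then show ?case using ET_row g h
    by (simp add: conj_mult conj_row_commute ET_mult J_subset ET_closed[of c k d "J (5 * M + 10)"])
next
  case (ET_col \<kappa> U)
  then have g: "\<kappa> \<in> vec_carrier R k" unfolding vec_carrier_def using J_closed by blast
  then show ?case using ET_col h
    by (simp add: conj_mult conj_col ET_mult J_subset ET_closed[of c k d "J (5 * M + 10)"])
qed

text \<open>The setting is symmetric in \<open>c\<close> and \<open>d\<close>; for the sake of this
  symmetry \<open>t\<close> is a multiple of \<open>d j\<close> as well as of
  \<open>c j\<close>.\<close>

lemma swap: "denominators R A t k d c j td tc"
  by (intro denominators.intro denominators_axioms.intro is_cring) (rule subring_A t c_A d_A j k tc td | assumption | simp add: dot_comm[of d k c] dot_cd)+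

lemma conj_col_ET:
  assumes h: "h \<in> vec_carrier R k" "dot R k c h = \<zero>" "\<And>a. a < k \<Longrightarrow> t \<otimes> h a \<in> A"
    and U: "U \<in> ET R k c d (J (5 * M + 10))"
  shows "mat_mult R k (mat_mult R k (transv R k h c) U) (transv R k (\<lambda>i. \<ominus> h i) c) \<in> ET R k c d (J M)"
proof -
  interpret sw: denominators R A t k d c j td tc by (rule swap)
  \<comment> \<open>Transposition reverses products, so conjugation by \<open>I + h c\<close>
    becomes conjugation by \<open>I - c h\<close>; hence the sign.\<close>
  let ?h = "\<lambda>i. \<ominus> h i"
  have "t \<otimes> ?h a \<in> A" if "a < k" for a
    using h(3)[OF that] vec_carrierD[OF h(1) that] subringE(5)[OF subring_A] by (simp add: r_minus)
  then have "mat_mult R k (mat_mult R k (transv R k c ?h) (mat_transpose U)) (transv R k c (\<lambda>i. \<ominus> ?h i)) \<in> ET R k d c (J M)"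
    using h U by (intro sw.conj_row_ET) (auto simp: dot_uminus_left dot_comm[of _ k c] intro: ET_transpose)
  also have "transv R k c (\<lambda>i. \<ominus> ?h i) = transv R k c h"
    using h by (intro transv_cong) (auto simp: vec_carrierD)
  finally have "mat_transpose (mat_mult R k (mat_mult R k (transv R k c ?h) (mat_transpose U)) (transv R k c h)) \<in> ET R k c d (J M)"
    using ET_transpose J_subset by simp
  then show ?thesis using h U
    by (simp add: mat_transpose_mult mat_transpose_transv ET_closed[of c k d "J (5 * M + 10)"] J_subset mat_mult_assoc)
qed

end

section \<open>Invertibility of matrices of Pfaffian one\<close>

definition matchings :: "nat \<Rightarrow> (nat \<Rightarrow> nat) set" where
  "matchings n = {\<rho>. \<rho> permutes {..<2*n} \<and> (\<forall>i<n. \<rho> (2*i) < \<rho> (2*i+1))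
                  \<and> (\<forall>i. Suc i < n \<longrightarrow> \<rho> (2*i) < \<rho> (2*i+2))}"

text \<open>The perfect matching itself, without any order. It identifies a normalized
  permutation.\<close>

definition pairs :: "nat \<Rightarrow> (nat \<Rightarrow> nat) \<Rightarrow> nat set set" where
  "pairs n \<rho> = (\<lambda>i. {\<rho> (2*i), \<rho> (2*i+1)}) ` {..<n}"

text \<open>Used for arbitrary permutations, so that one can be altered first and normalized
  afterwards.\<close>

definition pfaffian_term :: "('c, 'd) ring_scheme \<Rightarrow> nat \<Rightarrow> (nat \<Rightarrow> nat \<Rightarrow> 'c) \<Rightarrow> (nat \<Rightarrow> nat) \<Rightarrow> 'c" where
  "pfaffian_term S n A \<rho> = sign_elt S \<rho> \<otimes>\<^bsub>S\<^esub> (\<Otimes>\<^bsub>S\<^esub>i\<in>{..<n}. A (\<rho> (2*i)) (\<rho> (2*i+1)))"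

text \<open>An entrywise form that ignores entries out of range. The vanishing diagonal is demanded
  separately because \<open>2\<close> may be a zero divisor.\<close>

definition alt :: "('c, 'd) ring_scheme \<Rightarrow> nat \<Rightarrow> (nat \<Rightarrow> nat \<Rightarrow> 'c) \<Rightarrow> bool" where
  "alt S N A \<longleftrightarrow> (\<forall>i<N. \<forall>j<N. A i j \<in> carrier S \<and> A j i = \<ominus>\<^bsub>S\<^esub> A i j) \<and> (\<forall>i<N. A i i = \<zero>\<^bsub>S\<^esub>)"

lemma alt_closed: "alt S N A \<Longrightarrow> i < N \<Longrightarrow> j < N \<Longrightarrow> A i j \<in> carrier S"
  unfolding alt_def by blast

lemma alt_neg: "alt S N A \<Longrightarrow> i < N \<Longrightarrow> j < N \<Longrightarrow> A j i = \<ominus>\<^bsub>S\<^esub> A i j"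
  unfolding alt_def by blast

lemma alt_diag: "alt S N A \<Longrightarrow> i < N \<Longrightarrow> A i i = \<zero>\<^bsub>S\<^esub>"
  unfolding alt_def by blast

lemma pfaffian_pfaffian_term: "pfaffian S n A = (\<Oplus>\<^bsub>S\<^esub>\<rho>\<in>matchings n. pfaffian_term S n A \<rho>)"
  unfolding pfaffian_def matchings_def pfaffian_term_def ..

lemma finite_matchings [simp]: "finite (matchings n)"
  by (rule finite_subset[OF _ finite_permutations[of "{..<2*n}"]]) (auto simp: matchings_def)

lemma permutes_lt: "\<rho> permutes {..<N} \<Longrightarrow> x < N \<Longrightarrow> \<rho> x < N"
  using permutes_in_image by fastforce

lemma matching_mono:
  assumes "\<rho> \<in> matchings n" "i < j" "j < n"
  shows "\<rho> (2*i) < \<rho> (2*j)"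
  using assms(2,3)
proof (induction j)
  case (Suc j)
  have "\<rho> (2*j) < \<rho> (2*Suc j)" using assms(1) Suc.prems by (auto simp: matchings_def)
  then show ?case using Suc by (cases "i = j") auto
qed simp

text \<open>The minima of the pairs, in increasing order, are the values at the even places. The
  value at the following odd place is then the other point of the pair with that minimum.\<close>

lemma matching_eqI:
  assumes "\<rho> \<in> matchings n" "\<rho>' \<in> matchings n" "pairs n \<rho> = pairs n \<rho>'"
  shows "\<rho> = \<rho>'"
proof -
  have mn: "Min ` pairs n \<upsilon> = (\<lambda>i. \<upsilon> (2*i)) ` {..<n}" if "\<upsilon> \<in> matchings n" for \<upsilon>
    unfolding pairs_def image_image using that by (intro image_cong) (auto simp: matchings_def min_def)
  have srt: "sorted_wrt (<) (map (\<lambda>i. \<upsilon> (2*i)) [0..<n])" if "\<upsilon> \<in> matchings n" for \<upsilon>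
    using matching_mono[OF that] by (auto simp: sorted_wrt_iff_nth_less)
  have "map (\<lambda>i. \<rho> (2*i)) [0..<n] = map (\<lambda>i. \<rho>' (2*i)) [0..<n]"
    using srt[OF assms(1)] srt[OF assms(2)] mn[OF assms(1)] mn[OF assms(2)] assms(3)
    by (intro sorted_distinct_set_unique) (auto simp: strict_sorted_iff lessThan_atLeast0)
  then have even: "\<rho> (2*i) = \<rho>' (2*i)" if "i < n" for i using that by auto
  have odd: "\<rho> (2*i+1) = \<rho>' (2*i+1)" if i: "i < n" for i
  proof -
    have "{\<rho> (2*i), \<rho> (2*i+1)} \<in> pairs n \<rho>'" using i assms(3) by (auto simp: pairs_def)
    then obtain l where l: "l < n" "{\<rho> (2*i), \<rho> (2*i+1)} = {\<rho>' (2*l), \<rho>' (2*l+1)}" by (auto simp: pairs_def)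
    have "\<rho> (2*i) < \<rho> (2*i+1)" "\<rho>' (2*l) < \<rho>' (2*l+1)" using assms i l by (auto simp: matchings_def)
    with l(2) have "\<rho> (2*i) = \<rho>' (2*l)" "\<rho> (2*i+1) = \<rho>' (2*l+1)" by (auto simp: doubleton_eq_iff)
    moreover have "i = l" using matching_mono[OF assms(2), of i l] matching_mono[OF assms(2), of l i] even[OF i] i l calculation
      by (metis less_irrefl linorder_neqE_nat)
    ultimately show ?thesis by simp
  qed
  show ?thesis
  proof
    fix x show "\<rho> x = \<rho>' x"
    proof (cases "x < 2*n")
      case True
      then show ?thesis using even[of "x div 2"] odd[of "x div 2"]
        by (cases "even x") (auto elim!: evenE oddE)
    next
      case False
      then show ?thesis using assms by (auto simp: matchings_def permutes_def)
    qed
  qed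
qed

text \<open>Orbits with two elements cancel. At a fixed point only \<open>f x = - f x\<close> would
  follow, which does not give zero in characteristic two; hence the last assumption.\<close>

lemma (in abelian_group) finsum_involution_zero:
  assumes "finite C" "\<And>x. x \<in> C \<Longrightarrow> T x \<in> C" "\<And>x. x \<in> C \<Longrightarrow> T (T x) = x"
    and "\<And>x. x \<in> C \<Longrightarrow> f x \<in> carrier G" "\<And>x. x \<in> C \<Longrightarrow> f (T x) = \<ominus> f x" "\<And>x. x \<in> C \<Longrightarrow> T x = x \<Longrightarrow> f x = \<zero>"
  shows "finsum G f C = \<zero>"
  using assms
proof (induction "card C" arbitrary: C rule: less_induct)
  case less
  show ?case
  proof (cases "C = {}")
    case False
    then obtain x where x: "x \<in> C" by auto
    let ?D = "C - {x, T x}"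
    have Tx: "T x \<in> C" "T (T x) = x" using less.prems x by auto
    have DT: "T y \<in> ?D" if "y \<in> ?D" for y
      using that less.prems(2,3)[of y] Tx x by (metis DiffD1 DiffD2 DiffI insert_iff empty_iff)
    have D0: "finsum G f ?D = \<zero>"
      using less.prems x DT by (intro less.hyps) (auto intro!: psubset_card_mono)
    show ?thesis
    proof (cases "T x = x")
      case True
      then have "C = insert x ?D" using x by auto
      moreover have "finsum G f (insert x ?D) = f x \<oplus> finsum G f ?D"
        using less.prems x by (intro finsum_insert) auto
      ultimately show ?thesis using D0 True less.prems x by simp
    next
      case False
      then have "C = insert x (insert (T x) ?D)" using x Tx by auto
      moreover have "finsum G f (insert x (insert (T x) ?D)) = f x \<oplus> finsum G f (insert (T x) ?D)"
        using less.prems x Tx False by (intro finsum_insert) auto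
      moreover have "finsum G f (insert (T x) ?D) = f (T x) \<oplus> finsum G f ?D"
        using less.prems x Tx by (intro finsum_insert) auto
      ultimately show ?thesis using D0 less.prems x by (simp add: r_neg)
    qed
  qed simp
qed

section \<open>Terms of the Pfaffian under changes of the permutation\<close>

context cring
begin

lemma sign_elt_closed [simp]: "sign_elt R p \<in> carrier R"
  by (simp add: sign_elt_def)

lemma sign_elt_odd:
  "sign q = - sign p \<Longrightarrow> sign_elt R q = \<ominus> sign_elt R p"
  using sign_cases[of p] by (auto simp: sign_elt_def)

lemma pfaffian_term_closed [simp]:
  assumes "alt R (2*n) A" "\<rho> permutes {..<2*n}"
  shows "pfaffian_term R n A \<rho> \<in> carrier R"
  unfolding pfaffian_term_def using assms permutes_lt[OF assms(2)]
  by (auto simp: alt_closed intro!: m_closed finprod_closed)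

lemma finprod_remove:
  assumes "finite I" "i \<in> I" "\<And>x. x \<in> I \<Longrightarrow> f x \<in> carrier R"
  shows "finprod R f I = f i \<otimes> finprod R f (I - {i})"
proof -
  have "finprod R f (insert i (I - {i})) = f i \<otimes> finprod R f (I - {i})"
    using assms by (intro finprod_insert) auto
  then show ?thesis using assms by (simp add: insert_absorb)
qed

text \<open>The sign of the permutation changes, and by skew-symmetry so does exactly one
  factor.\<close>

lemma pfaffian_term_flip:
  assumes A: "alt R (2*n) A" and \<rho>: "\<rho> permutes {..<2*n}" and i: "i < n"
  shows "pfaffian_term R n A (\<rho> \<circ> transpose (2*i) (2*i+1)) = pfaffian_term R n A \<rho>"
proof -
  let ?t = "transpose (2*i) (2*i+1)" 
  let ?f = "\<lambda>\<upsilon> l. A (\<upsilon> (2*l)) (\<upsilon> (2*l+1))"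
  note lt = permutes_lt[OF \<rho>]
  have fc: "?f \<rho> l \<in> carrier R" if "l < n" for l using A that lt by (auto simp: alt_closed)
  have t: "?t permutes {..<2*n}" using i by (intro permutes_swap_id) auto
  have "permutation \<rho>" "permutation ?t" using \<rho> permutation_permutes finite_lessThan by (blast, simp add: permutation_swap_id)
  then have "sign (\<rho> \<circ> ?t) = - sign \<rho>" by (simp add: sign_compose sign_swap_id)
  then have s: "sign_elt R (\<rho> \<circ> ?t) = \<ominus> sign_elt R \<rho>" by (rule sign_elt_odd)
  have fi: "?f (\<rho> \<circ> ?t) i = \<ominus> ?f \<rho> i" 
    using alt_neg[OF A lt lt, of "2*i" "2*i+1"] i by simp
  have fl: "?f (\<rho> \<circ> ?t) l = ?f \<rho> l" if "l \<noteq> i" for l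
    using that by (simp add: transpose_def double_not_eq_Suc_double Suc_double_not_eq_double)
  have fc': "?f (\<rho> \<circ> ?t) l \<in> carrier R" if "l < n" for l
    using fc[OF that] fc[OF i] fl[of l] fi by (cases "l = i") auto
  have "finprod R (?f (\<rho> \<circ> ?t)) {..<n} = ?f (\<rho> \<circ> ?t) i \<otimes> finprod R (?f (\<rho> \<circ> ?t)) ({..<n} - {i})"
    using i fc' by (intro finprod_remove) auto
  also have "finprod R (?f (\<rho> \<circ> ?t)) ({..<n} - {i}) = finprod R (?f \<rho>) ({..<n} - {i})"
    using fc fl by (intro finprod_cong') auto
  also have "?f (\<rho> \<circ> ?t) i \<otimes> finprod R (?f \<rho>) ({..<n} - {i}) = \<ominus> (?f \<rho> i \<otimes> finprod R (?f \<rho>) ({..<n} - {i}))"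
    unfolding fi using fc i by (intro l_minus) (auto intro!: finprod_closed)
  also have "?f \<rho> i \<otimes> finprod R (?f \<rho>) ({..<n} - {i}) = finprod R (?f \<rho>) {..<n}"
    using i fc by (intro finprod_remove[symmetric]) auto
  finally show ?thesis unfolding pfaffian_term_def s using fc
    by (simp add: l_minus r_minus finprod_closed Pi_def)
qed

text \<open>Exchanging neighbouring pairs is a product of two transpositions, hence even, and only
  permutes the factors.\<close>

lemma pfaffian_term_swap:
  assumes A: "alt R (2*n) A" and \<rho>: "\<rho> permutes {..<2*n}" and i: "Suc i < n"
  shows "pfaffian_term R n A (\<rho> \<circ> (transpose (2*i) (2*i+2) \<circ> transpose (2*i+1) (2*i+3))) = pfaffian_term R n A \<rho>"
proof -
  let ?t = "transpose (2*i) (2*i+2) \<circ> transpose (2*i+1) (2*i+3)" 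
  let ?f = "\<lambda>\<upsilon> l. A (\<upsilon> (2*l)) (\<upsilon> (2*l+1))"
  let ?s = "transpose i (Suc i)"
  note lt = permutes_lt[OF \<rho>]
  have fc: "?f \<rho> l \<in> carrier R" if "l < n" for l using A that lt by (auto simp: alt_closed)
  have "permutation \<rho>" using \<rho> permutation_permutes finite_lessThan by blast
  then have "sign (\<rho> \<circ> ?t) = sign \<rho>"
    by (simp add: sign_compose permutation_swap_id permutation_compose sign_swap_id)
  then have s: "sign_elt R (\<rho> \<circ> ?t) = sign_elt R \<rho>" by (simp add: sign_elt_def)
  have "?t (2*l) = 2 * ?s l \<and> ?t (2*l+1) = 2 * ?s l + 1" for l
    by (auto simp: transpose_def; presburger)
  then have f: "?f (\<rho> \<circ> ?t) l = ?f \<rho> (?s l)" for l by (simp del: o_apply add: comp_apply[of \<rho>])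
  have sp: "?s permutes {..<n}" using i by (intro permutes_swap_id) auto
  have "finprod R (?f \<rho>) (?s ` {..<n}) = (\<Otimes>l\<in>{..<n}. ?f \<rho> (?s l))"
    using fc permutes_lt[OF sp] by (intro finprod_reindex) auto
  then have "finprod R (?f (\<rho> \<circ> ?t)) {..<n} = finprod R (?f \<rho>) {..<n}"
    unfolding f permutes_image[OF sp] ..
  then show ?thesis unfolding pfaffian_term_def s by simp
qed

text \<open>Bubble sort: swapping the two points of a pair and swapping two neighbouring pairs both preserve
  the term, and both decrease the measure of the induction when applied to an inversion.\<close>

lemma matching_representative:
  assumes A: "alt R (2*n) A" and "\<rho> permutes {..<2*n}"
  shows "\<exists>\<rho>'\<in>matchings n. pfaffian_term R n A \<rho>' = pfaffian_term R n A \<rho> \<and> pairs n \<rho>' = pairs n \<rho>"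
  using assms(2)
proof (induction "\<Sum>i<n. (n - i) * \<rho> (2*i)" arbitrary: \<rho> rule: less_induct)
  case less
  note \<rho> = less.prems
  have inj: "inj \<rho>" using \<rho> permutes_inj by blast
  consider "\<rho> \<in> matchings n" | i where "i < n" "\<not> \<rho> (2*i) < \<rho> (2*i+1)" | i where "Suc i < n" "\<not> \<rho> (2*i) < \<rho> (2*i+2)"
    using \<rho> by (auto simp: matchings_def)
  then show ?case
  proof cases
    case 1
    then show ?thesis by blast
  next
    case (2 i)
    let ?t = "transpose (2*i) (2*i+1)"
    have "\<rho> (2*i) \<noteq> \<rho> (2*i+1)" using inj_eq[OF inj] by simp
    then have gt: "\<rho> (2*i+1) < \<rho> (2*i)" using 2 by auto
    have p: "(\<rho> \<circ> ?t) permutes {..<2*n}" using 2 \<rho> by (intro permutes_compose permutes_swap_id) auto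
    have "(\<Sum>l<n. (n - l) * (\<rho> \<circ> ?t) (2*l)) < (\<Sum>l<n. (n - l) * \<rho> (2*l))"
    proof (rule sum_strict_mono_ex1)
      have "(\<rho> \<circ> ?t) (2*l) \<le> \<rho> (2*l)" for l
        using gt by (cases "l = i") (auto simp: transpose_def double_not_eq_Suc_double)
      then show "\<forall>l\<in>{..<n}. (n - l) * (\<rho> \<circ> ?t) (2*l) \<le> (n - l) * \<rho> (2*l)" by simp
      show "\<exists>l\<in>{..<n}. (n - l) * (\<rho> \<circ> ?t) (2*l) < (n - l) * \<rho> (2*l)"
        using 2 gt by (intro bexI[of _ i]) auto
    qed simp
    then obtain \<rho>' where \<rho>': "\<rho>' \<in> matchings n" "pfaffian_term R n A \<rho>' = pfaffian_term R n A (\<rho> \<circ> ?t)" "pairs n \<rho>' = pairs n (\<rho> \<circ> ?t)"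
      using less.hyps[OF _ p] by blast
    have "pairs n (\<rho> \<circ> ?t) = pairs n \<rho>"
      unfolding pairs_def by (intro image_cong) (auto simp: transpose_def double_not_eq_Suc_double Suc_double_not_eq_double)
    then show ?thesis using \<rho>' pfaffian_term_flip[OF A \<rho> 2(1)] by metis
  next
    case (3 i)
    let ?t = "transpose (2*i) (2*i+2) \<circ> transpose (2*i+1) (2*i+3)"
    let ?s = "transpose i (Suc i)"
    have "\<rho> (2*i) \<noteq> \<rho> (2*i+2)" using inj_eq[OF inj] by simp
    then have gt: "\<rho> (2*i+2) < \<rho> (2*i)" using 3 by auto
    have p: "(\<rho> \<circ> ?t) permutes {..<2*n}" using 3 \<rho> by (intro permutes_compose permutes_swap_id) auto
    have t: "?t (2*l) = 2 * ?s l \<and> ?t (2*l+1) = 2 * ?s l + 1" for l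
      by (auto simp: transpose_def; presburger)
    have sp: "?s permutes {..<n}" using 3 by (intro permutes_swap_id) auto
    have split: "(\<Sum>l<n. g l) = g i + g (Suc i) + (\<Sum>l\<in>{..<n} - {i, Suc i}. g l)" for g :: "nat \<Rightarrow> nat"
      using 3 by (subst sum.subset_diff[of "{i, Suc i}"]) auto
    have "(\<Sum>l\<in>{..<n} - {i, Suc i}. (n - l) * (\<rho> \<circ> ?t) (2*l)) = (\<Sum>l\<in>{..<n} - {i, Suc i}. (n - l) * \<rho> (2*l))"
      using t by (intro sum.cong) (auto simp: transpose_def simp del: o_apply simp: comp_apply[of \<rho>])
    moreover have "(n - i) * (\<rho> \<circ> ?t) (2*i) + (n - Suc i) * (\<rho> \<circ> ?t) (2*Suc i) < (n - i) * \<rho> (2*i) + (n - Suc i) * \<rho> (2*Suc i)"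
    proof -
      \<comment> \<open>The earlier of the two pairs has the larger weight, so moving the smaller
        first point there decreases the weighted sum.\<close>
      obtain m where m: "n - i = Suc m" "n - Suc i = m" using 3 by (metis Suc_diff_Suc Suc_lessD)
      have "(\<rho> \<circ> ?t) (2*i) = \<rho> (2*i+2)" "(\<rho> \<circ> ?t) (2*Suc i) = \<rho> (2*i)" using t[of i] t[of "Suc i"] by auto
      then show ?thesis using gt unfolding m by simp
    qed
    ultimately have "(\<Sum>l<n. (n - l) * (\<rho> \<circ> ?t) (2*l)) < (\<Sum>l<n. (n - l) * \<rho> (2*l))"
      unfolding split by linarith
    then obtain \<rho>' where \<rho>': "\<rho>' \<in> matchings n" "pfaffian_term R n A \<rho>' = pfaffian_term R n A (\<rho> \<circ> ?t)" "pairs n \<rho>' = pairs n (\<rho> \<circ> ?t)"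
      using less.hyps[OF _ p] by blast
    have "pairs n (\<rho> \<circ> ?t) = (\<lambda>l. {\<rho> (2*l), \<rho> (2*l+1)}) ` (?s ` {..<n})"
      unfolding pairs_def image_image using t by (intro image_cong) (auto simp del: o_apply simp: comp_apply[of \<rho>])
    also have "\<dots> = pairs n \<rho>" unfolding permutes_image[OF sp] pairs_def ..
    finally show ?thesis using \<rho>' pfaffian_term_swap[OF A \<rho> 3(1)] by metis
  qed
qed

text \<open>Exchanging the labels \<open>a\<close> and \<open>b\<close> preserves all entries and
  reverses the sign of the permutation, which gives a sign-reversing involution on matchings. A
  matching fixed by it contains the pair of \<open>a\<close> and \<open>b\<close>, whose entry
  vanishes.\<close>

lemma pfaffian_equal_rows:
  assumes A: "alt R (2*n) A" and ab: "a < 2*n" "b < 2*n" "a \<noteq> b"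
    and rows: "\<And>x. x < 2*n \<Longrightarrow> A a x = A b x"
  shows "pfaffian R n A = \<zero>"
proof -
  let ?t = "transpose a b"
  have cols: "A x a = A x b" if "x < 2*n" for x
    using A ab that rows[OF that] unfolding alt_def by metis
  have tA: "A (?t x) (?t y) = A x y" if "x < 2*n" "y < 2*n" for x y
    using that rows cols ab by (auto simp: transpose_def)
  have tp: "?t permutes {..<2*n}" using ab by (intro permutes_swap_id) auto
  have comp: "(?t \<circ> \<rho>) permutes {..<2*n}" if "\<rho> permutes {..<2*n}" for \<rho>
    using that tp by (rule permutes_compose)
  have prs: "pairs n (?t \<circ> \<rho>) = (\<lambda>P. ?t ` P) ` pairs n \<rho>" for \<rho>
    unfolding pairs_def image_image by (intro image_cong) auto
  \<comment> \<open>Relabelling destroys the normalization; \<open>T\<close> picks a normalized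
    permutation with the same pairs and the same term. Being determined by its pairs, it makes
    \<open>T\<close> an involution.\<close>
  define T where "T \<rho> = (SOME \<rho>'. \<rho>' \<in> matchings n \<and> pfaffian_term R n A \<rho>' = pfaffian_term R n A (?t \<circ> \<rho>) \<and> pairs n \<rho>' = pairs n (?t \<circ> \<rho>))" for \<rho>
  have T: "T \<rho> \<in> matchings n" "pfaffian_term R n A (T \<rho>) = pfaffian_term R n A (?t \<circ> \<rho>)" "pairs n (T \<rho>) = pairs n (?t \<circ> \<rho>)"
    if "\<rho> \<in> matchings n" for \<rho>
  proof -
    have "\<rho> permutes {..<2*n}" using that by (simp add: matchings_def)
    from someI_ex[OF matching_representative[OF A comp[OF this], unfolded Bex_def]]
    show "T \<rho> \<in> matchings n" "pfaffian_term R n A (T \<rho>) = pfaffian_term R n A (?t \<circ> \<rho>)" "pairs n (T \<rho>) = pairs n (?t \<circ> \<rho>)"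
      unfolding T_def by blast+
  qed
  have neg: "pfaffian_term R n A (?t \<circ> \<rho>) = \<ominus> pfaffian_term R n A \<rho>" if "\<rho> \<in> matchings n" for \<rho>
  proof -
    have \<rho>: "\<rho> permutes {..<2*n}" using that by (simp add: matchings_def)
    have "permutation \<rho>" using \<rho> permutation_permutes finite_lessThan by blast
    then have "sign (?t \<circ> \<rho>) = - sign \<rho>" using ab by (simp add: sign_compose permutation_swap_id sign_swap_id)
    then have s: "sign_elt R (?t \<circ> \<rho>) = \<ominus> sign_elt R \<rho>" by (rule sign_elt_odd)
    have "(\<Otimes>i\<in>{..<n}. A ((?t \<circ> \<rho>) (2*i)) ((?t \<circ> \<rho>) (2*i+1))) = (\<Otimes>i\<in>{..<n}. A (\<rho> (2*i)) (\<rho> (2*i+1)))"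
      using A permutes_lt[OF \<rho>] by (intro finprod_cong') (auto simp: tA, auto simp: alt_closed)
    moreover have "(\<Otimes>i\<in>{..<n}. A (\<rho> (2*i)) (\<rho> (2*i+1))) \<in> carrier R"
      using A permutes_lt[OF \<rho>] by (intro finprod_closed) (auto simp: alt_closed)
    ultimately show ?thesis unfolding pfaffian_term_def s by (simp add: l_minus)
  qed
  show ?thesis unfolding pfaffian_pfaffian_term
  proof (rule finsum_involution_zero[where T = T])
    fix \<rho> assume \<rho>C: "\<rho> \<in> matchings n"
    then have \<rho>: "\<rho> permutes {..<2*n}" by (simp add: matchings_def)
    show "T \<rho> \<in> matchings n" using T \<rho>C by simp
    show "T (T \<rho>) = \<rho>"
      using T \<rho>C by (intro matching_eqI[of _ n]) (auto simp: prs image_image)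
    show "pfaffian_term R n A \<rho> \<in> carrier R" using A \<rho> by simp
    show "pfaffian_term R n A (T \<rho>) = \<ominus> pfaffian_term R n A \<rho>" using T neg \<rho>C by simp
    assume fx: "T \<rho> = \<rho>"
    have inj: "\<And>x y. \<rho> x = \<rho> y \<Longrightarrow> x = y" using \<rho> permutes_inj injD by metis
    have "\<exists>i<n. {\<rho> (2*i), \<rho> (2*i+1)} = {a, b}"
    proof -
      obtain u where u: "\<rho> u = a" "u < 2*n" using \<rho> ab by (metis lessThan_iff permutes_def)
      define i where "i = u div 2"
      have i: "i < n" "u = 2*i \<or> u = 2*i+1" using u unfolding i_def by auto
      then obtain x where x: "{\<rho> (2*i), \<rho> (2*i+1)} = {a, x}" "x \<noteq> a" using u inj
        by (metis doubleton_eq_iff Suc_eq_plus1 n_not_Suc_n)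
      have "?t ` {a, x} \<in> pairs n \<rho>"
        using T(3)[OF \<rho>C] fx i x unfolding prs by (metis (no_types, lifting) image_eqI lessThan_iff pairs_def)
      then obtain l where l: "l < n" "{\<rho> (2*l), \<rho> (2*l+1)} = ?t ` {a, x}" by (auto simp: pairs_def)
      show ?thesis
      proof (cases "x = b")
        case False
        then have e: "{\<rho> (2*l), \<rho> (2*l+1)} = {b, x}" using l x ab by (auto simp: transpose_def)
        \<comment> \<open>Two pairs of a matching that share the point \<open>x\<close> coincide,
          which would force \<open>a = b\<close>.\<close>
        have "l = i"
        proof -
          from e have "x = \<rho> (2*l) \<or> x = \<rho> (2*l+1)" by (auto simp: doubleton_eq_iff)
          moreover from x have "x = \<rho> (2*i) \<or> x = \<rho> (2*i+1)" by (auto simp: doubleton_eq_iff)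
          ultimately have "2*l = 2*i \<or> 2*l = 2*i+1 \<or> 2*l+1 = 2*i \<or> 2*l+1 = 2*i+1" using inj by metis
          then show ?thesis by presburger
        qed
        then have "{a, x} = {b, x}" using e x by simp
        then show ?thesis using ab x by (auto simp: doubleton_eq_iff)
      qed (use x i in auto)
    qed
    then obtain i where i: "i < n" "{\<rho> (2*i), \<rho> (2*i+1)} = {a, b}" by blast
    let ?f = "\<lambda>l. A (\<rho> (2*l)) (\<rho> (2*l+1))"
    have fc: "?f l \<in> carrier R" if "l < n" for l using A that permutes_lt[OF \<rho>] by (auto simp: alt_closed)
    have "A a b = \<zero>" "A b a = \<zero>" using A ab rows[OF ab(2)] rows[OF ab(1)] alt_diag[OF A] by auto
    then have "?f i = \<zero>" using i(2) by (auto simp: doubleton_eq_iff)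
    then have "finprod R ?f {..<n} = \<zero>"
      using finprod_remove[of "{..<n}" i ?f] i fc by (simp add: finprod_closed Pi_def)
    then show "pfaffian_term R n A \<rho> = \<zero>" by (simp add: pfaffian_term_def)
  qed simp
qed

section \<open>Expansion of the Pfaffian along a row\<close>

definition replace_row :: "(nat \<Rightarrow> nat \<Rightarrow> 'a) \<Rightarrow> nat \<Rightarrow> (nat \<Rightarrow> 'a) \<Rightarrow> nat \<Rightarrow> nat \<Rightarrow> 'a" where
  "replace_row A l x = (\<lambda>i j. if i = l then (if j = l then \<zero> else x j) else if j = l then \<ominus> x i else A i j)"

lemma alt_replace_row: "alt R N A \<Longrightarrow> x \<in> vec_carrier R N \<Longrightarrow> l < N \<Longrightarrow> alt R N (replace_row A l x)"
proof -
  assume a: "alt R N A" "x \<in> vec_carrier R N" "l < N"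
  have "replace_row A l x j i = \<ominus> replace_row A l x i j" if "i < N" "j < N" for i j
    using that a alt_neg[OF a(1) that] by (simp add: replace_row_def vec_carrierD)
  moreover have "replace_row A l x i j \<in> carrier R" if "i < N" "j < N" for i j
    using that a by (simp add: replace_row_def vec_carrierD alt_closed)
  moreover have "replace_row A l x i i = \<zero>" if "i < N" for i
    using that a by (simp add: replace_row_def alt_diag)
  ultimately show ?thesis unfolding alt_def by blast
qed

text \<open>Exactly one factor of the term involves the point \<open>l\<close>, namely that of its
  pair. So the term depends linearly on the entry of \<open>x\<close> at the partner of
  \<open>l\<close>, and the other factors form the coefficient.\<close>

lemma pfaffian_term_replace_row:
  assumes A: "alt R (2*n) A" and \<rho>: "\<rho> permutes {..<2*n}" and l: "l < 2*n"
  shows "\<exists>m<2*n. \<exists>cf\<in>carrier R. \<forall>x\<in>vec_carrier R (2*n). pfaffian_term R n (replace_row A l x) \<rho> = cf \<otimes> x m"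
proof -
  have inj: "\<And>x y. \<rho> x = \<rho> y \<longleftrightarrow> x = y" using \<rho> permutes_inj injD by metis
  obtain u where u: "\<rho> u = l" "u < 2*n" using \<rho> l by (metis lessThan_iff permutes_def)
  define i where "i = u div 2"
  have i: "i < n" "u = 2*i \<or> u = 2*i+1" using u unfolding i_def by auto
  let ?f = "\<lambda>A i. A (\<rho> (2*i)) (\<rho> (2*i+1))"
  define P where "P = finprod R (?f A) ({..<n} - {i})"
  note lt = permutes_lt[OF \<rho>]
  have fc: "?f B a \<in> carrier R" if "alt R (2*n) B" "a < n" for B a using that lt by (auto simp: alt_closed)
  have P: "P \<in> carrier R" unfolding P_def using fc[OF A] by (intro finprod_closed) auto
  have eq: "pfaffian_term R n (replace_row A l x) \<rho> = sign_elt R \<rho> \<otimes> (?f (replace_row A l x) i \<otimes> P)" if x: "x \<in> vec_carrier R (2*n)" for x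
  proof -
    note B = alt_replace_row[OF A x l]
    have "?f (replace_row A l x) a = ?f A a" if "a \<noteq> i" for a
    proof -
      have "2*a \<noteq> u" "2*a+1 \<noteq> u" using i that by presburger+
      then have "\<rho> (2*a) \<noteq> l" "\<rho> (2*a+1) \<noteq> l" using inj[of "2*a" u] inj[of "2*a+1" u] u by auto
      then show ?thesis by (simp add: replace_row_def)
    qed
    then have "finprod R (?f (replace_row A l x)) ({..<n} - {i}) = P"
      unfolding P_def using fc[OF A] by (intro finprod_cong') auto
    then show ?thesis unfolding pfaffian_term_def
      using finprod_remove[of "{..<n}" i "?f (replace_row A l x)"] fc[OF B] i by simp
  qed
  from i(2) show ?thesis
  proof
    assume u0: "u = 2*i"
    have "pfaffian_term R n (replace_row A l x) \<rho> = (sign_elt R \<rho> \<otimes> P) \<otimes> x (\<rho> (2*i+1))" if x: "x \<in> vec_carrier R (2*n)" for x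
    proof -
      have "\<rho> (2*i) = l" "\<rho> (2*i+1) \<noteq> l" using u u0 inj[of "2*i+1" u] by auto
      then have "?f (replace_row A l x) i = x (\<rho> (2*i+1))" by (simp add: replace_row_def)
      then show ?thesis using eq[OF x] P vec_carrierD[OF x lt, of "2*i+1"] i by (simp add: m_ac)
    qed
    then show ?thesis using P i lt[of "2*i+1"] by (intro exI[of _ "\<rho> (2*i+1)"] conjI bexI[of _ "sign_elt R \<rho> \<otimes> P"]) auto
  next
    \<comment> \<open>Here \<open>l\<close> is the second point of its pair, so the factor lies in
      column \<open>l\<close> and carries a sign.\<close>
    assume u0: "u = 2*i+1"
    have "pfaffian_term R n (replace_row A l x) \<rho> = (\<ominus> (sign_elt R \<rho> \<otimes> P)) \<otimes> x (\<rho> (2*i))" if x: "x \<in> vec_carrier R (2*n)" for x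
    proof -
      have "\<rho> (2*i+1) = l" "\<rho> (2*i) \<noteq> l" using u u0 inj[of "2*i" u] by auto
      then have "?f (replace_row A l x) i = \<ominus> x (\<rho> (2*i))" by (simp add: replace_row_def)
      then show ?thesis using eq[OF x] P vec_carrierD[OF x lt, of "2*i"] i by (simp add: m_ac l_minus r_minus)
    qed
    then show ?thesis using P i lt[of "2*i"] by (intro exI[of _ "\<rho> (2*i)"] conjI bexI[of _ "\<ominus> (sign_elt R \<rho> \<otimes> P)"]) auto
  qed
qed

text \<open>Collecting the terms by the entry of \<open>x\<close> that they contain gives the
  expansion along row \<open>l\<close>. The vector \<open>q\<close> is chosen before
  \<open>x\<close>, so the same coefficients serve for every new row.\<close>

lemma pfaffian_row_linear:
  assumes A: "alt R (2*n) A" and l: "l < 2*n"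
  shows "\<exists>q\<in>vec_carrier R (2*n). \<forall>x\<in>vec_carrier R (2*n). pfaffian R n (replace_row A l x) = dot R (2*n) x q"
proof -
  have "\<forall>\<rho>\<in>matchings n. \<exists>z. fst z < 2*n \<and> snd z \<in> carrier R \<and>
      (\<forall>x\<in>vec_carrier R (2*n). pfaffian_term R n (replace_row A l x) \<rho> = snd z \<otimes> x (fst z))"
    using pfaffian_term_replace_row[OF A _ l] unfolding matchings_def by fastforce
  then obtain z where z: "\<And>\<rho>. \<rho> \<in> matchings n \<Longrightarrow> fst (z \<rho>) < 2*n" "\<And>\<rho>. \<rho> \<in> matchings n \<Longrightarrow> snd (z \<rho>) \<in> carrier R"
      "\<And>\<rho> x. \<rho> \<in> matchings n \<Longrightarrow> x \<in> vec_carrier R (2*n) \<Longrightarrow> pfaffian_term R n (replace_row A l x) \<rho> = snd (z \<rho>) \<otimes> x (fst (z \<rho>))"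
    by (metis (no_types, lifting) bchoice)
  define q where "q m = (\<Oplus>\<rho>\<in>matchings n. if fst (z \<rho>) = m then snd (z \<rho>) else \<zero>)" for m
  have q: "q \<in> vec_carrier R (2*n)" unfolding q_def vec_carrier_def using z by (auto intro!: finsum_closed)
  have "pfaffian R n (replace_row A l x) = dot R (2*n) x q" if x: "x \<in> vec_carrier R (2*n)" for x
  proof -
    have xc: "x m \<in> carrier R" if "m < 2*n" for m using vec_carrierD[OF x that] .
    have "dot R (2*n) x q = (\<Oplus>m\<in>{..<2*n}. \<Oplus>\<rho>\<in>matchings n. x m \<otimes> (if fst (z \<rho>) = m then snd (z \<rho>) else \<zero>))"
      unfolding dot_def q_def using xc z
      by (intro finsum_cong') (auto simp: Pi_def intro!: finsum_rdistr finsum_closed)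
    also have "\<dots> = (\<Oplus>\<rho>\<in>matchings n. \<Oplus>m\<in>{..<2*n}. x m \<otimes> (if fst (z \<rho>) = m then snd (z \<rho>) else \<zero>))"
      using xc z by (intro finsum_swap) auto
    also have "\<dots> = (\<Oplus>\<rho>\<in>matchings n. pfaffian_term R n (replace_row A l x) \<rho>)"
    proof (intro finsum_cong')
      show "pfaffian_term R n (replace_row A l x) \<in> matchings n \<rightarrow> carrier R"
        using z x xc by auto
      fix \<rho> assume \<rho>: "\<rho> \<in> matchings n"
      have "(\<Oplus>m\<in>{..<2*n}. x m \<otimes> (if fst (z \<rho>) = m then snd (z \<rho>) else \<zero>))
         = (\<Oplus>m\<in>{..<2*n}. if fst (z \<rho>) = m then x m \<otimes> snd (z \<rho>) else \<zero>)"
        using xc z \<rho> by (intro finsum_cong') auto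
      also have "\<dots> = x (fst (z \<rho>)) \<otimes> snd (z \<rho>)"
        using xc z \<rho> by (intro finsum_singleton) auto
      also have "\<dots> = pfaffian_term R n (replace_row A l x) \<rho>" using z[OF \<rho>] xc x by (simp add: m_comm)
      finally show "(\<Oplus>m\<in>{..<2*n}. x m \<otimes> (if fst (z \<rho>) = m then snd (z \<rho>) else \<zero>)) = pfaffian_term R n (replace_row A l x) \<rho>" .
    qed simp
    finally show ?thesis unfolding pfaffian_pfaffian_term by simp
  qed
  with q show ?thesis by blast
qed

lemma pfaffian_cong:
  assumes "alt R (2*n) A" "\<And>i j. i < 2*n \<Longrightarrow> j < 2*n \<Longrightarrow> A i j = B i j"
  shows "pfaffian R n A = pfaffian R n B"
  unfolding pfaffian_pfaffian_term
proof (intro finsum_cong')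
  fix \<rho> assume "\<rho> \<in> matchings n"
  then have \<rho>: "\<rho> permutes {..<2*n}" by (simp add: matchings_def)
  have "alt R (2*n) B" using assms unfolding alt_def by metis
  then show "pfaffian_term R n A \<rho> = pfaffian_term R n B \<rho>" unfolding pfaffian_term_def
    using assms(2) permutes_lt[OF \<rho>] by (intro arg_cong2[where f = "(\<otimes>)"] finprod_cong') (auto simp: alt_closed)
next
  show "pfaffian_term R n B \<in> matchings n \<rightarrow> carrier R"
  proof
    fix \<rho> assume "\<rho> \<in> matchings n"
    then have \<rho>: "\<rho> permutes {..<2*n}" by (simp add: matchings_def)
    have "alt R (2*n) B" using assms unfolding alt_def by metis
    then show "pfaffian_term R n B \<rho> \<in> carrier R" using \<rho> by simp
  qed
qed simp

lemma alternating_alt: "alternating R N A \<Longrightarrow> alt R N A"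
  unfolding alternating_def alt_def
  by (auto simp: a_minus_def minus_add a_comm r_neg)

text \<open>An analogue of Cramer's rule: replacing row \<open>l\<close> by row \<open>i\<close>
  gives back \<open>A\<close>, with Pfaffian \<open>1\<close>, if \<open>i = l\<close>, and a matrix
  with two equal rows otherwise. So the expansion vectors are the columns of a right
  inverse.\<close>

lemma pfaffian_one_right_inverse:
  assumes A: "alt R (2*n) A" "A \<in> mat_carrier R (2*n)" and pf: "pfaffian R n A = \<one>"
  shows "\<exists>Q\<in>mat_carrier R (2*n). mat_mult R (2*n) A Q = mat_one R (2*n)"
proof -
  have "\<forall>l\<in>{..<2*n}. \<exists>q. q \<in> vec_carrier R (2*n) \<and> (\<forall>x\<in>vec_carrier R (2*n). pfaffian R n (replace_row A l x) = dot R (2*n) x q)"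
    using pfaffian_row_linear[OF A(1)] by blast
  from bchoice[OF this] obtain q where q: "\<And>l. l < 2*n \<Longrightarrow> q l \<in> vec_carrier R (2*n)"
    "\<And>l x. l < 2*n \<Longrightarrow> x \<in> vec_carrier R (2*n) \<Longrightarrow> pfaffian R n (replace_row A l x) = dot R (2*n) x (q l)"
    by auto
  define Q where "Q = (\<lambda>i j. if i < 2*n \<and> j < 2*n then q j i else \<zero>)"
  have Q: "Q \<in> mat_carrier R (2*n)" using q(1) unfolding Q_def mat_carrier_def by (auto simp: vec_carrier_def)
  have row: "dot R (2*n) (A i) (q l) = (if i = l then \<one> else \<zero>)" if il: "i < 2*n" "l < 2*n" for i l
  proof -
    have Ai: "A i \<in> vec_carrier R (2*n)" using A by simp
    have "pfaffian R n (replace_row A l (A i)) = (if i = l then \<one> else \<zero>)"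
    proof (cases "i = l")
      case True
      have "pfaffian R n A = pfaffian R n (replace_row A l (A i))"
        using A(1) il True alt_diag[OF A(1)] alt_neg[OF A(1) il(2)]
        by (intro pfaffian_cong) (auto simp: replace_row_def)
      then show ?thesis using True pf by simp
    next
      case False
      have "pfaffian R n (replace_row A l (A i)) = \<zero>"
        using alt_replace_row[OF A(1) Ai il(2)] il False A(1)
        by (intro pfaffian_equal_rows[where a = i and b = l]) (auto simp: replace_row_def alt_diag)
      then show ?thesis using False by simp
    qed
    then show ?thesis using q(2)[OF il(2) Ai] by simp
  qed
  have "mat_mult R (2*n) A Q = mat_one R (2*n)"
  proof (rule mat_eqI[of _ R "2*n"])
    fix i j assume ij: "i < 2*n" "j < 2*n"
    have "dot R (2*n) (A i) (\<lambda>l. Q l j) = dot R (2*n) (A i) (q j)"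
      using A mat_col_closed[OF Q, of j] ij by (intro dot_cong) (auto simp: Q_def)
    then show "mat_mult R (2*n) A Q i j = mat_one R (2*n) i j"
      using ij row by (simp add: mat_mult_dot mat_one_def)
  qed (use A Q in auto)
  with Q show ?thesis by blast
qed

text \<open>Since \<open>A^t = - A\<close>, transposing \<open>A Q = 1\<close> shows that
  \<open>- Q^t\<close> is a left inverse, hence equal to \<open>Q\<close>. This yields a two-sided
  inverse and its skew-symmetry together.\<close>

lemma pfaffian_one_invertible:
  assumes A: "alternating R (2*n) A" and pf: "pfaffian R n A = \<one>"
  shows "\<exists>Q\<in>mat_carrier R (2*n). mat_mult R (2*n) A Q = mat_one R (2*n) \<and> mat_mult R (2*n) Q A = mat_one R (2*n) \<and>
    (\<forall>i j. Q i j = \<ominus> Q j i)"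
proof -
  let ?N = "2*n"
  have Ac: "A \<in> mat_carrier R ?N" using A by (simp add: alternating_def)
  obtain Q where Q: "Q \<in> mat_carrier R ?N" "mat_mult R ?N A Q = mat_one R ?N"
    using pfaffian_one_right_inverse[OF alternating_alt[OF A] Ac pf] by blast
  let ?P = "\<lambda>i j. \<ominus> Q j i"
  have P: "?P \<in> mat_carrier R ?N"
    using Q(1) mat_carrier_out[OF Q(1)] by (auto simp: mat_carrier_def[of R ?N])
  have "mat_mult R ?N ?P A = mat_transpose (mat_mult R ?N A Q)"
  proof (rule mat_eqI[of _ R ?N])
    fix i j assume ij: "i < ?N" "j < ?N"
    have "dot R ?N (\<lambda>l. \<ominus> Q l i) (\<lambda>l. A l j) = dot R ?N (A j) (\<lambda>l. Q l i)"
    proof -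
      have "dot R ?N (\<lambda>l. \<ominus> Q l i) (\<lambda>l. A l j) = dot R ?N (\<lambda>l. \<ominus> Q l i) (\<lambda>l. \<ominus> A j l)"
        using Ac Q ij alt_neg[OF alternating_alt[OF A], of j] by (intro dot_cong) auto
      also have "\<dots> = dot R ?N (\<lambda>l. Q l i) (A j)"
        using Ac Q by (simp add: dot_uminus_left dot_uminus_right)
      finally show ?thesis using Ac Q by (simp add: dot_comm)
    qed
    then show "mat_mult R ?N ?P A i j = mat_transpose (mat_mult R ?N A Q) i j"
      using ij by (simp add: mat_mult_dot mat_transpose_def)
  qed (use P Ac Q in auto)
  then have PA: "mat_mult R ?N ?P A = mat_one R ?N" using Q by simp
  have "?P = mat_mult R ?N ?P (mat_mult R ?N A Q)" using P Q by simp
  also have "\<dots> = Q" using PA P Q(1) Ac by (simp add: mat_mult_assoc[symmetric])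
  finally have PQ: "?P = Q" .
  show ?thesis
  proof (intro bexI[of _ Q] conjI allI)
    show "Q i j = \<ominus> Q j i" for i j using fun_cong[OF fun_cong[OF PQ, of i], of j] by (rule sym)
  qed (use Q PA[unfolded PQ] in simp_all)
qed

end

section \<open>Localization\<close>

lemma (in cring) loc_relD:
  assumes "((a, s), (b, t)) \<in> loc_rel R m"
  shows "a \<in> carrier R" "s \<in> carrier R - m" "b \<in> carrier R" "t \<in> carrier R - m"
    "\<exists>u\<in>carrier R - m. u \<otimes> (a \<otimes> t) = u \<otimes> (b \<otimes> s)"
proof -
  show c: "a \<in> carrier R" "s \<in> carrier R - m" "b \<in> carrier R" "t \<in> carrier R - m"
    using assms by (auto simp: loc_rel_def)
  obtain u where u: "u \<in> carrier R - m" "u \<otimes> (a \<otimes> t \<ominus> b \<otimes> s) = \<zero>"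
    using assms by (auto simp: loc_rel_def)
  have "u \<otimes> (a \<otimes> t) \<ominus> u \<otimes> (b \<otimes> s) = \<zero>" using u c by (simp add: a_minus_def r_distr r_minus)
  then have "u \<otimes> (a \<otimes> t) = u \<otimes> (b \<otimes> s)" using u c by (simp add: r_right_minus_eq)
  then show "\<exists>u\<in>carrier R - m. u \<otimes> (a \<otimes> t) = u \<otimes> (b \<otimes> s)" using u by blast
qed

lemma (in cring) loc_relI:
  assumes "a \<in> carrier R" "s \<in> carrier R - m" "b \<in> carrier R" "t \<in> carrier R - m"
    "u \<in> carrier R - m" "u \<otimes> (a \<otimes> t) = u \<otimes> (b \<otimes> s)"
  shows "((a, s), (b, t)) \<in> loc_rel R m"
proof -
  have "u \<otimes> (a \<otimes> t \<ominus> b \<otimes> s) = \<zero>"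
    using assms by (simp add: a_minus_def r_distr r_minus r_neg)
  then show ?thesis using assms by (auto simp: loc_rel_def)
qed

locale prime_localization = cring R for R (structure) +
  fixes m
  assumes prime: "primeideal m R"
begin

abbreviation D where "D \<equiv> carrier R - m"
abbreviation L where "L \<equiv> loc R m"

lemma D_mult: "s \<in> D \<Longrightarrow> t \<in> D \<Longrightarrow> s \<otimes> t \<in> D"
  using primeideal.I_prime[OF prime] by auto

lemma D_one: "\<one> \<in> D"
  using primeideal.I_notcarr[OF prime] ideal.one_imp_carrier[OF primeideal.axioms(1)[OF prime]] by auto

lemma equiv_loc_rel: "equiv (carrier R \<times> D) (loc_rel R m)"
proof (rule equivI)
  show "loc_rel R m \<subseteq> (carrier R \<times> D) \<times> (carrier R \<times> D)" by (auto simp: loc_rel_def)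
  show "refl_on (carrier R \<times> D) (loc_rel R m)"
    using D_one by (auto intro!: refl_onI loc_relI[where u = \<one>])
  show "sym (loc_rel R m)"
  proof (rule symI)
    fix x y assume xy: "(x, y) \<in> loc_rel R m"
    then show "(y, x) \<in> loc_rel R m"
      using loc_relD[of "fst x" "snd x" "fst y" "snd y" m] loc_relI[of "fst y" "snd y" m "fst x" "snd x"]
      by (metis prod.collapse)
  qed
  show "trans (loc_rel R m)"
  proof (rule transI, clarify)
    fix a s b t c r assume 1: "((a, s), (b, t)) \<in> loc_rel R m" and 2: "((b, t), (c, r)) \<in> loc_rel R m"
    note 1 = loc_relD[OF 1] and 2 = loc_relD[OF 2]
    from 1(5) 2(5) obtain u v where uv: "u \<in> D" "u \<otimes> (a \<otimes> t) = u \<otimes> (b \<otimes> s)" "v \<in> D" "v \<otimes> (b \<otimes> r) = v \<otimes> (c \<otimes> t)"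
      by blast
    have c: "u \<in> carrier R" "v \<in> carrier R" "a \<in> carrier R" "b \<in> carrier R" "c \<in> carrier R" "s \<in> carrier R" "t \<in> carrier R" "r \<in> carrier R"
      using uv 1 2 by auto
    \<comment> \<open>The middle denominator \<open>t\<close> joins the witness; the product stays
      outside \<open>m\<close> because \<open>m\<close> is prime.\<close>
    have "(u \<otimes> v \<otimes> t) \<otimes> (a \<otimes> r) = v \<otimes> r \<otimes> (u \<otimes> (a \<otimes> t))" using c by (simp add: m_ac)
    also have "\<dots> = u \<otimes> s \<otimes> (v \<otimes> (b \<otimes> r))" unfolding uv(2) using c by (simp add: m_ac)
    also have "\<dots> = (u \<otimes> v \<otimes> t) \<otimes> (c \<otimes> s)" unfolding uv(4) using c by (simp add: m_ac)
    finally show "((a, s), (c, r)) \<in> loc_rel R m"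
      using 1 2 uv D_mult by (intro loc_relI[where u = "u \<otimes> v \<otimes> t"]) auto
  qed
qed

lemma frac_eq:
  assumes "a \<in> carrier R" "s \<in> D" "b \<in> carrier R" "t \<in> D"
  shows "loc_frac R m (a, s) = loc_frac R m (b, t) \<longleftrightarrow> (\<exists>u\<in>D. u \<otimes> (a \<otimes> t) = u \<otimes> (b \<otimes> s))"
  unfolding loc_frac_def using eq_equiv_class_iff[OF equiv_loc_rel, of "(a, s)" "(b, t)"] assms
    loc_relD(5)[of a s b t m] loc_relI[of a s m b t] by auto

lemma frac_eqI:
  assumes "a \<in> carrier R" "s \<in> D" "b \<in> carrier R" "t \<in> D" "a \<otimes> t = b \<otimes> s"
  shows "loc_frac R m (a, s) = loc_frac R m (b, t)"
  using assms D_one by (subst frac_eq) auto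

lemma frac_closed: "a \<in> carrier R \<Longrightarrow> s \<in> D \<Longrightarrow> loc_frac R m (a, s) \<in> carrier L"
  unfolding loc_def loc_frac_def by (auto intro: quotientI)

lemma frac_cases:
  assumes "x \<in> carrier L"
  obtains a s where "a \<in> carrier R" "s \<in> D" "x = loc_frac R m (a, s)"
  using assms unfolding loc_def loc_frac_def by (auto elim!: quotientE)

text \<open>The operations of the ring of fractions act on chosen representatives. All that is known
  of such a choice is that it represents the same class.\<close>

lemma frac_rep:
  assumes "a \<in> carrier R" "s \<in> D"
  obtains b t where "loc_rep (loc_frac R m (a, s)) = (b, t)" "b \<in> carrier R" "t \<in> D"
    "loc_frac R m (b, t) = loc_frac R m (a, s)"
proof -
  have "(a, s) \<in> loc_frac R m (a, s)"
    unfolding loc_frac_def using equiv_class_self[OF equiv_loc_rel] assms by auto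
  then have "loc_rep (loc_frac R m (a, s)) \<in> loc_frac R m (a, s)"
    unfolding loc_rep_def by (rule someI)
  then obtain b t where bt: "loc_rep (loc_frac R m (a, s)) = (b, t)" "((a, s), (b, t)) \<in> loc_rel R m"
    unfolding loc_frac_def by (metis Image_singleton_iff surj_pair)
  show ?thesis
    by (rule that[OF bt(1)]) (use loc_relD[OF bt(2)] equiv_class_eq[OF equiv_loc_rel bt(2)] in \<open>auto simp: loc_frac_def\<close>)
qed

lemma mult_frac:
  assumes "a \<in> carrier R" "s \<in> D" "b \<in> carrier R" "t \<in> D"
  shows "loc_frac R m (a, s) \<otimes>\<^bsub>L\<^esub> loc_frac R m (b, t) = loc_frac R m (a \<otimes> b, s \<otimes> t)"
proof -
  obtain a' s' where a': "loc_rep (loc_frac R m (a, s)) = (a', s')" "a' \<in> carrier R" "s' \<in> D" "loc_frac R m (a', s') = loc_frac R m (a, s)"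
    using frac_rep assms by metis
  obtain b' t' where b': "loc_rep (loc_frac R m (b, t)) = (b', t')" "b' \<in> carrier R" "t' \<in> D" "loc_frac R m (b', t') = loc_frac R m (b, t)"
    using frac_rep assms by metis
  obtain u v where uv: "u \<in> D" "u \<otimes> (a' \<otimes> s) = u \<otimes> (a \<otimes> s')" "v \<in> D" "v \<otimes> (b' \<otimes> t) = v \<otimes> (b \<otimes> t')"
    using a' b' assms frac_eq by metis
  have c: "u \<in> carrier R" "v \<in> carrier R" "s \<in> carrier R" "s' \<in> carrier R" "t \<in> carrier R" "t' \<in> carrier R"
    using uv a' b' assms by auto
  have "(u \<otimes> v) \<otimes> ((a' \<otimes> b') \<otimes> (s \<otimes> t)) = (u \<otimes> (a' \<otimes> s)) \<otimes> (v \<otimes> (b' \<otimes> t))"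
    using c a' b' by (simp add: m_ac)
  also have "\<dots> = (u \<otimes> v) \<otimes> ((a \<otimes> b) \<otimes> (s' \<otimes> t'))" unfolding uv(2,4) using c assms by (simp add: m_ac)
  finally have "loc_frac R m (a' \<otimes> b', s' \<otimes> t') = loc_frac R m (a \<otimes> b, s \<otimes> t)"
    using uv a' b' assms D_mult by (subst frac_eq) auto
  then show ?thesis using a' b' by (simp add: loc_def)
qed

lemma add_frac:
  assumes "a \<in> carrier R" "s \<in> D" "b \<in> carrier R" "t \<in> D"
  shows "loc_frac R m (a, s) \<oplus>\<^bsub>L\<^esub> loc_frac R m (b, t) = loc_frac R m (a \<otimes> t \<oplus> b \<otimes> s, s \<otimes> t)"
proof -
  obtain a' s' where a': "loc_rep (loc_frac R m (a, s)) = (a', s')" "a' \<in> carrier R" "s' \<in> D" "loc_frac R m (a', s') = loc_frac R m (a, s)"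
    using frac_rep assms by metis
  obtain b' t' where b': "loc_rep (loc_frac R m (b, t)) = (b', t')" "b' \<in> carrier R" "t' \<in> D" "loc_frac R m (b', t') = loc_frac R m (b, t)"
    using frac_rep assms by metis
  obtain u v where uv: "u \<in> D" "u \<otimes> (a' \<otimes> s) = u \<otimes> (a \<otimes> s')" "v \<in> D" "v \<otimes> (b' \<otimes> t) = v \<otimes> (b \<otimes> t')"
    using a' b' assms frac_eq by metis
  have c: "u \<in> carrier R" "v \<in> carrier R" "s \<in> carrier R" "s' \<in> carrier R" "t \<in> carrier R" "t' \<in> carrier R"
    using uv a' b' assms by auto
  have "(u \<otimes> v) \<otimes> ((a' \<otimes> t' \<oplus> b' \<otimes> s') \<otimes> (s \<otimes> t))
     = v \<otimes> t \<otimes> t' \<otimes> (u \<otimes> (a' \<otimes> s)) \<oplus> u \<otimes> s \<otimes> s' \<otimes> (v \<otimes> (b' \<otimes> t))"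
    using c a' b' by (simp add: m_ac l_distr r_distr)
  also have "\<dots> = (u \<otimes> v) \<otimes> ((a \<otimes> t \<oplus> b \<otimes> s) \<otimes> (s' \<otimes> t'))"
    unfolding uv(2,4) using c assms by (simp add: m_ac l_distr r_distr)
  finally have "loc_frac R m (a' \<otimes> t' \<oplus> b' \<otimes> s', s' \<otimes> t') = loc_frac R m (a \<otimes> t \<oplus> b \<otimes> s, s \<otimes> t)"
    using uv a' b' assms D_mult by (subst frac_eq) auto
  then show ?thesis using a' b' by (simp add: loc_def)
qed

lemma one_frac: "\<one>\<^bsub>L\<^esub> = loc_frac R m (\<one>, \<one>)" and zero_frac: "\<zero>\<^bsub>L\<^esub> = loc_frac R m (\<zero>, \<one>)"
  by (simp_all add: loc_def)

lemma cring_loc: "cring L"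
proof (rule cringI)
  note D = DiffD1[of _ "carrier R" m]
  show "abelian_group L"
  proof (rule abelian_groupI)
    fix x y assume "x \<in> carrier L" "y \<in> carrier L"
    then obtain a s b t where ab: "a \<in> carrier R" "s \<in> D" "x = loc_frac R m (a, s)" "b \<in> carrier R" "t \<in> D" "y = loc_frac R m (b, t)"
      by (metis frac_cases)
    note st = D[OF ab(2)] D[OF ab(5)]
    show "x \<oplus>\<^bsub>L\<^esub> y \<in> carrier L" using ab st D_mult by (simp add: add_frac frac_closed del: Diff_iff)
    show "x \<oplus>\<^bsub>L\<^esub> y = y \<oplus>\<^bsub>L\<^esub> x" using ab st by (simp add: add_frac a_comm m_comm del: Diff_iff)
    fix z assume "z \<in> carrier L"
    then obtain c r where c: "c \<in> carrier R" "r \<in> D" "z = loc_frac R m (c, r)" by (metis frac_cases)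
    note r = D[OF c(2)]
    show "x \<oplus>\<^bsub>L\<^esub> y \<oplus>\<^bsub>L\<^esub> z = x \<oplus>\<^bsub>L\<^esub> (y \<oplus>\<^bsub>L\<^esub> z)"
      using ab st c r D_mult by (simp add: add_frac m_ac l_distr r_distr a_ac del: Diff_iff)
  next
    show "\<zero>\<^bsub>L\<^esub> \<in> carrier L" unfolding zero_frac using D_one by (intro frac_closed) auto
    fix x assume "x \<in> carrier L"
    then obtain a s where a: "a \<in> carrier R" "s \<in> D" "x = loc_frac R m (a, s)" by (metis frac_cases)
    note s = D[OF a(2)]
    show "\<zero>\<^bsub>L\<^esub> \<oplus>\<^bsub>L\<^esub> x = x" unfolding zero_frac using a s D_one by (simp add: add_frac del: Diff_iff)
    have "loc_frac R m (\<ominus> a, s) \<oplus>\<^bsub>L\<^esub> x = \<zero>\<^bsub>L\<^esub>"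
      unfolding zero_frac using a s D_one D_mult
      by (simp add: add_frac l_minus l_neg del: Diff_iff) (rule frac_eqI, auto)
    then show "\<exists>y\<in>carrier L. y \<oplus>\<^bsub>L\<^esub> x = \<zero>\<^bsub>L\<^esub>" using a frac_closed[of "\<ominus> a" s] by blast
  qed
  show "Group.comm_monoid L"
  proof (rule comm_monoidI)
    fix x y assume "x \<in> carrier L" "y \<in> carrier L"
    then obtain a s b t where ab: "a \<in> carrier R" "s \<in> D" "x = loc_frac R m (a, s)" "b \<in> carrier R" "t \<in> D" "y = loc_frac R m (b, t)"
      by (metis frac_cases)
    note st = D[OF ab(2)] D[OF ab(5)]
    show "x \<otimes>\<^bsub>L\<^esub> y \<in> carrier L" using ab st D_mult by (simp add: mult_frac frac_closed del: Diff_iff)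
    show "x \<otimes>\<^bsub>L\<^esub> y = y \<otimes>\<^bsub>L\<^esub> x" using ab st by (simp add: mult_frac m_comm del: Diff_iff)
    fix z assume "z \<in> carrier L"
    then obtain c r where c: "c \<in> carrier R" "r \<in> D" "z = loc_frac R m (c, r)" by (metis frac_cases)
    note r = D[OF c(2)]
    show "x \<otimes>\<^bsub>L\<^esub> y \<otimes>\<^bsub>L\<^esub> z = x \<otimes>\<^bsub>L\<^esub> (y \<otimes>\<^bsub>L\<^esub> z)"
      using ab st c r D_mult by (simp add: mult_frac m_assoc del: Diff_iff)
  next
    show "\<one>\<^bsub>L\<^esub> \<in> carrier L" unfolding one_frac using D_one by (intro frac_closed) auto
    fix x assume "x \<in> carrier L"
    then obtain a s where a: "a \<in> carrier R" "s \<in> D" "x = loc_frac R m (a, s)" by (metis frac_cases)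
    note s = D[OF a(2)]
    show "\<one>\<^bsub>L\<^esub> \<otimes>\<^bsub>L\<^esub> x = x" unfolding one_frac using a s D_one by (simp add: mult_frac del: Diff_iff)
  qed
next
  note D = DiffD1[of _ "carrier R" m]
  fix x y z assume "x \<in> carrier L" "y \<in> carrier L" "z \<in> carrier L"
  then obtain a s b t c r where ab: "a \<in> carrier R" "s \<in> D" "x = loc_frac R m (a, s)" "b \<in> carrier R" "t \<in> D" "y = loc_frac R m (b, t)"
     "c \<in> carrier R" "r \<in> D" "z = loc_frac R m (c, r)"
    by (metis frac_cases)
  note st = D[OF ab(2)] D[OF ab(5)] D[OF ab(8)]
  show "(x \<oplus>\<^bsub>L\<^esub> y) \<otimes>\<^bsub>L\<^esub> z = x \<otimes>\<^bsub>L\<^esub> z \<oplus>\<^bsub>L\<^esub> y \<otimes>\<^bsub>L\<^esub> z"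
    using ab st D_mult by (simp add: mult_frac add_frac del: Diff_iff)
      (rule frac_eqI, auto simp: m_ac l_distr r_distr simp del: Diff_iff intro!: D_mult)
qed

lemma loc_map_hom: "loc_map R m \<in> ring_hom R L"
  unfolding loc_map_def
proof (rule ring_hom_memI)
  fix x y assume xy: "x \<in> carrier R" "y \<in> carrier R"
  show "loc_frac R m (x, \<one>) \<in> carrier L" using xy D_one frac_closed by blast
  show "loc_frac R m (x \<otimes> y, \<one>) = loc_frac R m (x, \<one>) \<otimes>\<^bsub>L\<^esub> loc_frac R m (y, \<one>)"
    using xy D_one by (simp add: mult_frac del: Diff_iff)
  show "loc_frac R m (x \<oplus> y, \<one>) = loc_frac R m (x, \<one>) \<oplus>\<^bsub>L\<^esub> loc_frac R m (y, \<one>)"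
    using xy D_one by (simp add: add_frac del: Diff_iff)
qed (simp add: one_frac)

end

text \<open>Localization up to isomorphism: \<open>D\<close> becomes invertible, every element is a
  fraction, and the kernel is \<open>D\<close>-torsion. Unlike the concrete construction, this
  description passes directly to polynomial rings.\<close>

locale localization = ring_hom_cring A B f for A (structure) and B (structure) and f +
  fixes D
  assumes D_carrier: "D \<subseteq> carrier A" and D_one: "\<one> \<in> D"
    and D_mult: "\<And>s t. s \<in> D \<Longrightarrow> t \<in> D \<Longrightarrow> s \<otimes> t \<in> D"
    and D_units: "\<And>s. s \<in> D \<Longrightarrow> f s \<in> Units B"
    and fractions: "\<And>b. b \<in> carrier B \<Longrightarrow> \<exists>a\<in>carrier A. \<exists>s\<in>D. f s \<otimes>\<^bsub>B\<^esub> b = f a"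
    and kernel: "\<And>a. a \<in> carrier A \<Longrightarrow> f a = \<zero>\<^bsub>B\<^esub> \<Longrightarrow> \<exists>s\<in>D. s \<otimes> a = \<zero>"

lemma (in prime_localization) localization_loc: "localization R L (loc_map R m) D"
proof (intro localization.intro localization_axioms.intro ring_hom_cringI is_cring cring_loc loc_map_hom)
  interpret L: cring L by (rule cring_loc)
  show "D \<subseteq> carrier R" by auto
  show "\<one> \<in> D" by (rule D_one)
  fix s assume s: "s \<in> D"
  show "s \<otimes> t \<in> D" if "t \<in> D" for t using s that by (rule D_mult)
  have cl: "loc_frac R m (\<one>, s) \<in> carrier L" "loc_frac R m (s, \<one>) \<in> carrier L" using s D_one frac_closed by auto
  have "loc_frac R m (\<one>, s) \<otimes>\<^bsub>L\<^esub> loc_frac R m (s, \<one>) = \<one>\<^bsub>L\<^esub>"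
    unfolding one_frac using s D_one DiffD1[OF s] by (simp add: mult_frac del: Diff_iff) (rule frac_eqI, auto)
  then show "loc_map R m s \<in> Units L" unfolding loc_map_def
    using cl L.m_comm[OF cl] unfolding Units_def by auto
next
  fix b assume "b \<in> carrier L"
  then obtain a s where a: "a \<in> carrier R" "s \<in> D" "b = loc_frac R m (a, s)" by (metis frac_cases)
  then have "loc_map R m s \<otimes>\<^bsub>L\<^esub> b = loc_map R m a" unfolding loc_map_def
    using D_one DiffD1[OF a(2)] by (simp add: mult_frac del: Diff_iff) (rule frac_eqI, auto simp: m_comm)
  then show "\<exists>a\<in>carrier R. \<exists>s\<in>D. loc_map R m s \<otimes>\<^bsub>L\<^esub> b = loc_map R m a" using a by blast
next
  fix a assume a: "a \<in> carrier R" "loc_map R m a = \<zero>\<^bsub>L\<^esub>"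
  then obtain u where "u \<in> D" "u \<otimes> (a \<otimes> \<one>) = u \<otimes> (\<zero> \<otimes> \<one>)"
    unfolding loc_map_def zero_frac using D_one frac_eq[of a \<one> \<zero> \<one>] by auto
  then show "\<exists>s\<in>D. s \<otimes> a = \<zero>" using a by auto
qed

section \<open>Polynomial rings and coefficientwise homomorphisms\<close>

definition UP_map :: "('a \<Rightarrow> 'b) \<Rightarrow> (nat \<Rightarrow> 'a) \<Rightarrow> (nat \<Rightarrow> 'b)" where
  "UP_map f p = (\<lambda>i. f (p i))"

lemma cring_UP: "cring R \<Longrightarrow> cring (UP R)"
  using UP_cring.UP_cring UP_cring.intro by metis

context cring
begin

lemma UP_carrier: "p \<in> carrier (UP R) \<longleftrightarrow> (\<forall>i. p i \<in> carrier R) \<and> (\<exists>n. \<forall>i>n. p i = \<zero>)"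
  by (auto simp: UP_def up_def bound_def)

lemma UP_coeff_closed [simp]: "p \<in> carrier (UP R) \<Longrightarrow> p i \<in> carrier R"
  by (simp add: UP_carrier)

lemma UP_add_apply: "p \<in> carrier (UP R) \<Longrightarrow> q \<in> carrier (UP R) \<Longrightarrow> (p \<oplus>\<^bsub>UP R\<^esub> q) i = p i \<oplus> q i"
  by (auto simp: UP_def)

lemma UP_mult_apply:
  "p \<in> carrier (UP R) \<Longrightarrow> q \<in> carrier (UP R) \<Longrightarrow> (p \<otimes>\<^bsub>UP R\<^esub> q) n = (\<Oplus>i\<in>{..n}. p i \<otimes> q (n - i))"
  by (auto simp: UP_def)

lemma UP_one_apply: "\<one>\<^bsub>UP R\<^esub> i = (if i = 0 then \<one> else \<zero>)"
  by (auto simp: UP_def)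

lemma UP_zero_apply: "\<zero>\<^bsub>UP R\<^esub> i = \<zero>"
  by (auto simp: UP_def)

lemma UP_monom_apply: "a \<in> carrier R \<Longrightarrow> up_ring.monom (UP R) a n i = (if i = n then a else \<zero>)"
  by (auto simp: UP_def)

lemma const_poly_closed [simp]: "a \<in> carrier R \<Longrightarrow> const_poly R a \<in> carrier (UP R)"
  unfolding const_poly_def by (intro UP_ring.monom_closed UP_ring.intro) (rule ring_axioms)

lemma const_poly_apply: "a \<in> carrier R \<Longrightarrow> const_poly R a i = (if i = 0 then a else \<zero>)"
  by (simp add: const_poly_def UP_monom_apply)

lemma const_poly_hom: "const_poly R \<in> ring_hom R (UP R)"
  using UP_ring.const_ring_hom[OF UP_ring.intro[OF ring_axioms]] by (simp add: const_poly_def[abs_def])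

lemma const_mult_apply:
  assumes "a \<in> carrier R" "p \<in> carrier (UP R)"
  shows "(const_poly R a \<otimes>\<^bsub>UP R\<^esub> p) i = a \<otimes> p i"
proof -
  have "(const_poly R a \<otimes>\<^bsub>UP R\<^esub> p) i = (\<Oplus>l\<in>{..i}. if 0 = l then a \<otimes> p (i - l) else \<zero>)"
    using assms by (subst UP_mult_apply) (auto simp: const_poly_apply intro!: finsum_cong')
  also have "\<dots> = a \<otimes> p (i - 0)"
    using assms by (intro finsum_singleton[of 0 _ "\<lambda>l. a \<otimes> p (i - l)"]) auto
  finally show ?thesis by simp
qed

end

lemma (in ring_hom_cring) UP_map_hom: "UP_map h \<in> ring_hom (UP R) (UP S)"
proof (rule ring_hom_memI)
  fix p q assume p: "p \<in> carrier (UP R)" and q: "q \<in> carrier (UP R)"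
  have cl: "UP_map h x \<in> carrier (UP S)" if "x \<in> carrier (UP R)" for x
    using that unfolding UP_map_def R.UP_carrier S.UP_carrier by fastforce
  then show "UP_map h p \<in> carrier (UP S)" using p by simp
  have "\<And>n. UP_map h (p \<otimes>\<^bsub>UP R\<^esub> q) n = (UP_map h p \<otimes>\<^bsub>UP S\<^esub> UP_map h q) n"
    using p q cl by (auto simp: S.UP_mult_apply R.UP_mult_apply UP_map_def hom_finsum Pi_def intro!: S.finsum_cong')
  then show "UP_map h (p \<otimes>\<^bsub>UP R\<^esub> q) = UP_map h p \<otimes>\<^bsub>UP S\<^esub> UP_map h q" by blast
  have "\<And>n. UP_map h (p \<oplus>\<^bsub>UP R\<^esub> q) n = (UP_map h p \<oplus>\<^bsub>UP S\<^esub> UP_map h q) n"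
    using p q cl[OF p] cl[OF q] by (simp add: S.UP_add_apply) (simp add: UP_map_def R.UP_add_apply)
  then show "UP_map h (p \<oplus>\<^bsub>UP R\<^esub> q) = UP_map h p \<oplus>\<^bsub>UP S\<^esub> UP_map h q" by blast
next
  show "UP_map h \<one>\<^bsub>UP R\<^esub> = \<one>\<^bsub>UP S\<^esub>"
    by (rule ext) (simp add: UP_map_def R.UP_one_apply S.UP_one_apply)
qed

lemma (in ring_hom_cring) UP_map_const: "a \<in> carrier R \<Longrightarrow> UP_map h (const_poly R a) = const_poly S (h a)"
  by (rule ext) (simp add: UP_map_def R.const_poly_apply S.const_poly_apply)

context localization
begin

lemma D_closed [simp]: "s \<in> D \<Longrightarrow> s \<in> carrier A"
  using D_carrier by blast

lemma fractions_mult: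
  assumes "f s \<otimes>\<^bsub>B\<^esub> b = f a" "s \<in> D" "t \<in> D" "a \<in> carrier A" "b \<in> carrier B"
  shows "f (s \<otimes> t) \<otimes>\<^bsub>B\<^esub> b = f (t \<otimes> a)"
proof -
  have "f (s \<otimes> t) \<otimes>\<^bsub>B\<^esub> b = f t \<otimes>\<^bsub>B\<^esub> (f s \<otimes>\<^bsub>B\<^esub> b)" using assms(2-) by (simp add: S.m_ac)
  then show ?thesis using assms by simp
qed

lemma common_denominator:
  assumes "finite F" "\<And>x. x \<in> F \<Longrightarrow> g x \<in> carrier B"
  shows "\<exists>s\<in>D. \<forall>x\<in>F. \<exists>a\<in>carrier A. f s \<otimes>\<^bsub>B\<^esub> g x = f a"
  using assms
proof (induction F rule: finite_induct)
  case empty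
  then show ?case using D_one by blast
next
  case (insert x F)
  then obtain s where s: "s \<in> D" "\<forall>x\<in>F. \<exists>a\<in>carrier A. f s \<otimes>\<^bsub>B\<^esub> g x = f a" by auto
  obtain a t where a: "a \<in> carrier A" "t \<in> D" "f t \<otimes>\<^bsub>B\<^esub> g x = f a" using fractions[of "g x"] insert by blast
  have "\<exists>a\<in>carrier A. f (s \<otimes> t) \<otimes>\<^bsub>B\<^esub> g y = f a" if "y \<in> insert x F" for y
  proof (cases "y = x")
    case True
    have "f (t \<otimes> s) \<otimes>\<^bsub>B\<^esub> g x = f (s \<otimes> a)" using fractions_mult[OF a(3,2) s(1) a(1)] insert by simp
    moreover have "t \<otimes> s = s \<otimes> t" "s \<otimes> a \<in> carrier A" using a s by (auto simp: R.m_comm)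
    ultimately show ?thesis using True by metis
  next
    case False
    then have "y \<in> F" using that by simp
    with s(2) obtain a' where a': "a' \<in> carrier A" "f s \<otimes>\<^bsub>B\<^esub> g y = f a'" by fastforce
    have "f (s \<otimes> t) \<otimes>\<^bsub>B\<^esub> g y = f (t \<otimes> a')" using a' insert.prems[OF that] a(2) s(1) by (intro fractions_mult) simp_all
    moreover have "t \<otimes> a' \<in> carrier A" using a' a by simp
    ultimately show ?thesis by blast
  qed
  then show ?case using D_mult[OF s(1) a(2)] by blast
qed

lemma common_annihilator:
  assumes "finite F" "\<And>x. x \<in> F \<Longrightarrow> g x \<in> carrier A" "\<And>x. x \<in> F \<Longrightarrow> f (g x) = \<zero>\<^bsub>B\<^esub>"
  shows "\<exists>s\<in>D. \<forall>x\<in>F. s \<otimes> g x = \<zero>"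
  using assms
proof (induction F rule: finite_induct)
  case empty
  then show ?case using D_one by blast
next
  case (insert x F)
  then obtain s where s: "s \<in> D" "\<forall>x\<in>F. s \<otimes> g x = \<zero>" by auto
  obtain t where t: "t \<in> D" "t \<otimes> g x = \<zero>" using kernel[of "g x"] insert by blast
  have "s \<otimes> t \<otimes> g y = \<zero>" if "y \<in> insert x F" for y
  proof -
    have gy: "g y \<in> carrier A" using that insert by auto
    then have "s \<otimes> t \<otimes> g y = s \<otimes> (t \<otimes> g y)" "s \<otimes> t \<otimes> g y = t \<otimes> (s \<otimes> g y)"
      using s t by (simp_all add: R.m_ac)
    then show ?thesis using that s t by auto
  qed
  then show ?case using D_mult[OF s(1) t(1)] by blast
qed

text \<open>Only finitely many coefficients are nonzero, so one denominator and one annihilator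
  serve them all. The denominators remain constants, also when the construction is iterated.\<close>

lemma localization_UP: "localization (UP A) (UP B) (UP_map f) (const_poly A ` D)"
proof (intro localization.intro localization_axioms.intro ring_hom_cringI cring_UP R.is_cring S.is_cring UP_map_hom)
  interpret PA: cring "UP A" by (intro cring_UP R.is_cring)
  interpret PB: cring "UP B" by (intro cring_UP S.is_cring)
  interpret cA: ring_hom_cring A "UP A" "const_poly A" by (intro ring_hom_cringI R.is_cring PA.is_cring R.const_poly_hom)
  interpret cB: ring_hom_cring B "UP B" "const_poly B" by (intro ring_hom_cringI S.is_cring PB.is_cring S.const_poly_hom)
  show "const_poly A ` D \<subseteq> carrier (UP A)" by auto
  show "\<one>\<^bsub>UP A\<^esub> \<in> const_poly A ` D" using D_one cA.hom_one by (metis image_eqI)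
  fix s assume s: "s \<in> const_poly A ` D"
  then obtain s0 where s0: "s0 \<in> D" "s = const_poly A s0" by blast
  show "s \<otimes>\<^bsub>UP A\<^esub> t \<in> const_poly A ` D" if "t \<in> const_poly A ` D" for t
    using that s0 D_mult by (auto simp: cA.hom_mult[symmetric] simp del: cA.hom_mult)
  obtain v where v: "v \<in> carrier B" "v \<otimes>\<^bsub>B\<^esub> f s0 = \<one>\<^bsub>B\<^esub>" "f s0 \<otimes>\<^bsub>B\<^esub> v = \<one>\<^bsub>B\<^esub>"
    using D_units[OF s0(1)] by (auto simp: Units_def)
  then show "UP_map f s \<in> Units (UP B)"
    using s0 unfolding Units_def
    by (auto simp: UP_map_const cB.hom_mult[symmetric] simp del: cB.hom_mult intro!: bexI[of _ "const_poly B v"])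
next
  fix b assume b: "b \<in> carrier (UP B)"
  then obtain n where n: "\<forall>i>n. b i = \<zero>\<^bsub>B\<^esub>" by (auto simp: S.UP_carrier)
  obtain s where s: "s \<in> D" "\<forall>i\<in>{..n}. \<exists>a\<in>carrier A. f s \<otimes>\<^bsub>B\<^esub> b i = f a"
    using common_denominator[of "{..n}" b] b by auto
  \<comment> \<open>Beyond the degree bound the numerators are chosen to be zero, so that together
    they form a polynomial.\<close>
  then have "\<forall>i. \<exists>a\<in>carrier A. f s \<otimes>\<^bsub>B\<^esub> b i = f a \<and> (i > n \<longrightarrow> a = \<zero>)"
  proof (intro allI)
    fix i show "\<exists>a\<in>carrier A. f s \<otimes>\<^bsub>B\<^esub> b i = f a \<and> (i > n \<longrightarrow> a = \<zero>)"
      using s n by (cases "i > n") (auto intro!: bexI[of _ \<zero>])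
  qed
  then obtain a where a: "\<And>i. a i \<in> carrier A" "\<And>i. f s \<otimes>\<^bsub>B\<^esub> b i = f (a i)" "\<And>i. i > n \<Longrightarrow> a i = \<zero>" by metis
  then have ac: "a \<in> carrier (UP A)" by (auto simp: R.UP_carrier)
  have "UP_map f (const_poly A s) \<otimes>\<^bsub>UP B\<^esub> b = UP_map f a"
    using s a b by (intro ext) (simp add: UP_map_const S.const_mult_apply, simp add: UP_map_def)
  then show "\<exists>a\<in>carrier (UP A). \<exists>s\<in>const_poly A ` D. UP_map f s \<otimes>\<^bsub>UP B\<^esub> b = UP_map f a"
    using ac s by blast
next
  fix a assume a: "a \<in> carrier (UP A)" "UP_map f a = \<zero>\<^bsub>UP B\<^esub>"
  then have fa: "f (a i) = \<zero>\<^bsub>B\<^esub>" for i by (metis UP_map_def S.UP_zero_apply)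
  obtain n where n: "\<forall>i>n. a i = \<zero>" using a by (auto simp: R.UP_carrier)
  obtain s where s: "s \<in> D" "\<forall>i\<in>{..n}. s \<otimes> a i = \<zero>"
    using common_annihilator[of "{..n}" a] a fa by auto
  then have "s \<otimes> a i = \<zero>" for i using n by (cases "i > n") auto
  then have "const_poly A s \<otimes>\<^bsub>UP A\<^esub> a = \<zero>\<^bsub>UP A\<^esub>"
    using s a by (intro ext) (simp add: R.const_mult_apply R.UP_zero_apply)
  then show "\<exists>s\<in>const_poly A ` D. s \<otimes>\<^bsub>UP A\<^esub> a = \<zero>\<^bsub>UP A\<^esub>" using s by blast
qed

end

section \<open>Dilation\<close>

text \<open>Vectors are functions on all natural numbers, and images of vectors under homomorphisms
  often agree only below \<open>k\<close>.\<close>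

lemma (in cring) ET_cong:
  assumes "U \<in> ET R k c d J" "c \<in> vec_carrier R k" "d \<in> vec_carrier R k" "J \<subseteq> carrier R"
    and "\<And>i. i < k \<Longrightarrow> c i = c' i" "\<And>i. i < k \<Longrightarrow> d i = d' i"
  shows "U \<in> ET R k c' d' J"
  using assms(1)
proof (induction rule: ET.induct)
  case ET_one
  then show ?case by (rule ET.ET_one)
next
  case (ET_row g U)
  then have "g \<in> vec_carrier R k" using assms(4) by (auto simp: vec_carrier_def)
  then have "dot R k g d = dot R k g d'" using assms by (intro dot_cong) auto
  moreover have "transv R k d g = transv R k d' g" using assms by (intro transv_cong) auto
  ultimately show ?case using ET_row by (auto intro!: ET.ET_row)
next
  case (ET_col g U)
  then have "g \<in> vec_carrier R k" using assms(4) by (auto simp: vec_carrier_def)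
  then have "dot R k c g = dot R k c' g" using assms by (intro dot_cong) auto
  moreover have "transv R k g c = transv R k g c'" using assms by (intro transv_cong) auto
  ultimately show ?case using ET_col by (auto intro!: ET.ET_col)
qed

section \<open>Transvections under ring homomorphisms and their lifting\<close>

context ring_hom_cring
begin

lemma hom_vec_closed [simp]: "v \<in> vec_carrier R k \<Longrightarrow> (\<lambda>i. h (v i)) \<in> vec_carrier S k"
  by (auto simp: vec_carrier_def)

lemma mat_map_closed [simp]: "M \<in> mat_carrier R k \<Longrightarrow> mat_map S k h M \<in> mat_carrier S k"
  by (auto simp: mat_map_def mat_carrier_def[of S k])

lemma hom_dot:
  "v \<in> vec_carrier R k \<Longrightarrow> w \<in> vec_carrier R k \<Longrightarrow>
   h (dot R k v w) = dot S k (\<lambda>i. h (v i)) (\<lambda>i. h (w i))"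
  unfolding dot_def
  by (subst hom_finsum) (auto simp: vec_carrier_def intro!: S.finsum_cong')

lemma mat_map_mult:
  assumes "M \<in> mat_carrier R k" "N \<in> mat_carrier R k"
  shows "mat_map S k h (mat_mult R k M N) = mat_mult S k (mat_map S k h M) (mat_map S k h N)"
proof (rule mat_eqI[of _ S k])
  fix i j assume ij: "i < k" "j < k"
  have "h (dot R k (M i) (\<lambda>l. N l j)) = dot S k (\<lambda>l. h (M i l)) (\<lambda>l. h (N l j))"
    using assms by (simp add: hom_dot)
  also have "\<dots> = dot S k (mat_map S k h M i) (\<lambda>l. mat_map S k h N l j)"
    using assms ij by (intro S.dot_cong) (auto simp: mat_map_def vec_carrier_def)
  finally show "mat_map S k h (mat_mult R k M N) i j = mat_mult S k (mat_map S k h M) (mat_map S k h N) i j"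
    using ij by (simp add: S.mat_mult_dot) (simp add: mat_map_def R.mat_mult_dot)
qed (use assms in auto)

lemma mat_map_one [simp]: "mat_map S k h (mat_one R k) = mat_one S k"
  by (auto simp: mat_map_def mat_one_def fun_eq_iff)

lemma mat_map_transv:
  assumes "p \<in> vec_carrier R k" "q \<in> vec_carrier R k"
  shows "mat_map S k h (transv R k p q) = transv S k (\<lambda>i. h (p i)) (\<lambda>i. h (q i))"
  using assms by (auto simp: mat_map_def transv_def outer_def mat_one_def fun_eq_iff vec_carrierD)

lemma mat_map_ET:
  assumes "U \<in> ET R k c d J" "c \<in> vec_carrier R k" "d \<in> vec_carrier R k" "J \<subseteq> carrier R"
  shows "mat_map S k h U \<in> ET S k (\<lambda>i. h (c i)) (\<lambda>i. h (d i)) (h ` J)"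
  using assms(1)
proof (induction rule: ET.induct)
  case ET_one
  then show ?case by (simp add: ET.ET_one)
next
  case (ET_row g U)
  then have g: "g \<in> vec_carrier R k" using assms(4) by (auto simp: vec_carrier_def)
  have "U \<in> mat_carrier R k" using R.ET_closed[OF assms(2-4) ET_row(3)] .
  then show ?case using ET_row g assms hom_dot[OF g assms(3)]
    by (auto simp: mat_map_mult mat_map_transv intro!: ET.ET_row)
next
  case (ET_col g U)
  then have g: "g \<in> vec_carrier R k" using assms(4) by (auto simp: vec_carrier_def)
  have "U \<in> mat_carrier R k" using R.ET_closed[OF assms(2-4) ET_col(3)] .
  then show ?case using ET_col g assms hom_dot[OF assms(2) g]
    by (auto simp: mat_map_mult mat_map_transv intro!: ET.ET_col)
qed

lemma mat_map_ET_carrier: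
  assumes "U \<in> ET R k c d (carrier R)" "c \<in> vec_carrier R k" "d \<in> vec_carrier R k"
    and "\<And>i. i < k \<Longrightarrow> h (c i) = c' i" "\<And>i. i < k \<Longrightarrow> h (d i) = d' i"
  shows "mat_map S k h U \<in> ET S k c' d' (carrier S)"
proof -
  have "mat_map S k h U \<in> ET S k (\<lambda>i. h (c i)) (\<lambda>i. h (d i)) (carrier S)"
    using mat_map_ET[OF assms(1-3) subset_refl] by (rule S.ET_mono) auto
  then show ?thesis by (rule S.ET_cong) (use assms in auto)
qed

lemma lift_orthogonal:
  assumes cd: "c \<in> vec_carrier R k" "d \<in> vec_carrier R k" "dot R k c d = \<one>"
    and g: "\<And>i. i < k \<Longrightarrow> g i \<in> h ` carrier R" "dot S k g (\<lambda>i. h (d i)) = \<zero>\<^bsub>S\<^esub>"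
  shows "\<exists>g0\<in>vec_carrier R k. dot R k g0 d = \<zero> \<and> (\<forall>i<k. h (g0 i) = g i)"
proof -
  have "\<forall>i\<in>{..<k}. \<exists>x. x \<in> carrier R \<and> h x = g i" using g(1) by (metis imageE lessThan_iff)
  from bchoice[OF this] obtain g1 where g1: "\<And>i. i < k \<Longrightarrow> g1 i \<in> carrier R" "\<And>i. i < k \<Longrightarrow> h (g1 i) = g i" by auto
  have g1v: "g1 \<in> vec_carrier R k" using g1 by (simp add: vec_carrier_def)
  \<comment> \<open>An arbitrary lift \<open>g1\<close> need not be orthogonal to \<open>d\<close>, but \<open>g1 \<cdot> d\<close> lies in the kernel of \<open>h\<close>.\<close>
  define g0 where "g0 i = g1 i \<ominus> dot R k g1 d \<otimes> c i" for i
  have g0v: "g0 \<in> vec_carrier R k" unfolding g0_def using g1v cd by simp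
  have "dot R k g0 d = \<zero>" unfolding g0_def using g1v cd
    by (simp add: R.dot_minus_left R.dot_smult_left)
  moreover have "h (dot R k g1 d) = \<zero>\<^bsub>S\<^esub>"
  proof -
    have "h (dot R k g1 d) = dot S k (\<lambda>i. h (g1 i)) (\<lambda>i. h (d i))" using g1v cd by (simp add: hom_dot)
    also have "\<dots> = dot S k g (\<lambda>i. h (d i))" using g1v cd g1(2) by (intro S.dot_cong) auto
    finally show ?thesis using g(2) by simp
  qed
  then have "h (g0 i) = g i" if "i < k" for i
    unfolding g0_def using that g1 g1v cd vec_carrierD[OF cd(1) that] hom_closed[OF g1(1)[OF that]]
    by (auto simp: a_minus_def)
  ultimately show ?thesis using g0v by blast
qed

text \<open>Each generator is lifted separately, with its parameter corrected by a multiple of the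
  other vector to restore orthogonality. The coefficient of the correction maps to zero, so the
  image of the generator is unchanged.\<close>

lemma lift_ET:
  assumes cd: "c \<in> vec_carrier R k" "d \<in> vec_carrier R k" "dot R k c d = \<one>"
    and U: "U \<in> ET S k (\<lambda>i. h (c i)) (\<lambda>i. h (d i)) (h ` carrier R)"
  shows "\<exists>V\<in>ET R k c d (carrier R). mat_map S k h V = U"
  using U
proof (induction rule: ET.induct)
  case ET_one
  then show ?case by (intro bexI[of _ "mat_one R k"]) (auto intro: ET.ET_one)
next
  case (ET_row g U)
  then obtain V where V: "V \<in> ET R k c d (carrier R)" "mat_map S k h V = U" by blast
  obtain g0 where g0: "g0 \<in> vec_carrier R k" "dot R k g0 d = \<zero>" "\<And>i. i < k \<Longrightarrow> h (g0 i) = g i"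
    using lift_orthogonal[OF cd ET_row(1,2)] by blast
  have "mat_mult R k (transv R k d g0) V \<in> ET R k c d (carrier R)"
    using g0 V by (intro ET.ET_row) (auto simp: vec_carrierD)
  moreover have "mat_map S k h (mat_mult R k (transv R k d g0) V) = mat_mult S k (transv S k (\<lambda>i. h (d i)) g) U"
    using V g0 cd R.ET_closed[OF cd(1,2) subset_refl V(1)]
    by (simp add: mat_map_mult mat_map_transv) (metis S.transv_cong)
  ultimately show ?case by blast
next
  case (ET_col g U)
  then obtain V where V: "V \<in> ET R k c d (carrier R)" "mat_map S k h V = U" by blast
  have gv: "g \<in> vec_carrier S k" using ET_col(1) by (force simp: vec_carrier_def)
  have "dot S k g (\<lambda>i. h (c i)) = \<zero>\<^bsub>S\<^esub>" using ET_col(2) gv cd by (simp add: S.dot_comm)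
  moreover have "dot R k d c = \<one>" using cd by (simp add: R.dot_comm)
  ultimately obtain g0 where g0: "g0 \<in> vec_carrier R k" "dot R k g0 c = \<zero>" "\<And>i. i < k \<Longrightarrow> h (g0 i) = g i"
    using lift_orthogonal[OF cd(2,1), of g] ET_col(1) by blast
  have "mat_mult R k (transv R k g0 c) V \<in> ET R k c d (carrier R)"
    using g0 V cd by (intro ET.ET_col) (auto simp: vec_carrierD R.dot_comm)
  moreover have "mat_map S k h (mat_mult R k (transv R k g0 c) V) = mat_mult S k (transv S k g (\<lambda>i. h (c i))) U"
    using V g0 cd R.ET_closed[OF cd(1,2) subset_refl V(1)]
    by (simp add: mat_map_mult mat_map_transv) (metis S.transv_cong)
  ultimately show ?case by blast
qed

end

lemma mat_map_mat_map: "mat_map T k g (mat_map S k h M) = mat_map T k (\<lambda>x. g (h x)) M"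
  by (auto simp: mat_map_def fun_eq_iff)

lemma mat_map_cong:
  "M \<in> mat_carrier R k \<Longrightarrow> (\<And>x. x \<in> carrier R \<Longrightarrow> g x = h x) \<Longrightarrow> mat_map S k g M = mat_map S k h M"
  by (auto simp: mat_map_def fun_eq_iff mat_carrierD)

lemma mat_map_id: "M \<in> mat_carrier R k \<Longrightarrow> mat_map R k (\<lambda>x. x) M = M"
  by (rule mat_eqI[of _ R k]) (auto simp: mat_map_def mat_carrier_def)

text \<open>The substitution of \<open>s Y\<close> for the variable \<open>Y\<close>, written on
  coefficients.\<close>

definition scale :: "('a, 'm) ring_scheme \<Rightarrow> 'a \<Rightarrow> (nat \<Rightarrow> 'a) \<Rightarrow> (nat \<Rightarrow> 'a)" where
  "scale R s p = (\<lambda>i. s [^]\<^bsub>R\<^esub> i \<otimes>\<^bsub>R\<^esub> p i)"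

context cring
begin

lemma scale_closed [simp]: "s \<in> carrier R \<Longrightarrow> p \<in> carrier (UP R) \<Longrightarrow> scale R s p \<in> carrier (UP R)"
proof -
  assume s: "s \<in> carrier R" and p: "p \<in> carrier (UP R)"
  then obtain n where "\<forall>i>n. p i = \<zero>" by (auto simp: UP_carrier)
  then have "\<forall>i>n. scale R s p i = \<zero>" using s by (simp add: scale_def)
  then show ?thesis using s p unfolding UP_carrier by (auto simp: scale_def)
qed

lemma scale_hom:
  assumes s: "s \<in> carrier R"
  shows "ring_hom_cring (UP R) (UP R) (scale R s)"
proof (intro ring_hom_cringI cring_UP is_cring ring_hom_memI)
  fix p q assume p: "p \<in> carrier (UP R)" and q: "q \<in> carrier (UP R)"
  show "scale R s p \<in> carrier (UP R)" using s p by simp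
  show "scale R s (p \<oplus>\<^bsub>UP R\<^esub> q) = scale R s p \<oplus>\<^bsub>UP R\<^esub> scale R s q"
    using s p q by (intro ext) (simp add: UP_add_apply, simp add: scale_def UP_add_apply r_distr)
  show "scale R s (p \<otimes>\<^bsub>UP R\<^esub> q) = scale R s p \<otimes>\<^bsub>UP R\<^esub> scale R s q"
  proof
    fix n
    have "scale R s (p \<otimes>\<^bsub>UP R\<^esub> q) n = (\<Oplus>i\<in>{..n}. s [^] n \<otimes> (p i \<otimes> q (n - i)))"
      using s p q by (simp add: scale_def UP_mult_apply finsum_rdistr Pi_def)
    also have "\<dots> = (\<Oplus>i\<in>{..n}. scale R s p i \<otimes> scale R s q (n - i))"
    proof (intro finsum_cong')
      fix i assume "i \<in> {..n}"
      then have "s [^] n = s [^] i \<otimes> s [^] (n - i)" using s by (simp add: nat_pow_mult)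
      then show "s [^] n \<otimes> (p i \<otimes> q (n - i)) = scale R s p i \<otimes> scale R s q (n - i)"
        using s p q by (simp add: scale_def m_ac)
    qed (use s p q in auto)
    also have "\<dots> = (scale R s p \<otimes>\<^bsub>UP R\<^esub> scale R s q) n"
      using s p q by (simp add: UP_mult_apply)
    finally show "scale R s (p \<otimes>\<^bsub>UP R\<^esub> q) n = (scale R s p \<otimes>\<^bsub>UP R\<^esub> scale R s q) n" .
  qed
next
  show "scale R s \<one>\<^bsub>UP R\<^esub> = \<one>\<^bsub>UP R\<^esub>"
    using s by (intro ext) (auto simp: scale_def UP_one_apply)
qed

lemma scale_const: "s \<in> carrier R \<Longrightarrow> a \<in> carrier R \<Longrightarrow> scale R s (const_poly R a) = const_poly R a"
  by (rule ext) (simp add: scale_def const_poly_apply)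

lemma scale_scale:
  "s \<in> carrier R \<Longrightarrow> t \<in> carrier R \<Longrightarrow> p \<in> carrier (UP R) \<Longrightarrow> scale R s (scale R t p) = scale R (s \<otimes> t) p"
  by (rule ext) (simp add: scale_def nat_pow_distrib m_assoc)

lemma scale_zero_coeff: "s \<in> carrier R \<Longrightarrow> p \<in> carrier (UP R) \<Longrightarrow> scale R s p 0 = p 0"
  by (simp add: scale_def)

lemma zero_coeff_hom: "ring_hom_cring (UP R) R (\<lambda>p. p 0)"
  by (intro ring_hom_cringI cring_UP is_cring ring_hom_memI)
     (auto simp: UP_add_apply UP_mult_apply UP_one_apply)

lemma const_hom: "ring_hom_cring R (UP R) (const_poly R)"
  by (intro ring_hom_cringI cring_UP is_cring const_poly_hom)

text \<open>Evaluation at \<open>0\<close>, followed by the inclusion of constants so that values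
  stay in the same polynomial ring.\<close>

lemma const_zero_coeff_hom: "ring_hom_cring (UP R) (UP R) (\<lambda>p. const_poly R (p 0))"
proof -
  interpret z: ring_hom_cring "UP R" R "\<lambda>p. p 0" by (rule zero_coeff_hom)
  interpret c: ring_hom_cring R "UP R" "const_poly R" by (rule const_hom)
  show ?thesis
    by (intro ring_hom_cringI cring_UP is_cring ring_hom_memI) auto
qed

end

lemma (in cring) mult_dividesD:
  assumes "a \<in> carrier R" "b \<in> carrier R" "a \<otimes> b divides t"
  shows "a divides t" "b divides t"
proof -
  obtain r where r: "r \<in> carrier R" "t = a \<otimes> b \<otimes> r" using assms by (auto simp: factor_def)
  then have "t = a \<otimes> (b \<otimes> r)" "t = b \<otimes> (a \<otimes> r)" using assms by (auto simp: m_ac)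
  then show "a divides t" "b divides t" using r(1) assms(1,2) unfolding factor_def by blast+
qed

text \<open>Inserting \<open>G' G\<close> moves \<open>G\<close> to the right of \<open>T\<close>,
  at the price of a conjugate of \<open>T\<close>.\<close>

lemma (in cring) perturb_mult:
  assumes "E \<in> mat_carrier R k" "G \<in> mat_carrier R k" "G' \<in> mat_carrier R k" "T \<in> mat_carrier R k" "U \<in> mat_carrier R k"
    and "mat_mult R k G' G = mat_one R k"
  shows "mat_mult R k (mat_mult R k E G) (mat_mult R k T U)
    = mat_mult R k (mat_mult R k E (mat_mult R k (mat_mult R k G T) G')) (mat_mult R k G U)"
proof -
  have "mat_mult R k (mat_mult R k E (mat_mult R k (mat_mult R k G T) G')) (mat_mult R k G U)
    = mat_mult R k (mat_mult R k E (mat_mult R k G T)) (mat_mult R k (mat_mult R k G' G) U)"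
    using assms(1-5) by (simp add: mat_mult_assoc)
  then show ?thesis using assms by (simp add: mat_mult_assoc)
qed

section \<open>Words in transvections under the substitution of s Y for Y\<close>

context localization
begin

abbreviation "PA \<equiv> UP A"
abbreviation "PB \<equiv> UP B"
abbreviation "F \<equiv> UP_map f"

abbreviation "frac_ideal t \<equiv> pow_multiples PB (F ` carrier PA) (const_poly B (f t))"

text \<open>The coefficient of degree zero cancels in the difference. Every other coefficient has
  gained a factor \<open>s\<close>, hence \<open>t^(M + 1)\<close>: one power of \<open>t\<close>
  clears the denominator and \<open>t^M\<close> remains.\<close>

lemma perturbation_vec:
  assumes g: "g \<in> vec_carrier PB k"
  shows "\<exists>s1\<in>D. \<forall>t\<in>carrier A. s1 divides\<^bsub>A\<^esub> t \<longrightarrow> (\<forall>M. \<forall>s\<in>carrier A. t [^] Suc M divides\<^bsub>A\<^esub> s \<longrightarrow>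
     (\<forall>i<k. const_poly B (f t) \<otimes>\<^bsub>PB\<^esub> const_poly B (g i 0) \<in> F ` carrier PA \<and>
        (\<exists>e\<in>carrier PA. scale B (f s) (g i) \<ominus>\<^bsub>PB\<^esub> const_poly B (g i 0) = const_poly B (f t) [^]\<^bsub>PB\<^esub> M \<otimes>\<^bsub>PB\<^esub> F e)))"
proof -
  interpret P: localization PA PB F "const_poly A ` D" by (rule localization_UP)
  interpret cB: ring_hom_cring B PB "const_poly B" by (rule S.const_hom)
  obtain s1 where s1: "s1 \<in> D" "\<forall>i\<in>{..<k}. \<exists>a\<in>carrier PA. F (const_poly A s1) \<otimes>\<^bsub>PB\<^esub> g i = F a"
    using P.common_denominator[of "{..<k}" g] g by (auto simp: vec_carrierD)
  show ?thesis
  proof (intro bexI[OF _ s1(1)] ballI impI allI)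
    fix t M s i assume t: "t \<in> carrier A" "s1 divides\<^bsub>A\<^esub> t" and s: "s \<in> carrier A" "t [^] Suc M divides\<^bsub>A\<^esub> s" and i: "i < k"
    note gi = vec_carrierD[OF g i]
    obtain a where a: "a \<in> carrier PA" "F (const_poly A s1) \<otimes>\<^bsub>PB\<^esub> g i = F a" using s1 i by auto
    obtain r where r: "r \<in> carrier A" "t = s1 \<otimes> r" using t by (auto simp: factor_def)
    obtain r' where r': "r' \<in> carrier A" "s = t [^] Suc M \<otimes> r'" using s by (auto simp: factor_def)
    have tg: "f t \<otimes>\<^bsub>B\<^esub> g i l = f (r \<otimes> a l)" for l
    proof -
      have "f s1 \<otimes>\<^bsub>B\<^esub> g i l = f (a l)"
        using fun_cong[OF a(2), of l] s1 gi a by (simp add: UP_map_const S.const_mult_apply) (simp add: UP_map_def)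
      moreover have "f t \<otimes>\<^bsub>B\<^esub> g i l = f r \<otimes>\<^bsub>B\<^esub> (f s1 \<otimes>\<^bsub>B\<^esub> g i l)"
        using r s1 gi by (simp add: S.m_ac)
      ultimately show ?thesis using r a by simp
    qed
    have "const_poly B (f t) \<otimes>\<^bsub>PB\<^esub> const_poly B (g i 0) = F (const_poly A (r \<otimes> a 0))"
      using t gi r a tg[of 0] by (simp add: UP_map_const cB.hom_mult[symmetric] del: cB.hom_mult hom_mult)
    moreover have "const_poly A (r \<otimes> a 0) \<in> carrier PA" using r a by simp
    moreover
    \<comment> \<open>From \<open>s = t^M t r'\<close> and \<open>f t * g i l = f (r * a l)\<close>:
      of the factor \<open>s^l\<close> in degree \<open>l\<close>, one \<open>s\<close> is used up
      and \<open>s^(l - 1)\<close> is kept.\<close>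
    define e where "e l = (if l = 0 then \<zero> else r' \<otimes> s [^] (l - 1) \<otimes> (r \<otimes> a l))" for l :: nat
    have e: "e \<in> carrier PA" 
    proof -
      obtain n where "\<forall>i>n. a i = \<zero>" using a by (auto simp: R.UP_carrier)
      then have "\<forall>i>n. e i = \<zero>" using r'(1) s(1) r(1) by (simp add: e_def)
      moreover have "e i \<in> carrier A" for i using r'(1) s(1) r(1) a(1) by (simp add: e_def)
      ultimately show ?thesis unfolding R.UP_carrier by blast
    qed
    have "scale B (f s) (g i) \<ominus>\<^bsub>PB\<^esub> const_poly B (g i 0) = const_poly B (f t) [^]\<^bsub>PB\<^esub> M \<otimes>\<^bsub>PB\<^esub> F e"
    proof -
      have Fe: "F e \<in> carrier PB" using e by simp
      have "scale B (f s) (g i) = const_poly B (f t [^]\<^bsub>B\<^esub> M) \<otimes>\<^bsub>PB\<^esub> F e \<oplus>\<^bsub>PB\<^esub> const_poly B (g i 0)"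
      proof
        fix l
        show "scale B (f s) (g i) l = (const_poly B (f t [^]\<^bsub>B\<^esub> M) \<otimes>\<^bsub>PB\<^esub> F e \<oplus>\<^bsub>PB\<^esub> const_poly B (g i 0)) l"
        proof (cases l)
          case 0
          then show ?thesis using t s gi Fe
            by (simp add: S.UP_add_apply S.const_mult_apply S.const_poly_apply scale_def del: cB.hom_pow)
               (simp add: UP_map_def e_def)
        next
          case (Suc l')
          have fs: "f s = f t [^]\<^bsub>B\<^esub> M \<otimes>\<^bsub>B\<^esub> f r' \<otimes>\<^bsub>B\<^esub> f t" using t r' by (simp add: S.m_ac)
          have "scale B (f s) (g i) l = f s [^]\<^bsub>B\<^esub> l' \<otimes>\<^bsub>B\<^esub> f s \<otimes>\<^bsub>B\<^esub> g i l" by (simp add: scale_def Suc)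
          also have "\<dots> = f t [^]\<^bsub>B\<^esub> M \<otimes>\<^bsub>B\<^esub> (f r' \<otimes>\<^bsub>B\<^esub> f s [^]\<^bsub>B\<^esub> l' \<otimes>\<^bsub>B\<^esub> (f t \<otimes>\<^bsub>B\<^esub> g i l))"
            apply (subst (2) fs) using t r' s gi by (simp add: S.m_ac)
          also have "\<dots> = f t [^]\<^bsub>B\<^esub> M \<otimes>\<^bsub>B\<^esub> f (e l)"
            unfolding tg e_def using Suc r' s r a by simp
          finally show ?thesis using t gi Fe Suc
            by (simp add: S.UP_add_apply S.const_mult_apply S.const_poly_apply del: cB.hom_pow)
               (simp add: UP_map_def e_def r' s r a)
        qed
      qed
      then show ?thesis using t gi Fe by (simp add: cB.hom_pow[symmetric] a_minus_def P.S.a_assoc P.S.r_neg del: cB.hom_pow)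
    qed
    ultimately show "const_poly B (f t) \<otimes>\<^bsub>PB\<^esub> const_poly B (g i 0) \<in> F ` carrier PA \<and>
        (\<exists>e\<in>carrier PA. scale B (f s) (g i) \<ominus>\<^bsub>PB\<^esub> const_poly B (g i 0) = const_poly B (f t) [^]\<^bsub>PB\<^esub> M \<otimes>\<^bsub>PB\<^esub> F e)"
      using e by blast
  qed
qed

lemma UP_map_scale:
  "s \<in> carrier A \<Longrightarrow> p \<in> carrier PA \<Longrightarrow> F (scale A s p) = scale B (f s) (F p)"
  by (rule ext) (simp add: UP_map_def scale_def)

context
  fixes k c d j
  assumes cd [simp]: "c \<in> vec_carrier A k" "d \<in> vec_carrier A k" and dot_cd: "dot A k c d = \<one>"
    and k: "3 \<le> k" and j: "j < k" "c j \<in> D" "d j \<in> D"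
begin

abbreviation "CA \<equiv> \<lambda>i. const_poly A (c i)"
abbreviation "DA \<equiv> \<lambda>i. const_poly A (d i)"
abbreviation "CB \<equiv> \<lambda>i. const_poly B (f (c i))"
abbreviation "DB \<equiv> \<lambda>i. const_poly B (f (d i))"

lemma CA_closed [simp]: "CA \<in> vec_carrier PA k" "DA \<in> vec_carrier PA k"
  using ring_hom_cring.hom_vec_closed[OF R.const_hom] by auto

lemma CB_closed [simp]: "CB \<in> vec_carrier PB k" "DB \<in> vec_carrier PB k"
  using ring_hom_cring.hom_vec_closed[OF S.const_hom, OF hom_vec_closed] by auto

lemma F_CA: "i < k \<Longrightarrow> F (CA i) = CB i" "i < k \<Longrightarrow> F (DA i) = DB i"
  using UP_map_const vec_carrierD[OF cd(1)] vec_carrierD[OF cd(2)] by auto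

lemma dot_CA: "dot PA k CA DA = \<one>\<^bsub>PA\<^esub>"
  using ring_hom_cring.hom_dot[OF R.const_hom cd] ring_hom_one[OF R.const_poly_hom] dot_cd by simp

lemma dot_CB: "dot PB k CB DB = \<one>\<^bsub>PB\<^esub>"
  using ring_hom_cring.hom_dot[OF S.const_hom hom_vec_closed[OF cd(1)] hom_vec_closed[OF cd(2)]]
    ring_hom_one[OF S.const_poly_hom] hom_dot[OF cd] dot_cd by simp

lemma denominators_PB:
  assumes t: "t \<in> D" "c j divides\<^bsub>A\<^esub> t" "d j divides\<^bsub>A\<^esub> t"
  shows "\<exists>tc td. denominators PB (F ` carrier PA) (const_poly B (f t)) k CB DB j tc td"
proof -
  interpret P: localization PA PB F "const_poly A ` D" by (rule localization_UP)
  interpret cB: ring_hom_cring B PB "const_poly B" by (rule S.const_hom)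
  obtain r where r: "r \<in> carrier A" "t = c j \<otimes> r" using t by (auto simp: factor_def)
  obtain r' where r': "r' \<in> carrier A" "t = d j \<otimes> r'" using t by (auto simp: factor_def)
  have cj: "c j \<in> carrier A" "d j \<in> carrier A" using j by auto
  have im: "const_poly B (f x) \<in> F ` carrier PA" if "x \<in> carrier A" for x
    using that UP_map_const[OF that, symmetric] by auto
  have "denominators PB (F ` carrier PA) (const_poly B (f t)) k CB DB j (const_poly B (f r)) (const_poly B (f r'))"
  proof (intro denominators.intro denominators_axioms.intro P.S.is_cring)
    show "subring (F ` carrier PA) PB"
      by (rule ring_hom_ring.img_is_subring[OF ring_hom_ringI2[OF P.R.ring_axioms P.S.ring_axioms P.homh]])
         (rule P.R.carrier_is_subring)
    show "const_poly B (f t) \<in> F ` carrier PA" using im t by simp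
    show "const_poly B (f t) \<in> Units PB" using P.D_units[of "const_poly A t"] t UP_map_const[of t] by auto
    show "CB i \<in> F ` carrier PA" "DB i \<in> F ` carrier PA" if "i < k" for i
      using im vec_carrierD[OF cd(1) that] vec_carrierD[OF cd(2) that] by auto
    show "const_poly B (f t) = CB j \<otimes>\<^bsub>PB\<^esub> const_poly B (f r)" using r cj by simp
    show "const_poly B (f t) = DB j \<otimes>\<^bsub>PB\<^esub> const_poly B (f r')" using r' cj by simp
  qed (use im r r' j k dot_CB in auto)
  then show ?thesis by blast
qed

text \<open>The order of the quantifiers is made for induction on words. The bound \<open>t0\<close>
  precedes \<open>t\<close>, so that a longer word may ask for further denominators. Every exponent
  \<open>M\<close> is covered, because conjugation by the next generator loses powers of
  \<open>t\<close>. And \<open>N\<close> may depend on \<open>t\<close> and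
  \<open>M\<close>.\<close>

definition perturbable :: "(nat \<Rightarrow> nat \<Rightarrow> nat \<Rightarrow> 'c) \<Rightarrow> bool" where
  "perturbable U \<longleftrightarrow> (\<exists>t0\<in>D. \<forall>t\<in>D. t0 divides\<^bsub>A\<^esub> t \<longrightarrow> c j divides\<^bsub>A\<^esub> t \<longrightarrow> d j divides\<^bsub>A\<^esub> t \<longrightarrow>
    (\<forall>M. \<exists>N. \<forall>s\<in>carrier A. t [^] (N::nat) divides\<^bsub>A\<^esub> s \<longrightarrow>
      (\<exists>\<tau>\<in>ET PB k CB DB (frac_ideal t M).
        mat_map PB k (scale B (f s)) U = mat_mult PB k \<tau> (mat_map PB k (\<lambda>p. const_poly B (p 0)) U))))"

text \<open>Rows and columns under one name, so that the induction step below is carried out once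
  for both.\<close>

definition gen :: "bool \<Rightarrow> (nat \<Rightarrow> nat \<Rightarrow> 'c) \<Rightarrow> (nat \<Rightarrow> nat \<Rightarrow> nat \<Rightarrow> 'c)" where
  "gen row g = (if row then transv PB k DB g else transv PB k g CB)"

definition orth :: "bool \<Rightarrow> (nat \<Rightarrow> nat \<Rightarrow> 'c) \<Rightarrow> bool" where
  "orth row g \<longleftrightarrow> (if row then dot PB k g DB else dot PB k CB g) = \<zero>\<^bsub>PB\<^esub>"

lemma gen_map:
  assumes "ring_hom_cring PB PB h" "g \<in> vec_carrier PB k"
    and "\<And>a. a \<in> carrier B \<Longrightarrow> h (const_poly B a) = const_poly B a"
  shows "mat_map PB k h (gen row g) = gen row (\<lambda>i. h (g i))" and "orth row g \<Longrightarrow> orth row (\<lambda>i. h (g i))"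
proof -
  interpret h: ring_hom_cring PB PB h by fact
  have CD: "h (CB i) = CB i" "h (DB i) = DB i" if "i < k" for i
    using assms(3) vec_carrierD[OF cd(1) that] vec_carrierD[OF cd(2) that] by auto
  show "mat_map PB k h (gen row g) = gen row (\<lambda>i. h (g i))"
    unfolding gen_def using assms(2) CD by (auto simp: h.mat_map_transv intro!: h.R.transv_cong)
  have "dot PB k (\<lambda>i. h (g i)) DB = dot PB k (\<lambda>i. h (g i)) (\<lambda>i. h (DB i))"
    "dot PB k CB (\<lambda>i. h (g i)) = dot PB k (\<lambda>i. h (CB i)) (\<lambda>i. h (g i))"
    using assms(2) CD by (auto intro!: h.R.dot_cong)
  then show "orth row g \<Longrightarrow> orth row (\<lambda>i. h (g i))"
    unfolding orth_def using h.hom_dot[OF assms(2) CB_closed(2)] h.hom_dot[OF CB_closed(1) assms(2)]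
    by (auto split: if_splits)
qed

text \<open>With \<open>e = g(s Y) - g(0)\<close> the new generator at \<open>s Y\<close> is
  \<open>gen e\<close> times its value at \<open>0\<close>. This value is moved past
  \<open>\<tau>\<close> by conjugation, whose bound applies because \<open>t g(0)\<close> has no
  denominator. Asking for \<open>5M + 10\<close> in \<open>\<tau>\<close> leaves \<open>M\<close>
  after the conjugation.\<close>

lemma perturbable_mult_gen:
  assumes gv: "g \<in> vec_carrier PB k" and og: "orth row g" and Uc: "U \<in> mat_carrier PB k" and U: "perturbable U"
  shows "perturbable (mat_mult PB k (gen row g) U)"
proof -
  interpret PB: cring PB by (intro cring_UP S.is_cring)
  interpret pc: ring_hom_cring PB PB "\<lambda>p. const_poly B (p 0)" by (rule S.const_zero_coeff_hom)
  have gen_closed [simp]: "gen row v \<in> mat_carrier PB k" if "v \<in> vec_carrier PB k" for v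
    using that by (simp add: gen_def)
  obtain t0 where t0: "t0 \<in> D" and "\<forall>t\<in>D. t0 divides\<^bsub>A\<^esub> t \<longrightarrow> c j divides\<^bsub>A\<^esub> t \<longrightarrow> d j divides\<^bsub>A\<^esub> t \<longrightarrow>
    (\<forall>M. \<exists>N. \<forall>s\<in>carrier A. t [^] (N::nat) divides\<^bsub>A\<^esub> s \<longrightarrow>
      (\<exists>\<tau>\<in>ET PB k CB DB (frac_ideal t M).
        mat_map PB k (scale B (f s)) U = mat_mult PB k \<tau> (mat_map PB k (\<lambda>p. const_poly B (p 0)) U)))"
    by (rule bexE[OF U[unfolded perturbable_def]])
  note IH = this(2)[rule_format]
  obtain s1 where s1: "s1 \<in> D" and "\<forall>t\<in>carrier A. s1 divides\<^bsub>A\<^esub> t \<longrightarrow> (\<forall>M. \<forall>s\<in>carrier A. t [^] Suc M divides\<^bsub>A\<^esub> s \<longrightarrow>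
     (\<forall>i<k. const_poly B (f t) \<otimes>\<^bsub>PB\<^esub> const_poly B (g i 0) \<in> F ` carrier PA \<and>
        (\<exists>e\<in>carrier PA. scale B (f s) (g i) \<ominus>\<^bsub>PB\<^esub> const_poly B (g i 0) = const_poly B (f t) [^]\<^bsub>PB\<^esub> M \<otimes>\<^bsub>PB\<^esub> F e)))"
    by (rule bexE[OF perturbation_vec[OF gv]])
  note vec = this(2)[rule_format]
  show ?thesis
    unfolding perturbable_def
  proof (intro bexI[of _ "t0 \<otimes> s1"] ballI impI allI)
    show "t0 \<otimes> s1 \<in> D" using t0 s1 D_mult by blast
    fix t M assume t: "t \<in> D" "t0 \<otimes> s1 divides\<^bsub>A\<^esub> t" "c j divides\<^bsub>A\<^esub> t" "d j divides\<^bsub>A\<^esub> t"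
    obtain tc td where "denominators PB (F ` carrier PA) (const_poly B (f t)) k CB DB j tc td"
      using denominators_PB[OF t(1,3,4)] by blast
    then interpret den: denominators PB "F ` carrier PA" "const_poly B (f t)" k CB DB j tc td .
    have tt: "t0 divides\<^bsub>A\<^esub> t" "s1 divides\<^bsub>A\<^esub> t" using R.mult_dividesD[OF _ _ t(2)] t0 s1 by auto
    obtain N where N: "\<forall>s\<in>carrier A. t [^] (N::nat) divides\<^bsub>A\<^esub> s \<longrightarrow>
      (\<exists>\<tau>\<in>ET PB k CB DB (frac_ideal t (5 * M + 10)).
        mat_map PB k (scale B (f s)) U = mat_mult PB k \<tau> (mat_map PB k (\<lambda>p. const_poly B (p 0)) U))"
      using IH[OF t(1) tt(1) t(3,4), of "5 * M + 10"] by (rule exE)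
    show "\<exists>N. \<forall>s\<in>carrier A. t [^] (N::nat) divides\<^bsub>A\<^esub> s \<longrightarrow>
      (\<exists>\<tau>\<in>ET PB k CB DB (frac_ideal t M). mat_map PB k (scale B (f s)) (mat_mult PB k (gen row g) U)
        = mat_mult PB k \<tau> (mat_map PB k (\<lambda>p. const_poly B (p 0)) (mat_mult PB k (gen row g) U)))"
    \<comment> \<open>The power \<open>N\<close> is needed for \<open>U\<close>, and the power
      \<open>M + 1\<close> makes \<open>e\<close> divisible by \<open>t^M\<close>.\<close>
    proof (intro exI[of _ "N + Suc M"] ballI impI)
      fix s assume s: "s \<in> carrier A" "t [^] (N + Suc M) divides\<^bsub>A\<^esub> s"
      interpret sc: ring_hom_cring PB PB "scale B (f s)" using s by (intro S.scale_hom) simp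
      have ss: "t [^] N divides\<^bsub>A\<^esub> s" "t [^] Suc M divides\<^bsub>A\<^esub> s"
        using R.mult_dividesD[OF _ _ s(2)[unfolded R.nat_pow_mult[OF D_closed[OF t(1)], symmetric]]] D_closed[OF t(1)] by auto
      obtain \<tau> where \<tau>: "\<tau> \<in> ET PB k CB DB (frac_ideal t (5 * M + 10))"
        "mat_map PB k (scale B (f s)) U = mat_mult PB k \<tau> (mat_map PB k (\<lambda>p. const_poly B (p 0)) U)"
        by (rule bexE[OF N[rule_format, OF s(1) ss(1)]])
      define g' g0 e where "g' = (\<lambda>i. scale B (f s) (g i))" and "g0 = (\<lambda>i. const_poly B (g i 0))"
        and "e = (\<lambda>i. g' i \<ominus>\<^bsub>PB\<^esub> g0 i)"
      have v: "g' \<in> vec_carrier PB k" "g0 \<in> vec_carrier PB k" "e \<in> vec_carrier PB k"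
        unfolding g'_def g0_def e_def using sc.hom_vec_closed[OF gv] pc.hom_vec_closed[OF gv] by auto
      have sc_const: "scale B (f s) (const_poly B a) = const_poly B a" if "a \<in> carrier B" for a
        using that s by (simp add: S.scale_const)
      have pc_const: "const_poly B (const_poly B a 0) = const_poly B a" if "a \<in> carrier B" for a
        using that by (simp add: S.const_poly_apply)
      note mg' = gen_map[OF sc.ring_hom_cring_axioms gv sc_const, folded g'_def]
        and mg0 = gen_map[OF pc.ring_hom_cring_axioms gv pc_const, folded g0_def]
      have o: "orth row g'" "orth row g0" using mg'(2) mg0(2) og by auto
      then have oe: "orth row e" unfolding orth_def e_def using v
        by (auto simp: PB.dot_minus_left PB.dot_minus_right split: if_splits)
      let ?G = "gen row g0" and ?G' = "gen row (\<lambda>i. \<ominus>\<^bsub>PB\<^esub> g0 i)"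
      let ?U0 = "mat_map PB k (\<lambda>p. const_poly B (p 0)) U"
      have sm: "mat_map PB k (scale B (f s)) (mat_mult PB k (gen row g) U) = mat_mult PB k (gen row g') (mat_mult PB k \<tau> ?U0)"
        using gv Uc \<tau>(2) by (simp add: sc.mat_map_mult mg'(1))
      have pm: "mat_map PB k (\<lambda>p. const_poly B (p 0)) (mat_mult PB k (gen row g) U) = mat_mult PB k ?G ?U0"
        using gv Uc by (simp add: pc.mat_map_mult mg0(1))
      have \<tau>c: "\<tau> \<in> mat_carrier PB k" using PB.ET_closed[OF CB_closed den.J_subset \<tau>(1)] .
      have "g' i = e i \<oplus>\<^bsub>PB\<^esub> g0 i" if "i < k" for i
        using vec_carrierD[OF v(1) that] vec_carrierD[OF v(2) that]
        by (simp add: e_def a_minus_def PB.a_assoc PB.l_neg)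
      then have "gen row g' = gen row (\<lambda>i. e i \<oplus>\<^bsub>PB\<^esub> g0 i)" by (auto simp: gen_def intro!: PB.transv_cong)
      also have "\<dots> = mat_mult PB k (gen row e) ?G"
        using v o oe by (auto simp: gen_def orth_def PB.transv_mult_same_left PB.transv_mult_same_right)
      finally have split: "gen row g' = mat_mult PB k (gen row e) ?G" .
      have G'G: "mat_mult PB k ?G' ?G = mat_one PB k"
        using v o by (auto simp: gen_def orth_def PB.transv_uminus_right[symmetric] PB.transv_inverse split: if_splits)
      have eq: "mat_mult PB k (gen row g') (mat_mult PB k \<tau> ?U0)
         = mat_mult PB k (mat_mult PB k (gen row e) (mat_mult PB k (mat_mult PB k ?G \<tau>) ?G')) (mat_mult PB k ?G ?U0)"
        unfolding split using v \<tau>c Uc G'G by (intro PB.perturb_mult) auto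
      have eJ: "e i \<in> frac_ideal t M" if i: "i < k" for i
      proof -
        have "\<exists>x\<in>carrier PA. e i = const_poly B (f t) [^]\<^bsub>PB\<^esub> M \<otimes>\<^bsub>PB\<^esub> F x"
          using vec[OF D_closed[OF t(1)] tt(2) s(1) ss(2) i] unfolding e_def g'_def g0_def by blast
        then show ?thesis unfolding pow_multiples_def by blast
      qed
      have "gen row e \<in> ET PB k CB DB (frac_ideal t M)"
        using oe eJ PB.transv_row_ET[OF CB_closed den.J_subset] PB.transv_col_ET[OF CB_closed den.J_subset]
        by (auto simp: gen_def orth_def)
      moreover have tg0: "const_poly B (f t) \<otimes>\<^bsub>PB\<^esub> g0 i \<in> F ` carrier PA" if "i < k" for i
        using vec[OF D_closed[OF t(1)] tt(2) s(1) ss(2) that] by (simp add: g0_def)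
      have "mat_mult PB k (mat_mult PB k ?G \<tau>) ?G' \<in> ET PB k CB DB (frac_ideal t M)"
        using v o den.conj_row_ET[OF v(2) _ tg0 \<tau>(1)] den.conj_col_ET[OF v(2) _ tg0 \<tau>(1)]
        by (auto simp: gen_def orth_def)
      ultimately show "\<exists>\<tau>\<in>ET PB k CB DB (frac_ideal t M). mat_map PB k (scale B (f s)) (mat_mult PB k (gen row g) U)
        = mat_mult PB k \<tau> (mat_map PB k (\<lambda>p. const_poly B (p 0)) (mat_mult PB k (gen row g) U))"
        unfolding sm pm eq using PB.ET_mult[OF CB_closed den.J_subset] by blast
    qed
  qed
qed

lemma perturbation:
  assumes U: "U \<in> ET PB k CB DB (carrier PB)"
  shows "perturbable U"
proof -
  interpret PB: cring PB by (intro cring_UP S.is_cring)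
  note closed = PB.ET_closed[OF CB_closed subset_refl]
  show ?thesis using U
  proof (induction rule: ET.induct)
    case ET_one
    have "mat_map PB k (scale B (f s)) (mat_one PB k) = mat_one PB k" if "s \<in> carrier A" for s
      using ring_hom_cring.mat_map_one[OF S.scale_hom] that by simp
    moreover have "mat_map PB k (\<lambda>p. const_poly B (p 0)) (mat_one PB k) = mat_one PB k"
      using ring_hom_cring.mat_map_one[OF S.const_zero_coeff_hom] by simp
    ultimately show ?case using D_one
      by (auto simp: perturbable_def intro!: bexI[of _ "mat_one PB k"] ET.ET_one bexI[of _ \<one>])
  next
    case (ET_row g U)
    then show ?case using perturbable_mult_gen[of g True U] closed[OF ET_row(3)]
      by (simp add: vec_carrier_def gen_def orth_def)
  next
    case (ET_col g U)
    then show ?case using perturbable_mult_gen[of g False U] closed[OF ET_col(3)]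
      by (simp add: vec_carrier_def gen_def orth_def)
  qed
qed

text \<open>Over the localization the perturbation statement supplies a factor without denominators,
  which lifts. The lifted equation holds only up to the kernel of the localization map, so a second
  dilation has to remove the error.\<close>

lemma dilation:
  assumes \<Theta>: "\<Theta> \<in> mat_carrier PA k" "mat_map PB k F \<Theta> \<in> ET PB k CB DB (carrier PB)"
  shows "\<exists>s\<in>D. \<exists>V\<in>ET PA k CA DA (carrier PA).
    mat_map PA k (scale A s) \<Theta> = mat_mult PA k V (mat_map PA k (\<lambda>p. const_poly A (p 0)) \<Theta>)"
proof -
  interpret P: localization PA PB F "const_poly A ` D" by (rule localization_UP)
  interpret pA: ring_hom_cring PA PA "\<lambda>p. const_poly A (p 0)" by (rule R.const_zero_coeff_hom)
  interpret pB: ring_hom_cring PB PB "\<lambda>p. const_poly B (p 0)" by (rule S.const_zero_coeff_hom)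
  define pcA where "pcA = mat_map PA k (\<lambda>p. const_poly A (p (0::nat)))"
  define pcB where "pcB = mat_map PB k (\<lambda>p. const_poly B (p (0::nat)))"
  define FF where "FF = mat_map PB k F"
  have pcA_mult: "pcA (mat_mult PA k M N) = mat_mult PA k (pcA M) (pcA N)" if "M \<in> mat_carrier PA k" "N \<in> mat_carrier PA k" for M N
    using that by (simp add: pcA_def pA.mat_map_mult)
  have pcB_mult: "pcB (mat_mult PB k M N) = mat_mult PB k (pcB M) (pcB N)" if "M \<in> mat_carrier PB k" "N \<in> mat_carrier PB k" for M N
    using that by (simp add: pcB_def pB.mat_map_mult)
  have FF_mult: "FF (mat_mult PA k M N) = mat_mult PB k (FF M) (FF N)" if "M \<in> mat_carrier PA k" "N \<in> mat_carrier PA k" for M N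
    using that by (simp add: FF_def P.mat_map_mult)
  have cl [simp]: "pcA M \<in> mat_carrier PA k" "FF M \<in> mat_carrier PB k" if "M \<in> mat_carrier PA k" for M
    using that by (auto simp: pcA_def FF_def)
  have clB [simp]: "pcB M \<in> mat_carrier PB k" if "M \<in> mat_carrier PB k" for M using that by (simp add: pcB_def)
  have one: "pcA (mat_one PA k) = mat_one PA k" "pcB (mat_one PB k) = mat_one PB k" "FF (mat_one PA k) = mat_one PB k"
    by (simp_all add: pcA_def pcB_def FF_def)
  have FpcA: "FF (pcA M) = pcB (FF M)" if "M \<in> mat_carrier PA k" for M
    unfolding pcA_def pcB_def FF_def mat_map_mat_map
    by (rule mat_map_cong[OF that]) (simp add: UP_map_const, simp add: UP_map_def)
  have pcA_idem: "pcA (pcA M) = pcA M" if "M \<in> mat_carrier PA k" for M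
    unfolding pcA_def mat_map_mat_map by (rule mat_map_cong[OF that]) (simp add: R.const_poly_apply)
  define U where "U = FF \<Theta>"
  have U: "U \<in> ET PB k CB DB (carrier PB)" "U \<in> mat_carrier PB k" using \<Theta> by (auto simp: U_def FF_def)
  obtain t0 where t0: "t0 \<in> D" and "\<forall>t\<in>D. t0 divides\<^bsub>A\<^esub> t \<longrightarrow> c j divides\<^bsub>A\<^esub> t \<longrightarrow> d j divides\<^bsub>A\<^esub> t \<longrightarrow>
    (\<forall>M. \<exists>N. \<forall>s\<in>carrier A. t [^] (N::nat) divides\<^bsub>A\<^esub> s \<longrightarrow>
      (\<exists>\<tau>\<in>ET PB k CB DB (frac_ideal t M). mat_map PB k (scale B (f s)) U = mat_mult PB k \<tau> (mat_map PB k (\<lambda>p. const_poly B (p 0)) U)))"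
    by (rule bexE[OF perturbation[OF U(1), unfolded perturbable_def]])
  note pert = this(2)[rule_format]
  \<comment> \<open>The product is a common multiple of the three elements that still lies in
    \<open>D\<close>.\<close>
  define t where "t = t0 \<otimes> c j \<otimes> d j"
  have t: "t \<in> D" unfolding t_def using t0 j D_mult by blast
  have div: "t divides\<^bsub>A\<^esub> t" using t by (intro R.divides_refl) simp
  then have div2: "t0 \<otimes> c j divides\<^bsub>A\<^esub> t" "d j divides\<^bsub>A\<^esub> t"
    using R.mult_dividesD[of "t0 \<otimes> c j" "d j" t] t0 j by (auto simp: t_def)
  then have div3: "t0 divides\<^bsub>A\<^esub> t" "c j divides\<^bsub>A\<^esub> t"
    using R.mult_dividesD[of t0 "c j" t] t0 j by auto
  \<comment> \<open>Exponent \<open>0\<close> is enough here: divisibility served the induction,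
    whereas lifting only requires parameters in the image of \<open>A[Y]\<close>.\<close>
  obtain N where N: "\<forall>s\<in>carrier A. t [^] (N::nat) divides\<^bsub>A\<^esub> s \<longrightarrow>
      (\<exists>\<tau>\<in>ET PB k CB DB (frac_ideal t 0). mat_map PB k (scale B (f s)) U = mat_mult PB k \<tau> (mat_map PB k (\<lambda>p. const_poly B (p 0)) U))"
    using pert[OF t div3 div2(2), of 0] by (rule exE)
  define s0 where "s0 = t [^] N"
  have s0: "s0 \<in> D" unfolding s0_def using t D_one D_mult by (induction N) auto
  interpret sA: ring_hom_cring PA PA "scale A s0" using s0 by (intro R.scale_hom) simp
  interpret sB: ring_hom_cring PB PB "scale B (f s0)" using s0 by (intro S.scale_hom) simp
  have "t [^] N divides\<^bsub>A\<^esub> s0" unfolding s0_def using t by (intro R.divides_refl) simp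
  then obtain \<tau> where \<tau>: "\<tau> \<in> ET PB k CB DB (frac_ideal t 0)" "mat_map PB k (scale B (f s0)) U = mat_mult PB k \<tau> (pcB U)"
    unfolding pcB_def using N s0 D_closed by blast
  have "frac_ideal t 0 = F ` carrier PA"
    unfolding pow_multiples_def image_image using t by (intro image_cong) auto
  then have "\<tau> \<in> ET PB k CB DB (F ` carrier PA)" using \<tau>(1) by simp
  then have "\<tau> \<in> ET PB k (\<lambda>i. F (CA i)) (\<lambda>i. F (DA i)) (F ` carrier PA)"
    by (rule P.S.ET_cong) (auto simp: F_CA)
  then obtain \<tau>0 where \<tau>0: "\<tau>0 \<in> ET PA k CA DA (carrier PA)" "FF \<tau>0 = \<tau>"
    unfolding FF_def by (rule bexE[OF P.lift_ET[OF CA_closed dot_CA]])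
  note ETA = P.R.ET_closed[OF CA_closed subset_refl]
  have \<tau>0c: "\<tau>0 \<in> mat_carrier PA k" using ETA[OF \<tau>0(1)] .
  have \<tau>c: "\<tau> \<in> mat_carrier PB k" using \<tau>0 \<tau>0c by auto
  obtain U' where U': "U' \<in> mat_carrier PB k" "mat_mult PB k U U' = mat_one PB k"
    using P.S.ET_inverse[OF CB_closed subset_refl U(1)] P.S.ET_closed[OF CB_closed subset_refl] by blast
  \<comment> \<open>At \<open>0\<close> the two sides read \<open>U(0)\<close> and
    \<open>\<tau>(0) U(0)\<close>, and \<open>U(0)\<close> is invertible.\<close>
  have pc\<tau>: "pcB \<tau> = mat_one PB k"
  proof -
    have "pcB (mat_map PB k (scale B (f s0)) U) = pcB U"
      unfolding pcB_def mat_map_mat_map by (rule mat_map_cong[OF U(2)]) (use s0 in \<open>simp add: S.scale_zero_coeff\<close>)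
    moreover have "pcB (pcB U) = pcB U"
      unfolding pcB_def mat_map_mat_map by (rule mat_map_cong[OF U(2)]) (simp add: S.const_poly_apply)
    ultimately have "mat_mult PB k (pcB \<tau>) (pcB U) = pcB U" using \<tau>(2) \<tau>c U by (simp add: pcB_mult)
    then have "mat_mult PB k (mat_mult PB k (pcB \<tau>) (pcB U)) (pcB U') = mat_mult PB k (pcB U) (pcB U')" by simp
    moreover have "mat_mult PB k (pcB U) (pcB U') = mat_one PB k" using U U' pcB_mult[of U U'] one by simp
    ultimately show ?thesis using \<tau>c U U' by (simp add: P.S.mat_mult_assoc)
  qed
  have pcET: "pcA \<tau>0 \<in> ET PA k CA DA (carrier PA)"
    unfolding pcA_def using vec_carrierD[OF cd(1)] vec_carrierD[OF cd(2)]
    by (intro pA.mat_map_ET_carrier[OF \<tau>0(1)]) (auto simp: R.const_poly_apply)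
  \<comment> \<open>Dividing by the value at 0 makes both sides agree at 0; their difference then only involves
    positive powers of the variable and dies after one more scaling by a denominator \<open>u\<close>.\<close>
  obtain W where W: "W \<in> ET PA k CA DA (carrier PA)" "mat_mult PA k (pcA \<tau>0) W = mat_one PA k" "mat_mult PA k W (pcA \<tau>0) = mat_one PA k"
    using P.R.ET_inverse[OF CA_closed subset_refl pcET] by auto
  note Wc = ETA[OF W(1)]
  define V0 where "V0 = mat_mult PA k \<tau>0 W"
  have V0: "V0 \<in> ET PA k CA DA (carrier PA)" unfolding V0_def by (rule P.R.ET_mult[OF CA_closed subset_refl \<tau>0(1) W(1)])
  note V0c = ETA[OF V0]
  \<comment> \<open>Over the localization the normalizing factor \<open>W\<close> is trivial because
    \<open>\<tau>(0) = 1\<close>, so \<open>V0\<close> still maps to \<open>\<tau>\<close>.\<close>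
  have "FF (pcA \<tau>0) = mat_one PB k" using FpcA[OF \<tau>0c] \<tau>0 pc\<tau> by simp
  then have "FF W = mat_one PB k" using FF_mult[of W "pcA \<tau>0"] W Wc \<tau>0c one by simp
  then have FV0: "FF V0 = \<tau>" unfolding V0_def using FF_mult[OF \<tau>0c Wc] \<tau>0 \<tau>c by simp
  have pV0: "pcA V0 = mat_one PA k"
  proof -
    have "pcA V0 = mat_mult PA k (pcA (pcA \<tau>0)) (pcA W)" unfolding V0_def using pcA_mult \<tau>0c Wc pcA_idem by simp
    also have "\<dots> = pcA (mat_mult PA k (pcA \<tau>0) W)" using pcA_mult \<tau>0c Wc by simp
    finally show ?thesis using W one by simp
  qed
  define p q where "p = mat_map PA k (scale A s0) \<Theta>" and "q = mat_mult PA k V0 (pcA \<Theta>)"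
  have pq: "p \<in> mat_carrier PA k" "q \<in> mat_carrier PA k" unfolding p_def q_def using \<Theta> V0c by auto
  have "FF p = mat_map PB k (scale B (f s0)) U"
    unfolding p_def FF_def U_def mat_map_mat_map by (rule mat_map_cong[OF \<Theta>(1)]) (use s0 in \<open>simp add: UP_map_scale\<close>)
  also have "\<dots> = FF q" unfolding q_def \<tau>(2) using FF_mult[OF V0c] \<Theta> FpcA FV0 by (simp add: U_def)
  finally have Fpq: "FF p = FF q" .
  have "pcA p = pcA \<Theta>"
    unfolding p_def pcA_def mat_map_mat_map by (rule mat_map_cong[OF \<Theta>(1)]) (use s0 in \<open>simp add: R.scale_zero_coeff\<close>)
  also have "\<dots> = pcA q" unfolding q_def using pcA_mult[OF V0c] pcA_idem pV0 \<Theta> by simp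
  finally have ppq: "pcA p = pcA q" .
  let ?x = "\<lambda>(a, b). p a b \<ominus>\<^bsub>PA\<^esub> q a b"
  have Fx: "F (?x z) = \<zero>\<^bsub>PB\<^esub>" if zk: "z \<in> {..<k} \<times> {..<k}" for z
  proof -
    obtain a b where z: "z = (a, b)" "a < k" "b < k" using zk by auto
    have "F (p a b) = F (q a b)" using fun_cong[OF fun_cong[OF Fpq, of a], of b] z by (simp add: FF_def mat_map_def)
    then show ?thesis using pq z by (simp add: a_minus_def P.S.r_neg)
  qed
  obtain u where u: "u \<in> D" "\<And>a b. a < k \<Longrightarrow> b < k \<Longrightarrow> const_poly A u \<otimes>\<^bsub>PA\<^esub> (p a b \<ominus>\<^bsub>PA\<^esub> q a b) = \<zero>\<^bsub>PA\<^esub>"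
    using P.common_annihilator[of "{..<k} \<times> {..<k}" ?x] Fx pq by auto
  interpret uA: ring_hom_cring PA PA "scale A u" using u by (intro R.scale_hom) simp
  have "scale A u (p a b) = scale A u (q a b)" if ab: "a < k" "b < k" for a b
  proof
    fix l
    have pc: "p a b l \<in> carrier A" "q a b l \<in> carrier A" "p a b \<in> carrier PA" "q a b \<in> carrier PA" using pq by auto
    show "scale A u (p a b) l = scale A u (q a b) l"
    proof (cases l)
      case 0
      have "const_poly A (p a b 0) = const_poly A (q a b 0)"
        using fun_cong[OF fun_cong[OF ppq, of a], of b] ab by (simp add: pcA_def mat_map_def)
      then have "p a b 0 = q a b 0" using R.const_poly_apply[OF R.UP_coeff_closed[OF pc(3)], of 0 0]
          R.const_poly_apply[OF R.UP_coeff_closed[OF pc(4)], of 0 0] by metis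
      then show ?thesis using 0 by (simp add: scale_def)
    next
      case (Suc l')
      have mn: "(p a b \<ominus>\<^bsub>PA\<^esub> q a b) l = p a b l \<ominus> q a b l"
      proof -
        have "p a b = (p a b \<ominus>\<^bsub>PA\<^esub> q a b) \<oplus>\<^bsub>PA\<^esub> q a b" using pc by (simp add: a_minus_def P.R.a_assoc P.R.l_neg)
        then have "p a b l = (p a b \<ominus>\<^bsub>PA\<^esub> q a b) l \<oplus> q a b l" using pc R.UP_add_apply[of "p a b \<ominus>\<^bsub>PA\<^esub> q a b" "q a b" l] by simp
        then show ?thesis using pc R.UP_coeff_closed[of "p a b \<ominus>\<^bsub>PA\<^esub> q a b" l]
          by (simp add: a_minus_def R.a_assoc R.r_neg)
      qed
      have "u \<otimes> (p a b \<ominus>\<^bsub>PA\<^esub> q a b) l = \<zero>"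
        using fun_cong[OF u(2)[OF ab], of l] u(1) pc by (simp add: R.const_mult_apply R.UP_zero_apply)
      then have "u \<otimes> p a b l \<ominus> u \<otimes> q a b l = \<zero>" unfolding mn using u(1) pc by (simp add: a_minus_def R.r_distr R.r_minus)
      then have "u \<otimes> p a b l = u \<otimes> q a b l" using u(1) pc by (simp add: R.r_right_minus_eq)
      then show ?thesis using Suc u(1) pc by (simp add: scale_def R.m_assoc)
    qed
  qed
  then have "mat_map PA k (scale A u) p = mat_map PA k (scale A u) q" by (auto simp: mat_map_def fun_eq_iff)
  moreover have "mat_map PA k (scale A u) p = mat_map PA k (scale A (u \<otimes> s0)) \<Theta>"
    unfolding p_def mat_map_mat_map by (rule mat_map_cong[OF \<Theta>(1)]) (use u s0 in \<open>simp add: R.scale_scale\<close>)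
  moreover have "mat_map PA k (scale A u) q = mat_mult PA k (mat_map PA k (scale A u) V0) (mat_map PA k (scale A u) (pcA \<Theta>))"
    unfolding q_def using V0c \<Theta> by (simp add: uA.mat_map_mult)
  moreover have "mat_map PA k (scale A u) (pcA \<Theta>) = pcA \<Theta>"
    unfolding pcA_def mat_map_mat_map by (rule mat_map_cong[OF \<Theta>(1)]) (use u in \<open>simp add: R.scale_const\<close>)
  moreover have "mat_map PA k (scale A u) V0 \<in> ET PA k CA DA (carrier PA)"
    using vec_carrierD[OF cd(1)] vec_carrierD[OF cd(2)] u(1)
    by (intro uA.mat_map_ET_carrier[OF V0]) (auto simp: R.scale_const)
  moreover have "u \<otimes> s0 \<in> D" using u s0 D_mult by blast
  ultimately show ?thesis unfolding pcA_def by metis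
qed

end
end

section \<open>The group of an alternating matrix\<close>

context cring
begin

text \<open>Separates the border of a matrix of size \<open>2n\<close> from its block of size
  \<open>2n - 1\<close>.\<close>

lemma dot_Suc:
  assumes "v \<in> vec_carrier R (Suc k)" "w \<in> vec_carrier R (Suc k)"
  shows "dot R (Suc k) v w = v 0 \<otimes> w 0 \<oplus> dot R k (\<lambda>i. v (Suc i)) (\<lambda>i. w (Suc i))"
proof -
  have vw: "v l \<otimes> w l \<in> carrier R" if "l < Suc k" for l using assms that by (simp add: vec_carrier_def)
  have "{..<Suc k} = insert 0 (Suc ` {..<k})" by (auto simp: lessThan_Suc_eq_insert_0)
  then have "dot R (Suc k) v w = (\<Oplus>l\<in>insert 0 (Suc ` {..<k}). v l \<otimes> w l)"
    unfolding dot_def by simp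
  also have "\<dots> = v 0 \<otimes> w 0 \<oplus> (\<Oplus>l\<in>Suc ` {..<k}. v l \<otimes> w l)"
    using vw by (intro finsum_insert) auto
  also have "(\<Oplus>l\<in>Suc ` {..<k}. v l \<otimes> w l) = (\<Oplus>l\<in>{..<k}. v (Suc l) \<otimes> w (Suc l))"
    using vw by (intro add.finprod_reindex) auto
  finally show ?thesis by (simp add: dot_def)
qed

lemma dot_mat_assoc:
  assumes "v \<in> vec_carrier R k" "w \<in> vec_carrier R k" "\<And>i j. i < k \<Longrightarrow> j < k \<Longrightarrow> M i j \<in> carrier R"
  shows "dot R k (\<lambda>j. dot R k v (\<lambda>l. M l j)) w = dot R k v (\<lambda>l. dot R k (M l) w)"
proof -
  have c: "v l \<in> carrier R" "w l \<in> carrier R" if "l < k" for l using assms that by (auto simp: vec_carrier_def)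
  have "dot R k (\<lambda>j. dot R k v (\<lambda>l. M l j)) w = (\<Oplus>j\<in>{..<k}. \<Oplus>l\<in>{..<k}. v l \<otimes> M l j \<otimes> w j)"
    unfolding dot_def using c assms(3) by (intro finsum_cong') (auto simp: Pi_def intro!: finsum_ldistr finsum_closed)
  also have "\<dots> = (\<Oplus>l\<in>{..<k}. \<Oplus>j\<in>{..<k}. v l \<otimes> M l j \<otimes> w j)"
    using c assms(3) by (intro finsum_swap) auto
  also have "\<dots> = (\<Oplus>l\<in>{..<k}. \<Oplus>j\<in>{..<k}. v l \<otimes> (M l j \<otimes> w j))"
    using c assms(3) by (intro finsum_cong' finsum_closed) (auto simp: m_assoc intro!: finsum_cong')
  also have "\<dots> = dot R k v (\<lambda>l. dot R k (M l) w)"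
    unfolding dot_def using c assms(3)
    by (intro finsum_cong') (auto simp: Pi_def intro!: finsum_rdistr[symmetric] finsum_closed)
  finally show ?thesis .
qed

lemma mat_inv_eq:
  assumes "M \<in> mat_carrier R N" "P \<in> mat_carrier R N"
    "mat_mult R N M P = mat_one R N" "mat_mult R N P M = mat_one R N"
  shows "mat_inv R N M = P"
  unfolding mat_inv_def using assms
  by (intro Group.monoid.inv_unique'[OF monoid_mat_monoid, symmetric]) (auto simp: mat_monoid_def)

lemma GL_carrierI:
  assumes "M \<in> mat_carrier R k" "P \<in> mat_carrier R k"
    "mat_mult R k M P = mat_one R k" "mat_mult R k P M = mat_one R k"
  shows "M \<in> carrier (GL R k)"
  using assms by (auto simp: GL_def units_of_carrier Units_def mat_monoid_def)

lemma GL_simps: "monoid.mult (GL R k) = mat_mult R k" "monoid.one (GL R k) = mat_one R k"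
  by (simp_all add: GL_def units_of_mult units_of_one mat_monoid_def)

lemma group_GL: "group (GL R k)"
  unfolding GL_def by (rule Group.monoid.units_group[OF monoid_mat_monoid])

text \<open>The blocks of \<open>\<phi> \<psi> = 1 = \<psi> \<phi>\<close> give
  \<open>c . d = 1\<close>, \<open>c \<mu> = 0\<close>, \<open>\<nu> d^t = 0\<close> and
  \<open>d^t c + \<mu> \<nu> = 1\<close>. So \<open>v \<nu>\<close> always kills \<open>d\<close>,
  and conversely a row \<open>g\<close> that kills \<open>d\<close> satisfies
  \<open>g = g (d^t c + \<mu> \<nu>) = (g \<mu>) \<nu>\<close>. The columns \<open>\<mu> v^t\<close>
  are treated in the same way, and \<open>\<phi>\<close> disappears from the description of the
  generators.\<close>

lemma E_phi_eq_ET: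
  fixes n \<phi> \<psi>
  defines "k \<equiv> 2*n - 1" and "c \<equiv> \<lambda>i. \<ominus> \<phi> 0 (Suc i)" and "d \<equiv> \<lambda>i. \<psi> 0 (Suc i)"
  assumes n: "n \<ge> 2" and \<phi>: "\<phi> \<in> mat_carrier R (2*n)" and \<psi>: "\<psi> \<in> mat_carrier R (2*n)"
    and inv: "mat_mult R (2*n) \<phi> \<psi> = mat_one R (2*n)" "mat_mult R (2*n) \<psi> \<phi> = mat_one R (2*n)"
    and zero: "\<phi> 0 0 = \<zero>" "\<psi> 0 0 = \<zero>"
    and skew: "\<And>i. i < 2*n \<Longrightarrow> \<phi> i 0 = \<ominus> \<phi> 0 i" "\<And>i. i < 2*n \<Longrightarrow> \<psi> i 0 = \<ominus> \<psi> 0 i"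
  shows "E_phi R n \<phi> = ET R k c d (carrier R)" and "dot R k c d = \<one>"
proof -
  have N: "2*n = Suc k" using n by (simp add: k_def)
  note \<phi> = \<phi>[unfolded N] and \<psi> = \<psi>[unfolded N] and inv = inv[unfolded N] and skew = skew[unfolded N]
  have mi: "mat_inv R (2*n) \<phi> = \<psi>" unfolding N using \<phi> \<psi> inv by (rule mat_inv_eq)
  have cv [simp]: "c \<in> vec_carrier R k" "d \<in> vec_carrier R k" using \<phi> \<psi> by (auto simp: c_def d_def vec_carrier_def)
  define \<nu> where "\<nu> = (\<lambda>i j. \<phi> (Suc i) (Suc j))"
  define \<mu> where "\<mu> = (\<lambda>i j. \<psi> (Suc i) (Suc j))"
  have cl [simp]: "\<nu> i j \<in> carrier R" "\<mu> i j \<in> carrier R" "c i \<in> carrier R" "d i \<in> carrier R" for i j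
    using \<phi> \<psi> by (auto simp: \<nu>_def \<mu>_def c_def d_def)
  have vecs [simp]: "\<nu> i \<in> vec_carrier R k" "\<mu> i \<in> vec_carrier R k" "(\<lambda>i. \<nu> i j) \<in> vec_carrier R k" "(\<lambda>i. \<mu> i j) \<in> vec_carrier R k" for i j
    by (auto simp: vec_carrier_def)
  have entry: "dot R (Suc k) (P i) (\<lambda>l. Q l j) = mat_one R (Suc k) i j" if "mat_mult R (Suc k) P Q = mat_one R (Suc k)" "i < Suc k" "j < Suc k" for P Q i j
    using that(2,3) fun_cong[OF fun_cong[OF that(1), of i], of j] by (simp add: mat_mult_dot)
  show dot_cd: "dot R k c d = \<one>"
  proof -
    have "dot R k c d = dot R k (\<lambda>i. \<phi> 0 (Suc i)) (\<lambda>i. \<psi> (Suc i) 0)"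
    proof -
      have "dot R k (\<lambda>i. \<phi> 0 (Suc i)) (\<lambda>i. \<psi> (Suc i) 0) = dot R k (\<lambda>i. \<ominus> c i) (\<lambda>i. \<ominus> d i)"
        using \<phi> \<psi> skew by (intro dot_cong) (auto simp: c_def d_def vec_carrier_def)
      then show ?thesis by (simp add: dot_uminus_left dot_uminus_right)
    qed
    also have "\<dots> = \<one>" using entry[OF inv(1), of 0 0] \<phi> \<psi> zero by (simp add: dot_Suc mat_one_def vec_carrier_def)
    finally show ?thesis .
  qed
  have c\<mu>: "dot R k c (\<lambda>l. \<mu> l j) = \<zero>" if j: "j < k" for j
  proof -
    have "dot R k (\<lambda>i. \<phi> 0 (Suc i)) (\<lambda>l. \<mu> l j) = \<zero>"
      using entry[OF inv(1), of 0 "Suc j"] j \<phi> \<psi> zero by (simp add: dot_Suc mat_one_def vec_carrier_def \<mu>_def)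
    then show ?thesis unfolding c_def using \<phi> by (simp add: dot_uminus_left vec_carrier_def)
  qed
  have \<nu>d: "dot R k (\<nu> i) d = \<zero>" if i: "i < k" for i
  proof -
    have "dot R k (\<nu> i) (\<lambda>l. \<psi> (Suc l) 0) = \<zero>"
      using entry[OF inv(1), of "Suc i" 0] i \<phi> \<psi> zero by (simp add: dot_Suc mat_one_def vec_carrier_def \<nu>_def)
    moreover have "dot R k (\<nu> i) (\<lambda>l. \<psi> (Suc l) 0) = dot R k (\<nu> i) (\<lambda>l. \<ominus> d l)"
      using \<psi> skew by (intro dot_cong) (auto simp: d_def vec_carrier_def)
    ultimately have "\<ominus> dot R k (\<nu> i) d = \<zero>" by (simp add: dot_uminus_right)
    then show ?thesis by (metis cv(2) dot_closed minus_minus minus_zero vecs(1))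
  qed
  have \<mu>\<nu>: "dot R k (\<mu> i) (\<lambda>l. \<nu> l j) = (if i = j then \<one> else \<zero>) \<ominus> d i \<otimes> c j" if ij: "i < k" "j < k" for i j
  proof -
    have "\<psi> (Suc i) 0 \<otimes> \<phi> 0 (Suc j) \<oplus> dot R k (\<mu> i) (\<lambda>l. \<nu> l j) = (if i = j then \<one> else \<zero>)"
      using entry[OF inv(2), of "Suc i" "Suc j"] ij \<phi> \<psi> by (simp add: dot_Suc mat_one_def vec_carrier_def \<nu>_def \<mu>_def)
    moreover have "\<psi> (Suc i) 0 \<otimes> \<phi> 0 (Suc j) = d i \<otimes> c j"
      using skew(2)[of "Suc i"] ij \<phi> \<psi> by (simp add: c_def d_def l_minus r_minus)
    ultimately have "d i \<otimes> c j \<oplus> dot R k (\<mu> i) (\<lambda>l. \<nu> l j) = (if i = j then \<one> else \<zero>)" by simp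
    moreover have "(d i \<otimes> c j \<oplus> dot R k (\<mu> i) (\<lambda>l. \<nu> l j)) \<ominus> d i \<otimes> c j = dot R k (\<mu> i) (\<lambda>l. \<nu> l j)"
      by (simp add: a_minus_def a_comm[of "d i \<otimes> c j"] a_assoc r_neg)
    ultimately show ?thesis by simp
  qed
  have alpha: "alpha_phi R n \<phi> v = transv R k d (\<lambda>j. dot R k v (\<lambda>l. \<nu> l j))" for v
    unfolding alpha_phi_def Let_def mi by (auto simp: transv_def outer_def dot_def d_def \<nu>_def k_def fun_eq_iff mat_one_def)
  have beta: "beta_phi R n \<phi> v = transv R k (\<lambda>i. dot R k (\<mu> i) v) c" for v
    unfolding beta_phi_def Let_def mi by (auto simp: transv_def outer_def dot_def c_def \<mu>_def k_def fun_eq_iff mat_one_def)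
  have aset: "{alpha_phi R n \<phi> v | v. v \<in> vec_carrier R k} = {transv R k d g | g. g \<in> vec_carrier R k \<and> dot R k g d = \<zero>}"
  proof (intro equalityI subsetI; clarify)
    fix v assume v: "v \<in> vec_carrier R k"
    let ?g = "\<lambda>j. dot R k v (\<lambda>l. \<nu> l j)"
    have "dot R k ?g d = dot R k v (\<lambda>l. dot R k (\<nu> l) d)" using v by (intro dot_mat_assoc) auto
    also have "\<dots> = \<zero>" using v \<nu>d unfolding dot_def[of R k v] by (intro add.finprod_one_eqI) (auto simp: vec_carrierD)
    finally show "\<exists>g. alpha_phi R n \<phi> v = transv R k d g \<and> g \<in> vec_carrier R k \<and> dot R k g d = \<zero>"
      unfolding alpha using v by (intro exI[of _ ?g]) (auto simp: vec_carrier_def intro!: dot_closed)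
  next
    fix g assume g: "g \<in> vec_carrier R k" "dot R k g d = \<zero>"
    let ?v = "\<lambda>l. dot R k g (\<lambda>i. \<mu> i l)"
    have gc: "g i \<in> carrier R" if "i < k" for i using g(1) that by (rule vec_carrierD)
    have vv: "?v \<in> vec_carrier R k" using g by (simp add: vec_carrier_def[of R k])
    have "dot R k ?v (\<lambda>l. \<nu> l j) = g j" if j: "j < k" for j
    proof -
      have "dot R k ?v (\<lambda>l. \<nu> l j) = dot R k g (\<lambda>i. dot R k (\<mu> i) (\<lambda>l. \<nu> l j))" using g by (intro dot_mat_assoc) auto
      also have "\<dots> = dot R k g (\<lambda>i. (if i = j then \<one> else \<zero>) \<ominus> d i \<otimes> c j)"
        using g j \<mu>\<nu> by (intro dot_cong) (auto simp: vec_carrier_def)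
      also have "\<dots> = dot R k g (\<lambda>i. if i = j then \<one> else \<zero>) \<ominus> dot R k g (\<lambda>i. c j \<otimes> d i)"
        using g by (subst dot_minus_right[symmetric]) (auto simp: vec_carrier_def m_comm)
      also have "\<dots> = g j" using g gc[OF j] j by (simp add: dot_smult_right dot_indicator a_minus_def)
      finally show ?thesis .
    qed
    then have "alpha_phi R n \<phi> ?v = transv R k d g" unfolding alpha by (intro transv_cong) auto
    then show "\<exists>v. transv R k d g = alpha_phi R n \<phi> v \<and> v \<in> vec_carrier R k" using vv by metis
  qed
  have bset: "{beta_phi R n \<phi> v | v. v \<in> vec_carrier R k} = {transv R k \<kappa> c | \<kappa>. \<kappa> \<in> vec_carrier R k \<and> dot R k c \<kappa> = \<zero>}"
  proof (intro equalityI subsetI; clarify)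
    fix v assume v: "v \<in> vec_carrier R k"
    let ?g = "\<lambda>i. dot R k (\<mu> i) v"
    have "dot R k c ?g = dot R k (\<lambda>j. dot R k c (\<lambda>l. \<mu> l j)) v" using v by (intro dot_mat_assoc[symmetric]) auto
    also have "\<dots> = \<zero>" using v c\<mu> unfolding dot_def[of R k _ v] by (intro add.finprod_one_eqI) (auto simp: vec_carrierD)
    finally show "\<exists>g. beta_phi R n \<phi> v = transv R k g c \<and> g \<in> vec_carrier R k \<and> dot R k c g = \<zero>"
      unfolding beta using v by (intro exI[of _ ?g]) (auto simp: vec_carrier_def intro!: dot_closed)
  next
    fix g assume g: "g \<in> vec_carrier R k" "dot R k c g = \<zero>"
    \<comment> \<open>The preimage is \<open>\<nu> g\<close>, since
      \<open>\<mu> \<nu> g = g - d (c . g)\<close> and \<open>c . g = 0\<close>.\<close>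
    let ?v = "\<lambda>l. dot R k (\<nu> l) g"
    have gc: "g i \<in> carrier R" if "i < k" for i using g(1) that by (rule vec_carrierD)
    have vv: "?v \<in> vec_carrier R k" using g by (simp add: vec_carrier_def[of R k])
    have "dot R k (\<mu> i) ?v = g i" if i: "i < k" for i
    proof -
      have "dot R k (\<mu> i) ?v = dot R k (\<lambda>j. dot R k (\<mu> i) (\<lambda>l. \<nu> l j)) g" using g by (intro dot_mat_assoc[symmetric]) auto
      also have "\<dots> = dot R k (\<lambda>j. (if j = i then \<one> else \<zero>) \<ominus> d i \<otimes> c j) g"
        using g i \<mu>\<nu> by (intro dot_cong) (auto simp: vec_carrier_def)
      also have "\<dots> = dot R k (\<lambda>j. if j = i then \<one> else \<zero>) g \<ominus> dot R k (\<lambda>j. d i \<otimes> c j) g"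
        using g by (subst dot_minus_left[symmetric]) (auto simp: vec_carrier_def)
      also have "\<dots> = g i" using g gc[OF i] i
        by (simp add: dot_smult_left dot_indicator dot_comm[of "\<lambda>j. if j = i then \<one> else \<zero>" k g] vec_carrier_def[of R k] a_minus_def)
      finally show ?thesis .
    qed
    then have "beta_phi R n \<phi> ?v = transv R k g c" unfolding beta by (intro transv_cong) auto
    then show "\<exists>v. transv R k g c = beta_phi R n \<phi> v \<and> v \<in> vec_carrier R k" using vv by metis
  qed
  define H where "H = {transv R k d g | g. g \<in> vec_carrier R k \<and> dot R k g d = \<zero>} \<union> {transv R k \<kappa> c | \<kappa>. \<kappa> \<in> vec_carrier R k \<and> dot R k c \<kappa> = \<zero>}"
  have E: "E_phi R n \<phi> = generate (GL R k) H" unfolding E_phi_def H_def k_def[symmetric] aset bset ..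
  have HET: "x \<in> ET R k c d (carrier R)" if "x \<in> H" for x
    using that unfolding H_def
    by (auto intro!: transv_row_ET[OF cv subset_refl] transv_col_ET[OF cv subset_refl] simp: vec_carrierD)
  note ETc = ET_closed[OF cv subset_refl]
  interpret G: group "GL R k" by (rule group_GL)
  show "E_phi R n \<phi> = ET R k c d (carrier R)"
  proof (intro equalityI subsetI)
    fix x assume "x \<in> E_phi R n \<phi>"
    then have "x \<in> generate (GL R k) H" by (simp add: E)
    then show "x \<in> ET R k c d (carrier R)"
    proof (induction rule: generate.induct)
      case one
      then show ?case by (simp add: GL_simps ET.ET_one)
    next
      case (incl h)
      then show ?case by (rule HET)
    next
      case (inv h)
      obtain h' where h': "h' \<in> ET R k c d (carrier R)" "mat_mult R k h h' = mat_one R k" "mat_mult R k h' h = mat_one R k"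
        using ET_inverse[OF cv subset_refl HET[OF inv]] by auto
      have "inv\<^bsub>GL R k\<^esub> h = h'"
        using h' ETc[OF HET[OF inv]] ETc[OF h'(1)]
        by (intro G.inv_equality) (auto simp: GL_simps intro: GL_carrierI)
      then show ?case using h' by simp
    next
      case (eng h1 h2)
      then show ?case using ET_mult[OF cv subset_refl] by (simp add: GL_simps)
    qed
  next
    fix x assume "x \<in> ET R k c d (carrier R)"
    then have "x \<in> generate (GL R k) H"
    proof (induction rule: ET.induct)
      case ET_one
      then show ?case using generate.one[of "GL R k" H] by (simp add: GL_simps)
    next
      case (ET_row g A)
      then have "transv R k d g \<in> H" by (auto simp: H_def vec_carrier_def)
      then show ?case using generate.eng[OF generate.incl ET_row(4)] by (simp add: GL_simps)
    next
      case (ET_col g A)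
      then have "transv R k g c \<in> H" by (auto simp: H_def vec_carrier_def)
      then show ?case using generate.eng[OF generate.incl ET_col(4)] by (simp add: GL_simps)
    qed
    then show "x \<in> E_phi R n \<phi>" by (simp add: E)
  qed
qed

text \<open>For \<open>A = \<nu> - \<nu>^t\<close> the two resulting scalars are transposes of each
  other, hence equal.\<close>

lemma alternating_form_zero:
  assumes A: "alternating R N A" and x: "x \<in> vec_carrier R N"
  shows "dot R N x (\<lambda>a. dot R N (A a) x) = \<zero>"
proof -
  obtain \<nu> where \<nu>: "\<nu> \<in> mat_carrier R N" "\<And>i j. i < N \<Longrightarrow> j < N \<Longrightarrow> A i j = \<nu> i j \<ominus> \<nu> j i"
    using A by (auto simp: alternating_def)
  have Ac: "A \<in> mat_carrier R N" using A by (simp add: alternating_def)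
  have mv: "(\<lambda>a. dot R N (M a) x) \<in> vec_carrier R N" if "\<And>a. M a \<in> vec_carrier R N" for M
    using that x by (simp add: vec_carrier_def[of R N])
  have row: "dot R N (A a) x = dot R N (\<nu> a) x \<ominus> dot R N (\<lambda>b. \<nu> b a) x" if a: "a < N" for a
  proof -
    have "dot R N (A a) x = dot R N (\<lambda>b. \<nu> a b \<ominus> \<nu> b a) x" using Ac x \<nu>(2)[OF a] by (intro dot_cong) auto
    then show ?thesis using \<nu>(1) x by (simp add: dot_minus_left)
  qed
  have "dot R N x (\<lambda>a. dot R N (A a) x) = dot R N x (\<lambda>a. dot R N (\<nu> a) x \<ominus> dot R N (\<lambda>b. \<nu> b a) x)"
    using Ac x row mv[of A] by (intro dot_cong) auto
  also have "\<dots> = dot R N x (\<lambda>a. dot R N (\<nu> a) x) \<ominus> dot R N x (\<lambda>a. dot R N (\<lambda>b. \<nu> b a) x)"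
    using \<nu>(1) x mv[of \<nu>] mv[of "\<lambda>a b. \<nu> b a"] by (intro dot_minus_right) auto
  also have "dot R N x (\<lambda>a. dot R N (\<lambda>b. \<nu> b a) x) = dot R N (\<lambda>j. dot R N x (\<nu> j)) x"
    using \<nu>(1) x by (intro dot_mat_assoc[symmetric]) auto
  also have "\<dots> = dot R N x (\<lambda>a. dot R N (\<nu> a) x)"
    using \<nu>(1) x mv[of \<nu>] by (simp add: dot_comm)
  finally show ?thesis using \<nu>(1) x mv[of \<nu>] by (simp add: a_minus_def r_neg)
qed

text \<open>Skew-symmetry alone gives \<open>2 Q i i = 0\<close>. Instead, \<open>Q = Q A Q\<close>
  shows that \<open>Q i i\<close> is minus the value of the alternating form \<open>A\<close> at row
  \<open>i\<close> of \<open>Q\<close>.\<close>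

lemma alternating_inverse_diag:
  assumes A: "alternating R N A" and Q: "Q \<in> mat_carrier R N" "\<And>i j. Q i j = \<ominus> Q j i"
    and inv: "mat_mult R N A Q = mat_one R N" and i: "i < N"
  shows "Q i i = \<zero>"
proof -
  have Ac: "A \<in> mat_carrier R N" using A by (simp add: alternating_def)
  have mv: "(\<lambda>a. dot R N (A a) w) \<in> vec_carrier R N" if "w \<in> vec_carrier R N" for w
    using that Ac by (simp add: vec_carrier_def[of R N])
  have Qi: "Q i \<in> vec_carrier R N" "(\<lambda>b. Q b i) \<in> vec_carrier R N" using Q(1) by auto
  have "Q i i = mat_mult R N Q (mat_mult R N A Q) i i" using Q(1) inv by simp
  also have "\<dots> = dot R N (Q i) (\<lambda>a. mat_mult R N A Q a i)" using i by (simp add: mat_mult_dot[of N Q])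
  also have "\<dots> = dot R N (Q i) (\<lambda>a. dot R N (A a) (\<lambda>b. Q b i))"
    by (rule dot_cong[OF Qi(1) mat_col_closed[OF mat_mult_closed[OF Ac Q(1)]]])
       (use i in \<open>simp_all add: mat_mult_dot\<close>)
  also have "\<dots> = dot R N (Q i) (\<lambda>a. \<ominus> dot R N (A a) (Q i))"
  proof (intro dot_cong)
    fix a
    have "dot R N (A a) (\<lambda>b. Q b i) = dot R N (A a) (\<lambda>b. \<ominus> Q i b)"
      using Ac Qi by (intro dot_cong Q(2)) auto
    then show "dot R N (A a) (\<lambda>b. Q b i) = \<ominus> dot R N (A a) (Q i)" using Ac Qi by (simp add: dot_uminus_right)
  qed (use Qi mv in auto)
  also have "\<dots> = \<zero>" using alternating_form_zero[OF A Qi(1)] Qi mv by (simp add: dot_uminus_right)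
  finally show ?thesis .
qed

end

section \<open>Patching\<close>

lemma (in cring) exists_maximalideal:
  assumes I: "ideal I R" "\<one> \<notin> I"
  shows "\<exists>m. maximalideal m R \<and> I \<subseteq> m"
proof -
  let ?A = "{J. ideal J R \<and> I \<subseteq> J \<and> \<one> \<notin> J}"
  have "\<exists>M\<in>?A. \<forall>J\<in>?A. M \<subseteq> J \<longrightarrow> J = M"
  proof (rule subset_Zorn_nonempty)
    show "?A \<noteq> {}" using I by auto
    fix C assume C: "C \<noteq> {}" "subset.chain ?A C"
    then have sub: "C \<subseteq> ?A" by (simp add: subset.chain_def)
    then have "subset.chain {J. ideal J R} C" using C by (auto simp: subset.chain_def)
    then have "ideal (\<Union>C) R" using chain_Union_is_ideal[of C] C by simp
    then show "\<Union>C \<in> ?A" using sub C(1) by fastforce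
  qed
  then obtain M where M: "ideal M R" "I \<subseteq> M" "\<one> \<notin> M" "\<And>J. ideal J R \<Longrightarrow> I \<subseteq> J \<Longrightarrow> \<one> \<notin> J \<Longrightarrow> M \<subseteq> J \<Longrightarrow> J = M"
    by auto
  have "maximalideal M R"
  proof (rule maximalidealI[OF M(1)])
    show "carrier R \<noteq> M" using M by auto
    fix J assume J: "ideal J R" "M \<subseteq> J" "J \<subseteq> carrier R"
    show "J = M \<or> J = carrier R"
      using M J ideal.one_imp_carrier[OF J(1)] by (cases "\<one> \<in> J") auto
  qed
  then show ?thesis using M by blast
qed

text \<open>Applied to \<open>c . d = 1\<close>, this supplies for each maximal ideal an index at
  which both vectors become units.\<close>

lemma (in cring) dot_not_in_ideal:
  assumes m: "ideal m R" and vw: "v \<in> vec_carrier R k" "w \<in> vec_carrier R k" "dot R k v w \<notin> m"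
  shows "\<exists>j<k. v j \<otimes> w j \<notin> m"
proof (rule ccontr)
  assume "\<not> ?thesis"
  then have all: "\<And>j. j < k \<Longrightarrow> v j \<otimes> w j \<in> m" by blast
  interpret ideal m R by fact
  have "(\<Oplus>l\<in>F. v l \<otimes> w l) \<in> m" if "finite F" "F \<subseteq> {..<k}" for F
    using that
  proof (induction F rule: finite_induct)
    case empty
    then show ?case by simp
  next
    case (insert x F)
    then have "(\<Oplus>l\<in>insert x F. v l \<otimes> w l) = v x \<otimes> w x \<oplus> (\<Oplus>l\<in>F. v l \<otimes> w l)"
      using vw by (intro finsum_insert) (auto simp: vec_carrier_def subset_iff)
    then show ?case using insert all[of x] by (auto intro!: a_closed)
  qed
  then show False using vw(3) by (auto simp: dot_def)
qed

section \<open>Substitutions in polynomials\<close>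

definition polyX :: "('a, 'm) ring_scheme \<Rightarrow> (nat \<Rightarrow> 'a)" where
  "polyX R = up_ring.monom (UP R) \<one>\<^bsub>R\<^esub> (Suc 0)"

definition poly_subst :: "('a, 'm) ring_scheme \<Rightarrow> ('b, 'n) ring_scheme \<Rightarrow> ('a \<Rightarrow> 'b) \<Rightarrow> 'b \<Rightarrow> (nat \<Rightarrow> 'a) \<Rightarrow> 'b" where
  "poly_subst R S h x = UnivPoly.eval R S h x"

text \<open>Uniqueness in the universal property: identities between composed substitutions need
  checking only on constants and on the variable.\<close>

lemma UP_hom_eq:
  assumes R: "cring R" and Phi: "ring_hom_cring (UP R) S \<Phi>" and Psi: "ring_hom_cring (UP R) S \<Psi>"
    and const_eq: "\<And>r. r \<in> carrier R \<Longrightarrow> \<Phi> (const_poly R r) = \<Psi> (const_poly R r)"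
    and var_eq: "\<Phi> (polyX R) = \<Psi> (polyX R)" and p: "p \<in> carrier (UP R)"
  shows "\<Phi> p = \<Psi> p"
proof -
  interpret R: cring R by fact
  interpret Phi: ring_hom_cring "UP R" S \<Phi> by fact
  have h: "(\<lambda>r. \<Phi> (const_poly R r)) \<in> ring_hom R S"
    using ring_hom_trans[OF R.const_poly_hom Phi.homh] by (simp add: comp_def)
  have X: "polyX R \<in> carrier (UP R)"
    unfolding polyX_def by (intro UP_ring.monom_closed UP_ring.intro R.ring_axioms R.one_closed)
  show ?thesis
    by (rule UP_pre_univ_prop.UP_hom_unique[OF UP_pre_univ_propI[OF R Phi.S.is_cring h] Phi _ _ Psi, of "\<Phi> (polyX R)"])
       (use Phi.hom_closed[OF X] var_eq const_eq p in \<open>auto simp: const_poly_def polyX_def\<close>)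
qed

context ring_hom_cring
begin

lemma poly_subst_hom: "x \<in> carrier S \<Longrightarrow> ring_hom_cring (UP R) S (poly_subst R S h x)"
  unfolding poly_subst_def
  by (intro ring_hom_cringI cring_UP R.is_cring S.is_cring
      UP_pre_univ_prop.eval_ring_hom[OF UP_pre_univ_propI[OF R.is_cring S.is_cring homh]])

lemma poly_subst_const: "x \<in> carrier S \<Longrightarrow> r \<in> carrier R \<Longrightarrow> poly_subst R S h x (const_poly R r) = h r"
  unfolding poly_subst_def const_poly_def
  by (rule UP_pre_univ_prop.eval_const[OF UP_pre_univ_propI[OF R.is_cring S.is_cring homh]])

lemma poly_subst_X: "x \<in> carrier S \<Longrightarrow> poly_subst R S h x (polyX R) = x"
  unfolding poly_subst_def polyX_def
  using UP_pre_univ_prop.eval_monom1[OF UP_pre_univ_propI[OF R.is_cring S.is_cring homh], of x] by simp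

end

lemma (in cring) polyX_closed [simp]: "polyX R \<in> carrier (UP R)"
  unfolding polyX_def by (intro UP_ring.monom_closed UP_ring.intro ring_axioms one_closed)

lemma (in cring) polyX_apply: "polyX R i = (if i = 1 then \<one> else \<zero>)"
  unfolding polyX_def by (simp add: UP_monom_apply)

lemma ring_hom_cring_comp:
  assumes "ring_hom_cring R S g" "ring_hom_cring S T h"
  shows "ring_hom_cring R T (\<lambda>x. h (g x))"
proof -
  interpret g: ring_hom_cring R S g by fact
  interpret h: ring_hom_cring S T h by fact
  show ?thesis using ring_hom_trans[OF g.homh h.homh]
    by (intro ring_hom_cringI g.R.is_cring h.S.is_cring) (simp add: comp_def)
qed

section \<open>The ideal of scalars for patching\<close>

context cring
begin

context
  fixes k c d \<theta>
  assumes cd [simp]: "c \<in> vec_carrier R k" "d \<in> vec_carrier R k" and dot_cd: "dot R k c d = \<one>" and k: "3 \<le> k"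
    and \<theta>: "\<theta> \<in> mat_carrier (UP R) k"
begin

abbreviation "P1 \<equiv> UP R"
abbreviation "P2 \<equiv> UP (UP R)"
abbreviation "c1 \<equiv> \<lambda>i. const_poly R (c i)"
abbreviation "d1 \<equiv> \<lambda>i. const_poly R (d i)"
abbreviation "ev x \<equiv> poly_subst R P1 (const_poly R) x"

text \<open>Freedom of \<open>x\<close> gives closure under sums: the step by \<open>b y\<close>
  starts at \<open>x + a y\<close>. Freedom of \<open>y\<close> gives closure under multiples, since
  \<open>y\<close> absorbs the factor.\<close>

definition patching_ideal :: "'a set" where
  "patching_ideal = {s \<in> carrier R. \<forall>x\<in>carrier P1. \<forall>y\<in>carrier P1. \<exists>V\<in>ET P1 k c1 d1 (carrier P1).
     mat_map P1 k (ev (x \<oplus>\<^bsub>P1\<^esub> const_poly R s \<otimes>\<^bsub>P1\<^esub> y)) \<theta> = mat_mult P1 k V (mat_map P1 k (ev x) \<theta>)}"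

lemma c1_closed [simp]: "c1 \<in> vec_carrier P1 k" "d1 \<in> vec_carrier P1 k"
  using ring_hom_cring.hom_vec_closed[OF const_hom] by auto

lemma at_closed: "x \<in> carrier P1 \<Longrightarrow> mat_map P1 k (ev x) \<theta> \<in> mat_carrier P1 k"
  by (rule ring_hom_cring.mat_map_closed[OF ring_hom_cring.poly_subst_hom[OF const_hom] \<theta>])

lemma ideal_patching_ideal: "ideal patching_ideal R"
proof (rule idealI)
  interpret P1: cring P1 by (rule cring_UP[OF is_cring])
  interpret C: ring_hom_cring R P1 "const_poly R" by (rule const_hom)
  show "ring R" by (rule ring_axioms)
  note ETm = P1.ET_mult[OF c1_closed subset_refl]
  note ETc = P1.ET_closed[OF c1_closed subset_refl]
  have smult: "a \<otimes> x \<in> patching_ideal" if a: "a \<in> patching_ideal" and x: "x \<in> carrier R" for a x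
  proof -
    have ac: "a \<in> carrier R" using a by (simp add: patching_ideal_def)
    have "const_poly R (a \<otimes> x) \<otimes>\<^bsub>P1\<^esub> y = const_poly R a \<otimes>\<^bsub>P1\<^esub> (const_poly R x \<otimes>\<^bsub>P1\<^esub> y)" if "y \<in> carrier P1" for y
      using that ac x by (simp add: P1.m_assoc)
    then show ?thesis using a x ac unfolding patching_ideal_def by simp
  qed
  show "x \<otimes> a \<in> patching_ideal" "a \<otimes> x \<in> patching_ideal" if "a \<in> patching_ideal" "x \<in> carrier R" for a x
    using smult[OF that] m_comm[of x a] that by (auto simp: patching_ideal_def)
  have add: "a \<oplus> b \<in> patching_ideal" if a: "a \<in> patching_ideal" and b: "b \<in> patching_ideal" for a b
  proof -
    have ab: "a \<in> carrier R" "b \<in> carrier R" using a b by (simp_all add: patching_ideal_def)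
    have "\<exists>V\<in>ET P1 k c1 d1 (carrier P1).
      mat_map P1 k (ev (x \<oplus>\<^bsub>P1\<^esub> const_poly R (a \<oplus> b) \<otimes>\<^bsub>P1\<^esub> y)) \<theta> = mat_mult P1 k V (mat_map P1 k (ev x) \<theta>)"
      if xy: "x \<in> carrier P1" "y \<in> carrier P1" for x y
    proof -
      define x' where "x' = x \<oplus>\<^bsub>P1\<^esub> const_poly R a \<otimes>\<^bsub>P1\<^esub> y"
      have x': "x' \<in> carrier P1" using xy ab by (simp add: x'_def)
      have e: "x \<oplus>\<^bsub>P1\<^esub> const_poly R (a \<oplus> b) \<otimes>\<^bsub>P1\<^esub> y = x' \<oplus>\<^bsub>P1\<^esub> const_poly R b \<otimes>\<^bsub>P1\<^esub> y"
        using xy ab by (simp add: x'_def P1.l_distr P1.a_assoc)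
      obtain V where V: "V \<in> ET P1 k c1 d1 (carrier P1)" "mat_map P1 k (ev x') \<theta> = mat_mult P1 k V (mat_map P1 k (ev x) \<theta>)"
        using a xy unfolding patching_ideal_def x'_def by blast
      obtain W where W: "W \<in> ET P1 k c1 d1 (carrier P1)"
        "mat_map P1 k (ev (x' \<oplus>\<^bsub>P1\<^esub> const_poly R b \<otimes>\<^bsub>P1\<^esub> y)) \<theta> = mat_mult P1 k W (mat_map P1 k (ev x') \<theta>)"
        using b x' xy unfolding patching_ideal_def by blast
      show ?thesis
        using ETm[OF W(1) V(1)] W V ETc[OF W(1)] ETc[OF V(1)] at_closed[OF xy(1)]
        by (intro bexI[of _ "mat_mult P1 k W V"]) (simp_all add: e P1.mat_mult_assoc)
    qed
    then show ?thesis using ab by (simp add: patching_ideal_def)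
  qed
  have zero: "\<zero> \<in> patching_ideal"
  proof -
    have "mat_map P1 k (ev (x \<oplus>\<^bsub>P1\<^esub> const_poly R \<zero> \<otimes>\<^bsub>P1\<^esub> y)) \<theta> = mat_mult P1 k (mat_one P1 k) (mat_map P1 k (ev x) \<theta>)"
      if "x \<in> carrier P1" "y \<in> carrier P1" for x y
      using that at_closed[OF that(1)] by simp
    then show ?thesis unfolding patching_ideal_def mem_Collect_eq using zero_closed
      by (intro conjI ballI bexI[of _ "mat_one P1 k"] ET.ET_one)
  qed
  have "\<ominus> a \<in> patching_ideal" if "a \<in> patching_ideal" for a
    using smult[OF that, of "\<ominus> \<one>"] that by (simp add: patching_ideal_def r_minus)
  then show "subgroup patching_ideal (add_monoid R)"
    using add zero by (intro add.subgroupI) (auto simp: patching_ideal_def a_inv_def)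
qed

text \<open>Dilation over \<open>R[X]\<close> in the new variable \<open>Y\<close> is applied to
  \<open>\<theta>(X + Y)\<close>. Specializing \<open>X\<close> and \<open>Y\<close> afterwards
  covers all pairs \<open>x\<close>, \<open>y\<close> with a single scalar.\<close>

lemma patching_ideal_not_subset:
  assumes m: "maximalideal m R"
    and loc: "mat_map (UP (loc R m)) k (UP_map (loc_map R m)) \<theta> \<in>
      ET (UP (loc R m)) k (\<lambda>i. const_poly (loc R m) (loc_map R m (c i))) (\<lambda>i. const_poly (loc R m) (loc_map R m (d i))) (carrier (UP (loc R m)))"
  shows "\<not> patching_ideal \<subseteq> m"
proof -
  have prime: "primeideal m R" using maximalideal_prime[OF m] .
  interpret pl: prime_localization R m
    by (intro prime_localization.intro prime_localization_axioms.intro is_cring prime)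
  let ?L = "loc R m" and ?l = "loc_map R m"
  let ?Q1 = "UP ?L" and ?Q2 = "UP (UP ?L)" and ?f = "UP_map ?l"
  interpret L0: localization R ?L ?l "carrier R - m" by (rule pl.localization_loc)
  interpret L1: localization P1 ?Q1 ?f "const_poly R ` (carrier R - m)" by (rule L0.localization_UP)
  interpret L2: localization P2 ?Q2 "UP_map ?f" "const_poly P1 ` const_poly R ` (carrier R - m)" by (rule L1.localization_UP)
  have "ideal m R" using m by (rule maximalideal.axioms(1))
  then interpret m: ideal m R .
  have "\<one> \<notin> m" using pl.D_one by auto
  then obtain j where j: "j < k" "c j \<otimes> d j \<notin> m" using dot_not_in_ideal[OF \<open>ideal m R\<close> cd] dot_cd by auto
  have cj: "c j \<in> carrier R" "d j \<in> carrier R" using j by (auto simp: vec_carrierD[OF cd(1)] vec_carrierD[OF cd(2)])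
  then have cj': "c j \<in> carrier R - m" "d j \<in> carrier R - m" using j m.I_l_closed m.I_r_closed by auto
  interpret C: ring_hom_cring R P1 "const_poly R" by (rule const_hom)
  interpret C1: ring_hom_cring P1 P2 "const_poly P1" by (rule L1.R.const_hom)
  interpret CL: ring_hom_cring ?L ?Q1 "const_poly ?L" by (rule L0.S.const_hom)
  interpret CL1: ring_hom_cring ?Q1 ?Q2 "const_poly ?Q1" by (rule L1.S.const_hom)
  interpret CC: ring_hom_cring R P2 "\<lambda>r. const_poly P1 (const_poly R r)" by (rule ring_hom_cring_comp[OF const_hom L1.R.const_hom])
  interpret CCL: ring_hom_cring ?L ?Q2 "\<lambda>r. const_poly ?Q1 (const_poly ?L r)" by (rule ring_hom_cring_comp[OF L0.S.const_hom L1.S.const_hom])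
  \<comment> \<open>The substitution of \<open>X + Y\<close> for \<open>X\<close>, over
    \<open>R\<close> and over its localization.\<close>
  define \<rho> where "\<rho> = poly_subst R P2 (\<lambda>r. const_poly P1 (const_poly R r)) (const_poly P1 (polyX R) \<oplus>\<^bsub>P2\<^esub> polyX P1)"
  define \<rho>L where "\<rho>L = poly_subst ?L ?Q2 (\<lambda>r. const_poly ?Q1 (const_poly ?L r)) (const_poly ?Q1 (polyX ?L) \<oplus>\<^bsub>?Q2\<^esub> polyX ?Q1)"
  have XY: "const_poly P1 (polyX R) \<oplus>\<^bsub>P2\<^esub> polyX P1 \<in> carrier P2" by simp
  have XYL: "const_poly ?Q1 (polyX ?L) \<oplus>\<^bsub>?Q2\<^esub> polyX ?Q1 \<in> carrier ?Q2" by simp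
  interpret s: ring_hom_cring P1 P2 \<rho> unfolding \<rho>_def by (rule CC.poly_subst_hom[OF XY])
  interpret sL: ring_hom_cring ?Q1 ?Q2 \<rho>L unfolding \<rho>L_def by (rule CCL.poly_subst_hom[OF XYL])
  have s_const: "\<rho> (const_poly R r) = const_poly P1 (const_poly R r)" if "r \<in> carrier R" for r
    unfolding \<rho>_def using that by (rule CC.poly_subst_const[OF XY])
  have s_X: "\<rho> (polyX R) = const_poly P1 (polyX R) \<oplus>\<^bsub>P2\<^esub> polyX P1" unfolding \<rho>_def by (rule CC.poly_subst_X[OF XY])
  have sL_const: "\<rho>L (const_poly ?L r) = const_poly ?Q1 (const_poly ?L r)" if "r \<in> carrier ?L" for r
    unfolding \<rho>L_def using that by (rule CCL.poly_subst_const[OF XYL])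
  have sL_X: "\<rho>L (polyX ?L) = const_poly ?Q1 (polyX ?L) \<oplus>\<^bsub>?Q2\<^esub> polyX ?Q1" unfolding \<rho>L_def by (rule CCL.poly_subst_X[OF XYL])
  have fX: "?f (polyX R) = polyX ?L" by (rule ext) (simp add: UP_map_def polyX_apply L0.S.polyX_apply)
  have fX1: "UP_map ?f (polyX P1) = polyX ?Q1" by (rule ext) (simp add: UP_map_def[of ?f] L1.R.polyX_apply L1.S.polyX_apply)
  have comm: "UP_map ?f (\<rho> p) = \<rho>L (?f p)" if "p \<in> carrier P1" for p
  proof (rule UP_hom_eq[OF is_cring, where p = p])
    show "ring_hom_cring P1 ?Q2 (\<lambda>p. UP_map ?f (\<rho> p))" by (rule ring_hom_cring_comp[OF s.ring_hom_cring_axioms L2.ring_hom_cring_axioms])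
    show "ring_hom_cring P1 ?Q2 (\<lambda>p. \<rho>L (?f p))" by (rule ring_hom_cring_comp[OF L1.ring_hom_cring_axioms sL.ring_hom_cring_axioms])
    show "UP_map ?f (\<rho> (const_poly R r)) = \<rho>L (?f (const_poly R r))" if "r \<in> carrier R" for r
      using that by (simp add: s_const L0.UP_map_const L1.UP_map_const sL_const)
    show "UP_map ?f (\<rho> (polyX R)) = \<rho>L (?f (polyX R))"
      by (simp add: s_X sL_X fX fX1 L1.UP_map_const)
  qed fact
  define \<Theta> where "\<Theta> = mat_map P2 k \<rho> \<theta>"
  have \<Theta>c: "\<Theta> \<in> mat_carrier P2 k" unfolding \<Theta>_def using \<theta> by simp
  have "mat_map ?Q2 k (UP_map ?f) \<Theta> = mat_map ?Q2 k \<rho>L (mat_map ?Q1 k ?f \<theta>)"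
    unfolding \<Theta>_def mat_map_mat_map by (rule mat_map_cong[OF \<theta>]) (rule comm)
  also have "\<dots> \<in> ET ?Q2 k (\<lambda>i. const_poly ?Q1 (?f (c1 i))) (\<lambda>i. const_poly ?Q1 (?f (d1 i))) (carrier ?Q2)"
    using vec_carrierD[OF cd(1)] vec_carrierD[OF cd(2)]
    by (intro sL.mat_map_ET_carrier[OF loc])
       (auto simp: vec_carrier_def sL_const L0.UP_map_const)
  finally have F\<Theta>: "mat_map ?Q2 k (UP_map ?f) \<Theta> \<in> ET ?Q2 k (\<lambda>i. const_poly ?Q1 (?f (c1 i))) (\<lambda>i. const_poly ?Q1 (?f (d1 i))) (carrier ?Q2)" .
  have dot1: "dot P1 k c1 d1 = \<one>\<^bsub>P1\<^esub>" using C.hom_dot[OF cd] dot_cd by simp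
  \<comment> \<open>Because the denominators over \<open>R[X]\<close> are constants, the scalar
    comes from an element of \<open>R\<close> outside \<open>m\<close>.\<close>
  obtain s0 V where s0: "s0 \<in> carrier R - m" and V: "V \<in> ET P2 k (\<lambda>i. const_poly P1 (c1 i)) (\<lambda>i. const_poly P1 (d1 i)) (carrier P2)"
     "mat_map P2 k (scale P1 (const_poly R s0)) \<Theta> = mat_mult P2 k V (mat_map P2 k (\<lambda>p. const_poly P1 (p 0)) \<Theta>)"
    using L1.dilation[OF c1_closed dot1 k j(1) imageI[OF cj'(1)] imageI[OF cj'(2)] \<Theta>c F\<Theta>] by blast
  have s0c: "s0 \<in> carrier R" using s0 by simp
  interpret pc: ring_hom_cring P2 P2 "\<lambda>p. const_poly P1 (p 0)" by (rule L1.R.const_zero_coeff_hom)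
  interpret sc: ring_hom_cring P2 P2 "scale P1 (const_poly R s0)" using s0c by (intro L1.R.scale_hom) simp
  have "s0 \<in> patching_ideal"
    unfolding patching_ideal_def
  proof (intro CollectI conjI ballI s0c)
    fix x y assume xy: "x \<in> carrier P1" "y \<in> carrier P1"
    interpret ax: ring_hom_cring P1 P1 "ev x" by (rule C.poly_subst_hom[OF xy(1)])
    \<comment> \<open>\<open>E\<close> sends \<open>X\<close> to \<open>x\<close> and
      \<open>Y\<close> to \<open>y\<close>. After \<open>Y\<close> has been scaled by
      \<open>s0\<close> it sends \<open>X + Y\<close> to \<open>x + s0 y\<close>, and after
      \<open>Y\<close> has been set to \<open>0\<close> it sends \<open>X + Y\<close> to
      \<open>x\<close>.\<close>
    define E where "E = poly_subst P1 P1 (ev x) y"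
    interpret E: ring_hom_cring P2 P1 E unfolding E_def by (rule ax.poly_subst_hom[OF xy(2)])
    define z where "z = x \<oplus>\<^bsub>P1\<^esub> const_poly R s0 \<otimes>\<^bsub>P1\<^esub> y"
    have z: "z \<in> carrier P1" using xy s0c by (simp add: z_def)
    have at_const: "ev w (const_poly R r) = const_poly R r" if "w \<in> carrier P1" "r \<in> carrier R" for w r
      using that by (rule C.poly_subst_const)
    have E_const: "E (const_poly P1 p) = ev x p" if "p \<in> carrier P1" for p
      unfolding E_def using xy(2) that by (rule ax.poly_subst_const)
    have E_X: "E (polyX P1) = y" unfolding E_def using xy(2) by (rule ax.poly_subst_X)
    have scX: "scale P1 (const_poly R s0) (polyX P1) = const_poly P1 (const_poly R s0) \<otimes>\<^bsub>P2\<^esub> polyX P1"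
      using s0c by (intro ext) (simp add: L1.R.const_mult_apply, simp add: scale_def L1.R.polyX_apply)
    have eq1: "E (scale P1 (const_poly R s0) (\<rho> p)) = ev z p" if "p \<in> carrier P1" for p
    proof (rule UP_hom_eq[OF is_cring, where p = p])
      show "ring_hom_cring P1 P1 (\<lambda>p. E (scale P1 (const_poly R s0) (\<rho> p)))"
        by (rule ring_hom_cring_comp[OF ring_hom_cring_comp[OF s.ring_hom_cring_axioms sc.ring_hom_cring_axioms] E.ring_hom_cring_axioms])
      show "ring_hom_cring P1 P1 (ev z)" by (rule C.poly_subst_hom[OF z])
      show "E (scale P1 (const_poly R s0) (\<rho> (const_poly R r))) = ev z (const_poly R r)" if "r \<in> carrier R" for r
        using that s0c xy z by (simp add: s_const L1.R.scale_const E_const at_const)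
      show "E (scale P1 (const_poly R s0) (\<rho> (polyX R))) = ev z (polyX R)"
        using s0c xy z C.poly_subst_X[OF z] C.poly_subst_X[OF xy(1)]
        by (simp add: s_X scX L1.R.scale_const E_const E_X at_const z_def)
    qed fact
    have eq2: "E (const_poly P1 (\<rho> p 0)) = ev x p" if "p \<in> carrier P1" for p
    proof (rule UP_hom_eq[OF is_cring, where p = p])
      show "ring_hom_cring P1 P1 (\<lambda>p. E (const_poly P1 (\<rho> p 0)))"
        by (rule ring_hom_cring_comp[OF ring_hom_cring_comp[OF s.ring_hom_cring_axioms pc.ring_hom_cring_axioms] E.ring_hom_cring_axioms])
      show "ring_hom_cring P1 P1 (ev x)" by (rule C.poly_subst_hom[OF xy(1)])
      show "E (const_poly P1 (\<rho> (const_poly R r) 0)) = ev x (const_poly R r)" if "r \<in> carrier R" for r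
        using that xy by (simp add: s_const L1.R.const_poly_apply E_const at_const)
      show "E (const_poly P1 (\<rho> (polyX R) 0)) = ev x (polyX R)"
        using xy by (simp add: s_X L1.R.UP_add_apply L1.R.const_poly_apply L1.R.polyX_apply E_const)
    qed fact
    have Vc: "V \<in> mat_carrier P2 k" using L2.R.ET_closed[OF C1.hom_vec_closed[OF c1_closed(1)] C1.hom_vec_closed[OF c1_closed(2)] subset_refl V(1)] .
    have "mat_map P1 k (ev z) \<theta> = mat_map P1 k E (mat_map P2 k (scale P1 (const_poly R s0)) \<Theta>)"
      unfolding \<Theta>_def mat_map_mat_map by (rule mat_map_cong[OF \<theta>]) (simp add: eq1)
    also have "\<dots> = mat_mult P1 k (mat_map P1 k E V) (mat_map P1 k E (mat_map P2 k (\<lambda>p. const_poly P1 (p 0)) \<Theta>))"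
      unfolding V(2) using Vc \<Theta>c by (simp add: E.mat_map_mult)
    also have "mat_map P1 k E (mat_map P2 k (\<lambda>p. const_poly P1 (p 0)) \<Theta>) = mat_map P1 k (ev x) \<theta>"
      unfolding \<Theta>_def mat_map_mat_map by (rule mat_map_cong[OF \<theta>]) (simp add: eq2)
    finally have "mat_map P1 k (ev z) \<theta> = mat_mult P1 k (mat_map P1 k E V) (mat_map P1 k (ev x) \<theta>)" .
    moreover have "mat_map P1 k E V \<in> ET P1 k c1 d1 (carrier P1)"
      using xy vec_carrierD[OF cd(1)] vec_carrierD[OF cd(2)]
      by (intro E.mat_map_ET_carrier[OF V(1)]) (auto simp: vec_carrier_def E_const at_const)
    ultimately show "\<exists>V\<in>ET P1 k c1 d1 (carrier P1).
       mat_map P1 k (ev (x \<oplus>\<^bsub>P1\<^esub> const_poly R s0 \<otimes>\<^bsub>P1\<^esub> y)) \<theta> = mat_mult P1 k V (mat_map P1 k (ev x) \<theta>)"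
      unfolding z_def by blast
  qed
  then show ?thesis using s0 by blast
qed

lemma ET_local_global:
  assumes \<theta>0: "\<And>i j. i < k \<Longrightarrow> j < k \<Longrightarrow> \<theta> i j 0 = (if i = j then \<one> else \<zero>)"
    and loc: "\<And>m. maximalideal m R \<Longrightarrow> mat_map (UP (loc R m)) k (UP_map (loc_map R m)) \<theta> \<in>
      ET (UP (loc R m)) k (\<lambda>i. const_poly (loc R m) (loc_map R m (c i))) (\<lambda>i. const_poly (loc R m) (loc_map R m (d i))) (carrier (UP (loc R m)))"
  shows "\<theta> \<in> ET P1 k c1 d1 (carrier P1)"
proof -
  interpret P1: cring P1 by (rule cring_UP[OF is_cring])
  interpret C: ring_hom_cring R P1 "const_poly R" by (rule const_hom)
  have "\<one> \<in> patching_ideal"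
    using exists_maximalideal[OF ideal_patching_ideal] patching_ideal_not_subset[OF _ loc] by blast
  then obtain V where V: "V \<in> ET P1 k c1 d1 (carrier P1)"
    "mat_map P1 k (ev (\<zero>\<^bsub>P1\<^esub> \<oplus>\<^bsub>P1\<^esub> const_poly R \<one> \<otimes>\<^bsub>P1\<^esub> polyX R)) \<theta> = mat_mult P1 k V (mat_map P1 k (ev \<zero>\<^bsub>P1\<^esub>) \<theta>)"
    unfolding patching_ideal_def using polyX_closed P1.zero_closed by blast
  have at_X: "ev (polyX R) p = p" if "p \<in> carrier P1" for p
  proof (rule UP_hom_eq[OF is_cring, where p = p])
    show "ring_hom_cring P1 P1 (ev (polyX R))" by (rule C.poly_subst_hom) simp
    show "ring_hom_cring P1 P1 (\<lambda>p. p)"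
      by (intro ring_hom_cringI P1.is_cring) (simp add: ring_hom_def)
    show "ev (polyX R) (const_poly R r) = const_poly R r" if "r \<in> carrier R" for r
      using that by (intro C.poly_subst_const) auto
    show "ev (polyX R) (polyX R) = polyX R" by (rule C.poly_subst_X) simp
  qed fact
  have at_0: "ev \<zero>\<^bsub>P1\<^esub> p = const_poly R (p 0)" if "p \<in> carrier P1" for p
  proof (rule UP_hom_eq[OF is_cring, where p = p])
    show "ring_hom_cring P1 P1 (ev \<zero>\<^bsub>P1\<^esub>)" by (rule C.poly_subst_hom) simp
    show "ring_hom_cring P1 P1 (\<lambda>p. const_poly R (p 0))" by (rule const_zero_coeff_hom)
    show "ev \<zero>\<^bsub>P1\<^esub> (const_poly R r) = const_poly R (const_poly R r 0)" if "r \<in> carrier R" for r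
      using that by (simp add: C.poly_subst_const const_poly_apply)
    show "ev \<zero>\<^bsub>P1\<^esub> (polyX R) = const_poly R (polyX R 0)" by (simp add: C.poly_subst_X polyX_apply)
  qed fact
  have "mat_map P1 k (ev (polyX R)) \<theta> = \<theta>"
    using mat_map_cong[OF \<theta>, of "ev (polyX R)" "\<lambda>p. p" P1] at_X mat_map_id[OF \<theta>] by simp
  moreover have "mat_map P1 k (ev \<zero>\<^bsub>P1\<^esub>) \<theta> = mat_one P1 k"
    using \<theta> \<theta>0 by (auto simp: mat_map_def mat_one_def fun_eq_iff at_0 P1.mat_carrier_entry)
  ultimately have "\<theta> = V" using V(2) P1.ET_closed[OF c1_closed subset_refl V(1)] by simp
  then show ?thesis using V(1) by simp
qed

end

end

text \<open>The image of \<open>\<psi>\<close> inverts the image of \<open>\<phi>\<close>, so the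
  two vectors over \<open>S\<close> are images of those over \<open>R\<close>. A single pair of
  vectors thus describes the groups over all rings involved.\<close>

lemma (in ring_hom_cring) E_phi_hom:
  assumes n: "n \<ge> 2" and \<phi>: "\<phi> \<in> mat_carrier R (2*n)" and \<psi>: "\<psi> \<in> mat_carrier R (2*n)"
    and inv: "mat_mult R (2*n) \<phi> \<psi> = mat_one R (2*n)" "mat_mult R (2*n) \<psi> \<phi> = mat_one R (2*n)"
    and zero: "\<phi> 0 0 = \<zero>" "\<psi> 0 0 = \<zero>"
    and skew: "\<And>i. i < 2*n \<Longrightarrow> \<phi> i 0 = \<ominus> \<phi> 0 i" "\<And>i. i < 2*n \<Longrightarrow> \<psi> i 0 = \<ominus> \<psi> 0 i"
  shows "E_phi S n (mat_map S (2*n) h \<phi>) =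
    ET S (2*n - 1) (\<lambda>i. h (\<ominus> \<phi> 0 (Suc i))) (\<lambda>i. h (\<psi> 0 (Suc i))) (carrier S)"
proof -
  let ?N = "2*n" and ?k = "2*n - 1"
  let ?c = "\<lambda>i. \<ominus>\<^bsub>S\<^esub> mat_map S ?N h \<phi> 0 (Suc i)" and ?d = "\<lambda>i. mat_map S ?N h \<psi> 0 (Suc i)"
  have m0: "mat_map S ?N h M 0 i = h (M 0 i)" "mat_map S ?N h M i 0 = h (M i 0)" if "i < ?N" for M i
    using that n by (auto simp: mat_map_def)
  have "E_phi S n (mat_map S ?N h \<phi>) = ET S ?k ?c ?d (carrier S)"
  proof (rule S.E_phi_eq_ET(1)[OF n])
    show "mat_map S ?N h \<phi> \<in> mat_carrier S ?N" "mat_map S ?N h \<psi> \<in> mat_carrier S ?N" using \<phi> \<psi> by auto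
    show "mat_mult S ?N (mat_map S ?N h \<phi>) (mat_map S ?N h \<psi>) = mat_one S ?N"
      using mat_map_mult[OF \<phi> \<psi>] inv by simp
    show "mat_mult S ?N (mat_map S ?N h \<psi>) (mat_map S ?N h \<phi>) = mat_one S ?N"
      using mat_map_mult[OF \<psi> \<phi>] inv by simp
    show "mat_map S ?N h \<phi> 0 0 = \<zero>\<^bsub>S\<^esub>" "mat_map S ?N h \<psi> 0 0 = \<zero>\<^bsub>S\<^esub>"
      using n zero by (auto simp: mat_map_def)
    show "mat_map S ?N h \<phi> i 0 = \<ominus>\<^bsub>S\<^esub> mat_map S ?N h \<phi> 0 i" if "i < ?N" for i
      unfolding m0[OF that] skew(1)[OF that] using \<phi> by simp
    show "mat_map S ?N h \<psi> i 0 = \<ominus>\<^bsub>S\<^esub> mat_map S ?N h \<psi> 0 i" if "i < ?N" for i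
      unfolding m0[OF that] skew(2)[OF that] using \<psi> by simp
  qed
  moreover
  have c: "?c i = h (\<ominus> \<phi> 0 (Suc i))" and d: "?d i = h (\<psi> 0 (Suc i))" if "i < ?k" for i
    using that \<phi> m0[of "Suc i"] by auto
  have v: "(\<lambda>i. h (\<ominus> \<phi> 0 (Suc i))) \<in> vec_carrier S ?k" "(\<lambda>i. h (\<psi> 0 (Suc i))) \<in> vec_carrier S ?k"
    using \<phi> \<psi> by (auto simp: vec_carrier_def)
  have v': "?c \<in> vec_carrier S ?k" "?d \<in> vec_carrier S ?k"
    using v c d by (auto simp: vec_carrier_def)
  have "ET S ?k ?c ?d (carrier S) = ET S ?k (\<lambda>i. h (\<ominus> \<phi> 0 (Suc i))) (\<lambda>i. h (\<psi> 0 (Suc i))) (carrier S)"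
    using S.ET_cong[OF _ v' subset_refl c d] S.ET_cong[OF _ v subset_refl c[symmetric] d[symmetric]] by blast
  ultimately show ?thesis by simp
qed

theorem theorem4p6:
  fixes R :: "('a, 'b) ring_scheme" and n :: nat
    and \<phi> :: "nat \<Rightarrow> nat \<Rightarrow> 'a" and \<theta> :: "nat \<Rightarrow> nat \<Rightarrow> (nat \<Rightarrow> 'a)"
  assumes "cring R"
    and "n \<ge> 2"
    and "alternating R (2*n) \<phi>"
    and "pfaffian R n \<phi> = \<one>\<^bsub>R\<^esub>"
    and "\<theta> \<in> SL (UP R) (2*n - 1)"
    and "\<forall>i<2*n - 1. \<forall>j<2*n - 1. \<theta> i j 0 = (if i = j then \<one>\<^bsub>R\<^esub> else \<zero>\<^bsub>R\<^esub>)"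
    and "\<forall>m. maximalideal m R \<longrightarrow>
           mat_map (UP (loc R m)) (2*n - 1) (poly_loc_map R m) \<theta>
             \<in> E_phi (UP (loc R m)) n (mat_map (UP (loc R m)) (2*n) (\<lambda>r. const_poly (loc R m) (loc_map R m r)) \<phi>)"
  shows "\<theta> \<in> E_phi (UP R) n (mat_map (UP R) (2*n) (const_poly R) \<phi>)"
proof -
  interpret cring R by fact
  let ?N = "2*n" and ?k = "2*n - 1"
  have \<phi>: "\<phi> \<in> mat_carrier R ?N" using assms(3) by (simp add: alternating_def)
  obtain \<psi> where \<psi>: "\<psi> \<in> mat_carrier R ?N" "mat_mult R ?N \<phi> \<psi> = mat_one R ?N" "mat_mult R ?N \<psi> \<phi> = mat_one R ?N"
    "\<And>i j. \<psi> i j = \<ominus>\<^bsub>R\<^esub> \<psi> j i"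
    using pfaffian_one_invertible[OF assms(3,4)] by blast
  have alt: "alt R ?N \<phi>" using assms(3) by (rule alternating_alt)
  define c d where "c i = \<ominus>\<^bsub>R\<^esub> \<phi> 0 (Suc i)" and "d i = \<psi> 0 (Suc i)" for i
  have cd: "c \<in> vec_carrier R ?k" "d \<in> vec_carrier R ?k" using \<phi> \<psi>(1) by (auto simp: c_def d_def vec_carrier_def)
  have zero: "\<phi> 0 0 = \<zero>\<^bsub>R\<^esub>" "\<psi> 0 0 = \<zero>\<^bsub>R\<^esub>"
    using alt_diag[OF alt] alternating_inverse_diag[OF assms(3) \<psi>(1,4,2)] assms(2) by auto
  have skew: "\<phi> i 0 = \<ominus>\<^bsub>R\<^esub> \<phi> 0 i" if "i < ?N" for i using alt_neg[OF alt, of 0 i] that assms(2) by simp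
  have dot: "dot R ?k c d = \<one>\<^bsub>R\<^esub>"
    unfolding c_def[abs_def] d_def[abs_def]
    by (rule E_phi_eq_ET(2)[OF assms(2) \<phi> \<psi>(1,2,3) zero skew \<psi>(4)])
  \<comment> \<open>Used for the map to \<open>R[X]\<close> in the conclusion and for the maps to
    the localized polynomial rings in the hypothesis.\<close>
  have E: "E_phi S n (mat_map S ?N h \<phi>) = ET S ?k (\<lambda>i. h (c i)) (\<lambda>i. h (d i)) (carrier S)"
    if "ring_hom_cring R S h" for S :: "(nat \<Rightarrow> 'e, 'f) ring_scheme" and h
    unfolding c_def d_def
    by (rule ring_hom_cring.E_phi_hom[OF that assms(2) \<phi> \<psi>(1,2,3) zero skew \<psi>(4)])
  have "\<theta> \<in> ET (UP R) ?k (\<lambda>i. const_poly R (c i)) (\<lambda>i. const_poly R (d i)) (carrier (UP R))"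
  proof (rule ET_local_global[OF cd dot])
    show "3 \<le> ?k" using assms(2) by simp
    show "\<theta> \<in> mat_carrier (UP R) ?k" using assms(5) by (simp add: SL_def)
    show "\<theta> i j 0 = (if i = j then \<one>\<^bsub>R\<^esub> else \<zero>\<^bsub>R\<^esub>)" if "i < ?k" "j < ?k" for i j using assms(6) that by blast
    fix m assume m: "maximalideal m R"
    interpret pl: prime_localization R m
      by (intro prime_localization.intro prime_localization_axioms.intro is_cring maximalideal_prime[OF m])
    interpret L0: localization R "loc R m" "loc_map R m" "carrier R - m" by (rule pl.localization_loc)
    have hom: "ring_hom_cring R (UP (loc R m)) (\<lambda>r. const_poly (loc R m) (loc_map R m r))"
      by (rule ring_hom_cring_comp[OF L0.ring_hom_cring_axioms L0.S.const_hom])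
    have pm: "poly_loc_map R m = UP_map (loc_map R m)" by (intro ext) (simp add: poly_loc_map_def UP_map_def)
    show "mat_map (UP (loc R m)) ?k (UP_map (loc_map R m)) \<theta> \<in>
      ET (UP (loc R m)) ?k (\<lambda>i. const_poly (loc R m) (loc_map R m (c i))) (\<lambda>i. const_poly (loc R m) (loc_map R m (d i))) (carrier (UP (loc R m)))"
      using assms(7)[rule_format, OF m] unfolding pm E[OF hom] .
  qed
  then show ?thesis using E[OF const_hom] by simp
qed

end
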